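(* Let $Q$ be an external potential which is $C^2$-smooth in a neighbourhood of its droplet $S$ and which satisfies conditions (1)-(4) listed in the context. Let $c>0$. Then there exists a constant $s_0=s_0(c)>0$ (depending only on $Q$ and $c$) such that for every sequence of inverse temperatures $(\beta_n)_{n\ge 1}$ with $$\beta_n\ge c\log n\qquad (n\ge 1),$$ almost every family $\boldsymbol{\zeta}=(\boldsymbol{\zeta}_n)_{n\ge 1}$, picked randomly with respect to the measure $\mathbf{P}=\prod_{n=1}^\infty \mathbf{P}_n^{\beta_n}$, is $s_0$-separated, i.e. $$\liminf_{n\to\infty} \mathrm{s}_n(\boldsymbol{\zeta}_n)\ge s_0,\qquad \text{almost surely.}$$
   Context: Conventions: $dA=\frac1\pi\,dx\,dy$ on $\mathbb{C}$, $dA_n=(dA)^{\otimes n}$ on $\mathbb{C}^n$, and $\Delta=\partial\overline{\partial}=\frac14(\partial_{xx}+\partial_{yy})$. External potential: a lower semicontinuous function $Q:\mathbb{C}\to\mathbb{R}\cup\{+\infty\}$, finite on some set of positive capacity, with $\liminf_{\zeta\to\infty}\frac{Q(\zeta)}{2\log|\zeta|}>1$. Equilibrium measure and droplet: there is a unique probability measure $\sigma$ minimizing $$I_Q[\mu]=\int_{\mathbb{C}^2}\log\frac1{|\zeta-\eta|}\,d\mu(\zeta)\,d\mu(\eta)+\int Q\,d\mu$$ over all compactly supported Borel probability measures $\mu$ on $\mathbb{C}$. The droplet is $S=\operatorname{supp}\sigma$. Conditions on $Q$: (1) $\Delta Q>0$ in a neighbourhood of $\partial S$. (2) $\partial S$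 has finitely many connected components. (3) Each boundary component is an everywhere $C^1$-smooth Jordan curve. (4) For every $\zeta\in\mathbb{C}\setminus S$, $Q(\zeta)>\sup\{f(\zeta): f\in\mathcal{F}_Q\}$, where $\mathcal{F}_Q$ is the class of subharmonic functions $f$ on $\mathbb{C}$ with $f\le Q$ everywhere and $f(\zeta)\le\log|\zeta|^2+O(1)$ as $|\zeta|\to\infty$. Coulomb gas: for $(\zeta_1,\dots,\zeta_n)\in\mathbb{C}^n$ put $$H_n=\sum_{j\ne k}\log\frac1{|\zeta_j-\zeta_k|}+n\sum_{j=1}^nQ(\zeta_j),$$ and for $\beta>0$ let $d\mathbf{P}_n^{\beta}=\frac1{Z_n^{\beta}}e^{-\beta H_n}\,dA_n$ be the Boltzmann-Gibbs probability measure on $\mathbb{C}^n$, with $Z_n^\beta$ the normalizing constant. All inverse temperatures $\beta_n$ are strictly positive and such that $0<Z_n^{\beta_n}<\infty$. Families: a family is a sequence $\boldsymbol{\zeta}=(\boldsymbol{\zeta}_n)_{n\ge1}$ of configurations $\boldsymbol{\zeta}_n=\{\zeta_{nj}\}_{j=1}^n$; it is random with respect to the product measure $\mathbf{P}=\prod_{n=1}^\infty\mathbf{P}_n^{\beta_n}$ on $\prod_{n=1}^\infty\mathbb{C}^n$. Spacing: $\mathrm{s}_n(\boldsymbol{\zeta}_n)=\sqrt n\cdot\min\{|\zeta_{nj}-\zeta_{nk}|: j\ne k\}$. *)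

theory Defs
  imports "HOL-Probability.Probability"
begin

section \<open>Extended-real integration\<close>

text \<open>Integral of an extended-real function as positive part minus negative part. It is used only
  where one of the two parts is finite, so the convention for \<^term>\<open>\<infinity> - (\<infinity>::ereal)\<close> plays no role.\<close>

definition ereal_integral :: "'a measure \<Rightarrow> ('a \<Rightarrow> ereal) \<Rightarrow> ereal" where
  "ereal_integral M f =
     enn2ereal (\<integral>\<^sup>+x. e2ennreal (f x) \<partial>M) - enn2ereal (\<integral>\<^sup>+x. e2ennreal (- f x) \<partial>M)"

definition ereal_exp :: "ereal \<Rightarrow> ennreal" where
  "ereal_exp x =
     (if x = \<infinity> then \<infinity> else if x = - \<infinity> then 0 else ennreal (exp (real_of_ereal x)))"

section \<open>Logarithmic potential theory\<close>

definition log_kernel :: "complex \<Rightarrow> complex \<Rightarrow> ereal" where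
  "log_kernel z w = (if z = w then \<infinity> else ereal (ln (1 / cmod (z - w))))"

definition log_energy :: "complex measure \<Rightarrow> ereal" where
  "log_energy \<mu> = ereal_integral (\<mu> \<Otimes>\<^sub>M \<mu>) (\<lambda>(z, w). log_kernel z w)"

definition measure_support :: "'a::topological_space measure \<Rightarrow> 'a set" where
  "measure_support \<mu> = {x. \<forall>U. open U \<and> x \<in> U \<longrightarrow> emeasure \<mu> U > 0}"

definition compact_prob_measure :: "complex measure \<Rightarrow> bool" where
  "compact_prob_measure \<mu> \<longleftrightarrow>
     prob_space \<mu> \<and> sets \<mu> = sets borel \<and> compact (measure_support \<mu>)"

definition log_capacity :: "complex set \<Rightarrow> ennreal" where
  "log_capacity E =
     (SUP \<mu> \<in> {\<mu>. compact_prob_measure \<mu> \<and> measure_support \<mu> \<subseteq> E}. ereal_exp (- log_energy \<mu>))"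

definition subharmonic :: "(complex \<Rightarrow> ereal) \<Rightarrow> bool" where
  "subharmonic f \<longleftrightarrow>
     (\<forall>z. f z < \<infinity>) \<and>
     (\<forall>a. open {z. f z < a}) \<and>
     (\<forall>z. \<exists>\<rho>>0. \<forall>r. 0 \<le> r \<and> r < \<rho> \<longrightarrow>
        f z \<le> ereal (1 / (2 * pi)) *
          ereal_integral (restrict_space lborel {0..2 * pi}) (\<lambda>t. f (z + complex_of_real r * cis t)))"

section \<open>External potentials, equilibrium measure, droplet\<close>

definition external_potential :: "(complex \<Rightarrow> ereal) \<Rightarrow> bool" where
  "external_potential Q \<longleftrightarrow>
     (\<forall>z. Q z \<noteq> - \<infinity>) \<and>
     (\<forall>a. open {z. Q z > a}) \<and>
     (\<exists>E. log_capacity E > 0 \<and> (\<forall>z\<in>E. Q z < \<infinity>)) \<and>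
     Liminf at_infinity (\<lambda>z. Q z / ereal (2 * ln (cmod z))) > 1"

definition weighted_energy :: "(complex \<Rightarrow> ereal) \<Rightarrow> complex measure \<Rightarrow> ereal" where
  "weighted_energy Q \<mu> = log_energy \<mu> + ereal_integral \<mu> Q"

definition equilibrium_measure :: "(complex \<Rightarrow> ereal) \<Rightarrow> complex measure \<Rightarrow> bool" where
  "equilibrium_measure Q \<sigma> \<longleftrightarrow>
     compact_prob_measure \<sigma> \<and>
     (\<forall>\<mu>. compact_prob_measure \<mu> \<longrightarrow> weighted_energy Q \<sigma> \<le> weighted_energy Q \<mu>)"

section \<open>Regularity of the potential and of the droplet\<close>

text \<open>\<open>f'\<close> and \<open>f''\<close> are the first and second Frechet derivatives over the reals.\<close>

definition C2_smooth_on :: "(complex \<Rightarrow> real) \<Rightarrow> complex set \<Rightarrow> bool" where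
  "C2_smooth_on f U \<longleftrightarrow>
     (\<exists>(f' :: complex \<Rightarrow> complex \<Rightarrow>\<^sub>L real) (f'' :: complex \<Rightarrow> complex \<Rightarrow>\<^sub>L complex \<Rightarrow>\<^sub>L real).
        (\<forall>z\<in>U. (f has_derivative blinfun_apply (f' z)) (at z)) \<and>
        (\<forall>z\<in>U. (f' has_derivative blinfun_apply (f'' z)) (at z)) \<and>
        continuous_on U f'')"

definition C2_near :: "(complex \<Rightarrow> ereal) \<Rightarrow> complex set \<Rightarrow> bool" where
  "C2_near Q S \<longleftrightarrow>
     (\<exists>U. open U \<and> S \<subseteq> U \<and> (\<forall>z\<in>U. Q z < \<infinity>) \<and> C2_smooth_on (\<lambda>z. real_of_ereal (Q z)) U)"

definition partial_x :: "(complex \<Rightarrow> real) \<Rightarrow> complex \<Rightarrow> real" where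
  "partial_x f z = deriv (\<lambda>t::real. f (z + complex_of_real t)) 0"

definition partial_y :: "(complex \<Rightarrow> real) \<Rightarrow> complex \<Rightarrow> real" where
  "partial_y f z = deriv (\<lambda>t::real. f (z + \<i> * complex_of_real t)) 0"

text \<open>Normalized as \<open>\<partial>\<partial>\<close>-bar, i.e. one quarter of the standard Laplacian.\<close>

definition laplacian :: "(complex \<Rightarrow> real) \<Rightarrow> complex \<Rightarrow> real" where
  "laplacian f z = (partial_x (partial_x f) z + partial_y (partial_y f) z) / 4"

definition laplacian_pos_near :: "(complex \<Rightarrow> ereal) \<Rightarrow> complex set \<Rightarrow> bool" where
  "laplacian_pos_near Q A \<longleftrightarrow>
     (\<exists>V. open V \<and> A \<subseteq> V \<and> (\<forall>z\<in>V. laplacian (\<lambda>z. real_of_ereal (Q z)) z > 0))"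

text \<open>The parametrization is regular (nonvanishing derivative), also across the base point, so that
  corners and cusps are excluded.\<close>

definition C1_jordan_curve :: "complex set \<Rightarrow> bool" where
  "C1_jordan_curve C \<longleftrightarrow>
     (\<exists>\<gamma> \<gamma>'. simple_path \<gamma> \<and> pathfinish \<gamma> = pathstart \<gamma> \<and> path_image \<gamma> = C \<and>
        (\<forall>t\<in>{0..1}. (\<gamma> has_vector_derivative \<gamma>' t) (at t within {0..1})) \<and>
        continuous_on {0..1} \<gamma>' \<and> (\<forall>t\<in>{0..1}. \<gamma>' t \<noteq> 0) \<and> \<gamma>' 0 = \<gamma>' 1)"

definition obstacle_class :: "(complex \<Rightarrow> ereal) \<Rightarrow> (complex \<Rightarrow> ereal) set" where
  "obstacle_class Q =
     {f. subharmonic f \<and> (\<forall>z. f z \<le> Q z) \<and>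
         (\<exists>C. \<forall>\<^sub>F z in at_infinity. f z \<le> ereal (ln ((cmod z)\<^sup>2) + C))}"

section \<open>The Coulomb gas\<close>

text \<open>A configuration of \<open>n\<close> points is a function on \<open>{1..n}\<close>.\<close>

definition dA :: "complex measure" where
  "dA = density lborel (\<lambda>_. ennreal (1 / pi))"

definition dA_n :: "nat \<Rightarrow> (nat \<Rightarrow> complex) measure" where
  "dA_n n = (\<Pi>\<^sub>M j\<in>{1..n}. dA)"

definition hamiltonian :: "(complex \<Rightarrow> ereal) \<Rightarrow> nat \<Rightarrow> (nat \<Rightarrow> complex) \<Rightarrow> ereal" where
  "hamiltonian Q n \<zeta> =
     (\<Sum>j\<in>{1..n}. \<Sum>k\<in>{1..n} - {j}. log_kernel (\<zeta> j) (\<zeta> k)) + ereal (real n) * (\<Sum>j\<in>{1..n}. Q (\<zeta> j))"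

definition boltzmann_weight ::
    "(complex \<Rightarrow> ereal) \<Rightarrow> real \<Rightarrow> nat \<Rightarrow> (nat \<Rightarrow> complex) \<Rightarrow> ennreal" where
  "boltzmann_weight Q \<beta> n \<zeta> = ereal_exp (- (ereal \<beta> * hamiltonian Q n \<zeta>))"

definition partition_function :: "(complex \<Rightarrow> ereal) \<Rightarrow> real \<Rightarrow> nat \<Rightarrow> ennreal" where
  "partition_function Q \<beta> n = (\<integral>\<^sup>+\<zeta>. boltzmann_weight Q \<beta> n \<zeta> \<partial>dA_n n)"

definition gibbs_measure ::
    "(complex \<Rightarrow> ereal) \<Rightarrow> real \<Rightarrow> nat \<Rightarrow> (nat \<Rightarrow> complex) measure" where
  "gibbs_measure Q \<beta> n =
     density (dA_n n) (\<lambda>\<zeta>. boltzmann_weight Q \<beta> n \<zeta> / partition_function Q \<beta> n)"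

definition admissible_temperatures :: "(complex \<Rightarrow> ereal) \<Rightarrow> (nat \<Rightarrow> real) \<Rightarrow> bool" where
  "admissible_temperatures Q \<beta> \<longleftrightarrow>
     (\<forall>n\<ge>1. \<beta> n > 0 \<and> 0 < partition_function Q (\<beta> n) n \<and> partition_function Q (\<beta> n) n < \<infinity>)"

text \<open>A family is a function \<open>\<zeta>\<close> with \<open>\<zeta> n j\<close> the \<open>j\<close>-th point of the \<open>n\<close>-th configuration.\<close>

definition family_measure ::
    "(complex \<Rightarrow> ereal) \<Rightarrow> (nat \<Rightarrow> real) \<Rightarrow> (nat \<Rightarrow> nat \<Rightarrow> complex) measure" where
  "family_measure Q \<beta> = (\<Pi>\<^sub>M n\<in>{1..}. gibbs_measure Q (\<beta> n) n)"

text \<open>Meaningful for \<open>n \<ge> 2\<close> only, since otherwise the minimum is over the empty set.\<close>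

definition spacing :: "nat \<Rightarrow> (nat \<Rightarrow> complex) \<Rightarrow> real" where
  "spacing n \<zeta> = sqrt (real n) * Min {cmod (\<zeta> j - \<zeta> k) | j k. j \<in> {1..n} \<and> k \<in> {1..n} \<and> j \<noteq> k}"

end

theory Submission
  imports Defs "HOL-Complex_Analysis.Complex_Analysis"
begin

text \<open>
  Fix all points but \<open>\<zeta>\<^sub>j\<close>, and let \<open>p\<close> be the monic polynomial vanishing at them. The conditional density
  of \<open>\<zeta>\<^sub>j\<close> is proportional to \<open>G\<^sup>\<beta>\<close> with \<open>G = |p|\<^sup>2 e\<^sup>-\<^sup>n\<^sup>Q\<close>. The conditional probability that
  \<open>\<zeta>\<^sub>j\<close> lies in a bounded neighbourhood \<open>N\<close> of the droplet while \<open>G(\<zeta>\<^sub>j)\<^sup>\<beta> < n\<^sup>-\<^sup>3 \<integral> G\<^sup>\<beta>\<close> is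
  trivially at most \<open>|N| n\<^sup>-\<^sup>3\<close>. Since \<open>Q\<close> is \<open>C\<^sup>2\<close> near the droplet, at the scale \<open>n\<^sup>-\<^sup>1\<^sup>/\<^sup>2\<close> the function
  \<open>G\<close> is comparable to \<open>|g|\<^sup>2\<close> with \<open>g\<close> entire, so the sub-mean value property bounds \<open>G\<^sup>\<beta>\<close> there by
  \<open>n e\<^sup>A\<^sup>\<beta> \<integral> G\<^sup>\<beta>\<close>. Outside the exceptional event, \<open>\<beta> \<ge> c log n\<close> turns the factor
  \<open>(n\<^sup>4)\<^sup>1\<^sup>/\<^sup>\<beta>\<close> into a constant, whence \<open>|g| \<le> C |g(\<zeta>\<^sub>j)|\<close> on the disc of radius
  \<open>n\<^sup>-\<^sup>1\<^sup>/\<^sup>2\<close> about \<open>\<zeta>\<^sub>j\<close>; as \<open>g(\<zeta>\<^sub>k) = 0\<close>, the maximum principle for \<open>g(w) / (w - \<zeta>\<^sub>k)\<close> keeps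
  \<open>\<zeta>\<^sub>k\<close> at distance of order \<open>n\<^sup>-\<^sup>1\<^sup>/\<^sup>2\<close>.

  That no point lies outside \<open>N\<close> comes from condition (4). Normalize \<open>G\<close> by its supremum \<open>M\<close>; then
  \<open>(1/n) log (|p|\<^sup>2 / M)\<close> belongs to the obstacle class, so \<open>G \<le> M q\<^sup>n\<close> off \<open>N\<close> for some \<open>q < 1\<close>, as soon as the
  pointwise gap in condition (4) is known to be locally uniform. Then \<open>M\<close> is nearly attained in \<open>N\<close>, and the
  sub-mean value property compares \<open>M\<^sup>\<beta>\<close> with \<open>\<integral> G\<^sup>\<beta>\<close>. Summing the probabilities,
  the Borel-Cantelli lemma concludes.
\<close>

section \<open>Mean values of entire functions\<close>

lemma borel_measurable_Complex [measurable (raw)]: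
  assumes [measurable]: "f \<in> borel_measurable M" "g \<in> borel_measurable M"
  shows "(\<lambda>x. Complex (f x) (g x)) \<in> borel_measurable M"
  unfolding Complex_eq by measurable

lemma lborel_complex_eq_distr:
  "(lborel :: complex measure) =
     distr (lborel \<Otimes>\<^sub>M lborel) borel (\<lambda>(x, y). Complex x y)"
proof (rule lborel_eqI)
  fix l u :: complex
  assume lu: "\<And>b. b \<in> Basis \<Longrightarrow> l \<bullet> b \<le> u \<bullet> b"
  have le: "Re l \<le> Re u" "Im l \<le> Im u"
    using lu[of 1] lu[of \<i>] by (auto simp: Basis_complex_def)
  have eq: "(\<lambda>(x, y). Complex x y) -` box l u \<inter> space (lborel \<Otimes>\<^sub>M lborel)
      = {Re l<..<Re u} \<times> {Im l<..<Im u}"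
    by (auto simp: space_pair_measure box_def Basis_complex_def)
  have "emeasure (distr (lborel \<Otimes>\<^sub>M lborel) borel (\<lambda>(x, y). Complex x y)) (box l u)
      = emeasure (lborel \<Otimes>\<^sub>M lborel) ({Re l<..<Re u} \<times> {Im l<..<Im u})"
    by (subst emeasure_distr) (auto simp: eq)
  also have "\<dots> = ennreal (Re u - Re l) * ennreal (Im u - Im l)"
    using le by (subst lborel.emeasure_pair_measure_Times) auto
  also have "\<dots> = ennreal (\<Prod>b\<in>Basis. (u - l) \<bullet> b)"
    using le by (simp add: Basis_complex_def ennreal_mult)
  finally show "emeasure (distr (lborel \<Otimes>\<^sub>M lborel) borel (\<lambda>(x, y). Complex x y)) (box l u)
      = (\<Prod>b\<in>Basis. (u - l) \<bullet> b)" .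
qed simp

lemma nn_integral_complex:
  assumes [measurable]: "f \<in> borel_measurable borel"
  shows "(\<integral>\<^sup>+z. f z \<partial>(lborel :: complex measure)) = (\<integral>\<^sup>+x. \<integral>\<^sup>+y. f (Complex x y) \<partial>lborel \<partial>lborel)"
    and "(\<integral>\<^sup>+z. f z \<partial>(lborel :: complex measure)) = (\<integral>\<^sup>+y. \<integral>\<^sup>+x. f (Complex x y) \<partial>lborel \<partial>lborel)"
proof -
  have 1: "(\<integral>\<^sup>+z. f z \<partial>(lborel :: complex measure))
      = (\<integral>\<^sup>+p. f (Complex (fst p) (snd p)) \<partial>(lborel \<Otimes>\<^sub>M lborel))"
    by (subst lborel_complex_eq_distr, subst nn_integral_distr) (auto simp: split_beta)
  show "(\<integral>\<^sup>+z. f z \<partial>(lborel :: complex measure)) = (\<integral>\<^sup>+x. \<integral>\<^sup>+y. f (Complex x y) \<partial>lborel \<partial>lborel)"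
    unfolding 1 by (subst lborel.nn_integral_fst[symmetric]) auto
  show "(\<integral>\<^sup>+z. f z \<partial>(lborel :: complex measure)) = (\<integral>\<^sup>+y. \<integral>\<^sup>+x. f (Complex x y) \<partial>lborel \<partial>lborel)"
    unfolding 1 by (subst lborel_pair.nn_integral_snd[symmetric]) auto
qed

text \<open>A rotation with nonzero cosine factors into two affine maps, each changing one
  coordinate while the other is held fixed. The one-dimensional substitutions contribute 1/|cos t|
  and |cos t|, which cancel after exchanging the order of integration.\<close>

lemma nn_integral_cis_mult_cos_nonzero:
  assumes [measurable]: "f \<in> borel_measurable borel" and t: "cos t \<noteq> 0"
  shows "(\<integral>\<^sup>+z. f (cis t * z) \<partial>lborel) = (\<integral>\<^sup>+z. f z \<partial>(lborel :: complex measure))"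
proof -
  let ?c = "cos t" and ?s = "sin t"
  have inner: "(\<integral>\<^sup>+x. f (cis t * Complex x y) \<partial>lborel)
      = ennreal (1 / \<bar>?c\<bar>) * (\<integral>\<^sup>+x. f (Complex x ((?s / ?c) * x + (1 / ?c) * y)) \<partial>lborel)" for y
  proof -
    have eq: "cis t * Complex x y
       = Complex (- ?s * y + ?c * x) ((?s / ?c) * (- ?s * y + ?c * x) + (1 / ?c) * y)" for x
    proof -
      have "(?s / ?c) * (- ?s * y + ?c * x) + (1 / ?c) * y = ?s * x + y * ((1 - ?s * ?s) / ?c)"
        using t by (simp add: field_simps)
      also have "(1 - ?s * ?s) / ?c = ?c"
        using t sin_cos_squared_add[of t] by (simp add: field_simps power2_eq_square)
      finally show ?thesis
        by (auto simp: complex_eq_iff algebra_simps)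
    qed
    have "(\<integral>\<^sup>+x. f (Complex x ((?s / ?c) * x + (1 / ?c) * y)) \<partial>lborel)
       = ennreal \<bar>?c\<bar> * (\<integral>\<^sup>+x. f (cis t * Complex x y) \<partial>lborel)"
      unfolding eq by (subst nn_integral_real_affine[where t="- ?s * y" and c="?c"]) (use t in auto)
    then show ?thesis
      using t by (simp add: mult.assoc[symmetric] ennreal_mult[symmetric])
  qed
  have "(\<integral>\<^sup>+z. f (cis t * z) \<partial>lborel)
      = (\<integral>\<^sup>+y. ennreal (1 / \<bar>?c\<bar>) * (\<integral>\<^sup>+x. f (Complex x ((?s / ?c) * x + (1 / ?c) * y)) \<partial>lborel) \<partial>lborel)"
    by (subst nn_integral_complex(2)) (auto simp: inner)
  also have "\<dots> = ennreal (1 / \<bar>?c\<bar>) *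
      (\<integral>\<^sup>+y. \<integral>\<^sup>+x. f (Complex x ((?s / ?c) * x + (1 / ?c) * y)) \<partial>lborel \<partial>lborel)"
    by (rule nn_integral_cmult) auto
  also have "(\<integral>\<^sup>+y. \<integral>\<^sup>+x. f (Complex x ((?s / ?c) * x + (1 / ?c) * y)) \<partial>lborel \<partial>lborel)
     = (\<integral>\<^sup>+x. \<integral>\<^sup>+y. f (Complex x ((?s / ?c) * x + (1 / ?c) * y)) \<partial>lborel \<partial>lborel)"
    by (rule lborel_pair.Fubini') auto
  also have "\<dots> = (\<integral>\<^sup>+x. ennreal \<bar>?c\<bar> * (\<integral>\<^sup>+y. f (Complex x y) \<partial>lborel) \<partial>lborel)"
  proof (rule nn_integral_cong)
    fix x
    have "(\<integral>\<^sup>+y. f (Complex x y) \<partial>lborel)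
       = ennreal \<bar>1 / ?c\<bar> * (\<integral>\<^sup>+y. f (Complex x ((?s / ?c) * x + (1 / ?c) * y)) \<partial>lborel)"
      by (subst nn_integral_real_affine[where t="?s / ?c * x" and c="1 / ?c"]) (use t in auto)
    then show "(\<integral>\<^sup>+y. f (Complex x ((?s / ?c) * x + (1 / ?c) * y)) \<partial>lborel)
        = ennreal \<bar>?c\<bar> * (\<integral>\<^sup>+y. f (Complex x y) \<partial>lborel)"
      using t by (simp add: mult.assoc[symmetric] ennreal_mult[symmetric] del: times_divide_eq_left)
  qed
  also have "\<dots> = ennreal \<bar>?c\<bar> * (\<integral>\<^sup>+z. f z \<partial>(lborel :: complex measure))"
    by (subst nn_integral_complex(1)) (auto intro!: nn_integral_cmult)
  finally show ?thesis
    using t by (simp add: mult.assoc[symmetric] ennreal_mult[symmetric])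
qed

section \<open>Mean value inequalities for powers of the modulus\<close>

lemma circle_mean_holomorphic:
  fixes g :: "complex \<Rightarrow> complex"
  assumes g: "g holomorphic_on ball z R" and r: "0 \<le> r" "r < R"
  shows "((\<lambda>t. g (z + of_real r * cis t)) has_integral (2 * pi * g z)) {0..2 * pi}"
proof (cases "r = 0")
  case True
  show ?thesis
    using has_integral_const_real[of "g z" 0 "2 * pi"] True by (simp add: scaleR_conv_of_real)
next
  case False
  with r have r0: "r > 0" by simp
  have "g holomorphic_on cball z r"
    by (rule holomorphic_on_subset[OF g]) (use r in auto)
  then have "((\<lambda>u. g u / (u - z)) has_contour_integral (2 * of_real pi * \<i> * g z)) (circlepath z r)"
    using r0 by (intro Cauchy_integral_circlepath_simple) auto
  then have "((\<lambda>t. g (z + of_real r * cis t) / (z + of_real r * cis t - z) * r * \<i> * cis t)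
      has_integral (2 * of_real pi * \<i> * g z)) {0..2 * pi}"
    unfolding circlepath_def
    by (subst (asm) has_contour_integral_part_circlepath_iff) auto
  also have "(\<lambda>t. g (z + of_real r * cis t) / (z + of_real r * cis t - z) * r * \<i> * cis t)
     = (\<lambda>t. \<i> * g (z + of_real r * cis t))"
    using r0 by (auto simp: field_simps)
  finally have "((\<lambda>t. (- \<i>) * (\<i> * g (z + of_real r * cis t))) has_integral
     ((- \<i>) * (2 * of_real pi * \<i> * g z))) {0..2 * pi}"
    by (rule has_integral_mult_right)
  moreover have "(- \<i>) * (2 * of_real pi * \<i> * g z) = 2 * pi * g z"
    by (simp add: algebra_simps)
  moreover have "(\<lambda>t. (- \<i>) * (\<i> * g (z + of_real r * cis t))) = (\<lambda>t. g (z + of_real r * cis t))"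
    by (simp add: mult.assoc[symmetric])
  ultimately show ?thesis by (simp only:)
qed

text \<open>Convexity of the power function, used below in place of Jensen's inequality. The tangent
  argument runs on the open half-line, so \<open>x = 0\<close> is handled by direct
  computation.\<close>

lemma powr_tangent_le:
  fixes x a p :: real
  assumes "x \<ge> 0" "a > 0" "p \<ge> 1"
  shows "a powr p + p * a powr (p - 1) * (x - a) \<le> x powr p"
proof (cases "x = 0")
  case True
  have "a powr p = a powr (p - 1) * a"
    using assms by (simp add: powr_diff)
  moreover have "a powr (p - 1) * a \<le> p * (a powr (p - 1) * a)"
    using assms using mult_right_mono[of 1 p "a powr (p - 1) * a"] by simp
  ultimately show ?thesis using True assms by (simp add: algebra_simps)
next
  case False
  then have x: "x > 0" using assms by simp
  have "convex_on {0<..} (\<lambda>x::real. x powr p)"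
    using assms by (intro powr_convex) auto
  then have "x powr p - a powr p \<ge> (p * a powr (p - 1)) * (x - a)"
    using assms x
    by (intro convex_on_imp_above_tangent[where A="{0<..}"])
       (auto intro!: derivative_eq_intros simp: powr_diff interior_open)
  then show ?thesis by simp
qed

text \<open>Integrate the tangent inequality at \<open>a = cmod (g 0)\<close> over the circle
  through \<open>w\<close>: its linear term has nonnegative integral because the mean of |g| is at
  least |g(0)|. Describing the circle as \<open>cis t * w\<close> prepares the averaging over
  \<open>w\<close> in a disc.\<close>

lemma circle_mean_powr_le:
  fixes g :: "complex \<Rightarrow> complex"
  assumes g: "g holomorphic_on UNIV" and p: "p \<ge> 1"
  shows "ennreal (2 * pi * cmod (g 0) powr p)
    \<le> (\<integral>\<^sup>+t. ennreal (cmod (g (cis t * w)) powr p) * indicator {0..2 * pi} t \<partial>lborel)"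
proof (cases "g 0 = 0")
  case False
  define a where "a = cmod (g 0)"
  have a: "a > 0" using False by (simp add: a_def)
  define u where "u t = cmod (g (cis t * w))" for t
  have contg: "continuous_on UNIV g"
    using g holomorphic_on_imp_continuous_on by blast
  have contu: "continuous_on A u" for A
    unfolding u_def
    by (intro continuous_intros continuous_on_compose2[OF contg]) auto
  have "(\<lambda>y. g (y * w)) holomorphic_on ball 0 2"
    using holomorphic_on_compose_gen[of "\<lambda>y. y * w" "ball 0 2" g UNIV] g
    by (simp add: o_def holomorphic_intros)
  from circle_mean_holomorphic[OF this, of 1]
  have int: "((\<lambda>t. g (cis t * w)) has_integral (2 * pi * g 0)) {0..2 * pi}"
    by simp
  have "cmod (integral {0..2 * pi} (\<lambda>t. g (cis t * w))) \<le> integral {0..2 * pi} u"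
    using int contu by (intro integral_norm_bound_integral)
       (auto simp: u_def has_integral_integrable intro: integrable_continuous_interval)
  then have mean: "2 * pi * a \<le> integral {0..2 * pi} u"
    using int by (simp add: integral_unique a_def norm_mult)
  have contp: "continuous_on {0..2 * pi} (\<lambda>t. u t powr p)"
    using p by (intro continuous_on_powr' contu continuous_intros) (auto simp: u_def)
  have "2 * pi * a powr p \<le> 2 * pi * a powr p + p * a powr (p - 1) * (integral {0..2 * pi} u - 2 * pi * a)"
    using mean p by simp
  also have "\<dots> = integral {0..2 * pi} (\<lambda>t. a powr p + p * a powr (p - 1) * (u t - a))"
  proof -
    have "((\<lambda>t. a powr p + p * a powr (p - 1) * (u t - a)) has_integral
       (2 * pi) *\<^sub>R (a powr p) + p * a powr (p - 1) * (integral {0..2 * pi} u - (2 * pi) *\<^sub>R a)) {0..2 * pi}"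
      using has_integral_const_real[of "a powr p" 0 "2 * pi"] has_integral_const_real[of a 0 "2 * pi"]
      by (intro has_integral_add has_integral_mult_right has_integral_diff
            integrable_integral integrable_continuous_interval contu) auto
    then show ?thesis by (simp add: integral_unique)
  qed
  also have "\<dots> \<le> integral {0..2 * pi} (\<lambda>t. u t powr p)"
  proof (rule integral_le)
    show "(\<lambda>t. a powr p + p * a powr (p - 1) * (u t - a)) integrable_on {0..2 * pi}"
      by (intro integrable_continuous_interval continuous_intros contu)
    show "(\<lambda>t. u t powr p) integrable_on {0..2 * pi}"
      by (intro integrable_continuous_interval contp)
  qed (use a p in \<open>auto simp: u_def intro!: powr_tangent_le\<close>)
  finally have le: "2 * pi * a powr p \<le> integral {0..2 * pi} (\<lambda>t. u t powr p)" .
  have "((\<lambda>t. u t powr p) has_integral integral {0..2 * pi} (\<lambda>t. u t powr p)) {0..2 * pi}"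
    using contp by (intro integrable_integral integrable_continuous_interval)
  then have "(\<integral>\<^sup>+t. ennreal (indicator {0..2 * pi} t * u t powr p) \<partial>lborel)
       = ennreal (integral {0..2 * pi} (\<lambda>t. u t powr p))"
    using nn_integral_has_integral_lebesgue[of "{0..2 * pi}" "\<lambda>t. u t powr p"] 
    by (simp add: nn_integral_completion)
  moreover have "(\<integral>\<^sup>+t. ennreal (indicator {0..2 * pi} t * u t powr p) \<partial>lborel)
     = (\<integral>\<^sup>+t. ennreal (cmod (g (cis t * w)) powr p) * indicator {0..2 * pi} t \<partial>lborel)"
    by (intro nn_integral_cong) (auto simp: indicator_def u_def)
  ultimately show ?thesis
    using ennreal_leI[OF le] by (simp only: a_def)
qed (use p in auto)

text \<open>If cos t vanishes then cos (t/2) does not, so the rotation is performed as two half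
  rotations.\<close>

lemma nn_integral_cis_mult:
  assumes f [measurable]: "f \<in> borel_measurable borel"
  shows "(\<integral>\<^sup>+z. f (cis t * z) \<partial>lborel) = (\<integral>\<^sup>+z. f z \<partial>(lborel :: complex measure))"
proof (cases "cos t = 0")
  case True
  then have c: "cos (t / 2) \<noteq> 0"
    using cos_double_cos[of "t / 2"] by auto
  have "(\<integral>\<^sup>+z. f (cis t * z) \<partial>lborel) = (\<integral>\<^sup>+z. f (cis (t/2) * (cis (t/2) * z)) \<partial>lborel)"
    by (simp add: mult.assoc[symmetric] cis_mult)
  also have "\<dots> = (\<integral>\<^sup>+z. f (cis (t/2) * z) \<partial>lborel)"
    by (rule nn_integral_cis_mult_cos_nonzero) (use c in auto)
  also have "\<dots> = (\<integral>\<^sup>+z. f z \<partial>lborel)"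
    by (rule nn_integral_cis_mult_cos_nonzero) (use c in auto)
  finally show ?thesis .
qed (rule nn_integral_cis_mult_cos_nonzero, auto)

lemma nn_integral_lborel_add:
  fixes z :: "'a :: euclidean_space"
  assumes [measurable]: "f \<in> borel_measurable borel"
  shows "(\<integral>\<^sup>+w. f (z + w) \<partial>lborel) = (\<integral>\<^sup>+w. f w \<partial>lborel)"
proof -
  have "(\<integral>\<^sup>+w. f w \<partial>lborel) = (\<integral>\<^sup>+w. f w \<partial>(distr lborel borel ((+) z)))"
    by (simp add: lborel_distr_plus)
  also have "\<dots> = (\<integral>\<^sup>+w. f (z + w) \<partial>lborel)"
    by (subst nn_integral_distr) auto
  finally show ?thesis ..
qed

text \<open>Rotation averaging replaces polar coordinates: integrate the circle inequality over all
  \<open>w\<close> in the disc and exchange the integrals. By rotation invariance the inner integral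
  is then the same for every angle.\<close>

lemma area_mean_powr_le_origin:
  fixes g :: "complex \<Rightarrow> complex"
  assumes g: "g holomorphic_on UNIV" and p: "p \<ge> 1" and r: "r > 0"
  shows "ennreal (pi * r\<^sup>2 * cmod (g 0) powr p)
    \<le> (\<integral>\<^sup>+w. indicator (ball 0 r) w * ennreal (cmod (g w) powr p) \<partial>lborel)"
proof -
  define h where "h w = indicator (ball 0 r) w * ennreal (cmod (g w) powr p)" for w
  have contg: "continuous_on UNIV g"
    using g holomorphic_on_imp_continuous_on by blast
  have [measurable]: "g \<in> borel_measurable borel"
    using contg by (rule borel_measurable_continuous_onI)
  have cis_meas [measurable]: "cis \<in> borel_measurable borel"
    by (intro borel_measurable_continuous_onI continuous_intros)
  have [measurable]: "ball (0::complex) r \<in> sets borel" by simp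
  have [measurable]: "h \<in> borel_measurable borel"
    unfolding h_def by measurable
  have area: "emeasure lborel (ball (0::complex) r) = ennreal (pi * r\<^sup>2)"
    using r emeasure_ball[of r "0::complex"] by (simp add: unit_ball_vol_2)
  have "ennreal (2 * pi) * ennreal (pi * r\<^sup>2 * cmod (g 0) powr p)
     = (\<integral>\<^sup>+w. ennreal (2 * pi * cmod (g 0) powr p) * indicator (ball 0 r) w \<partial>(lborel :: complex measure))"
    using area r by (subst nn_integral_cmult_indicator) (simp_all add: ennreal_mult[symmetric] mult_ac)
  also have "\<dots> \<le> (\<integral>\<^sup>+w. \<integral>\<^sup>+t. h (cis t * w) * indicator {0..2 * pi} t \<partial>lborel \<partial>lborel)"
  proof (rule nn_integral_mono)
    fix w :: complex
    have "h (cis t * w) * indicator {0..2 * pi} t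
       = indicator (ball 0 r) w * (ennreal (cmod (g (cis t * w)) powr p) * indicator {0..2 * pi} t)" for t
      by (auto simp: h_def indicator_def norm_mult)
    then show "ennreal (2 * pi * cmod (g 0) powr p) * indicator (ball 0 r) w
      \<le> (\<integral>\<^sup>+t. h (cis t * w) * indicator {0..2 * pi} t \<partial>lborel)"
      using circle_mean_powr_le[OF g p, of w]
      by (auto simp: nn_integral_cmult indicator_def)
  qed
  also have "\<dots> = (\<integral>\<^sup>+t. \<integral>\<^sup>+w. h (cis t * w) * indicator {0..2 * pi} t \<partial>lborel \<partial>lborel)"
    by (rule lborel_pair.Fubini') measurable
  also have "\<dots> = (\<integral>\<^sup>+t. (\<integral>\<^sup>+w. h w \<partial>lborel) * indicator {0..2 * pi} t \<partial>lborel)"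
    by (intro nn_integral_cong) (simp add: nn_integral_multc nn_integral_cis_mult)
  also have "\<dots> = ennreal (2 * pi) * (\<integral>\<^sup>+w. h w \<partial>lborel)"
    by (simp add: nn_integral_cmult mult.commute)
  finally have "ennreal (2 * pi) * ennreal (pi * r\<^sup>2 * cmod (g 0) powr p) \<le> ennreal (2 * pi) * (\<integral>\<^sup>+w. h w \<partial>lborel)" .
  then show ?thesis
    unfolding h_def[symmetric]
    by (subst (asm) ennreal_mult_le_mult_iff) auto
qed

lemma area_mean_powr_le:
  fixes g :: "complex \<Rightarrow> complex"
  assumes g: "g holomorphic_on UNIV" and p: "p \<ge> 1" and r: "r > 0"
  shows "ennreal (r\<^sup>2 * cmod (g z) powr p)
    \<le> (\<integral>\<^sup>+w. indicator (ball z r) w * ennreal (cmod (g w) powr p) \<partial>dA)"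
proof -
  have contg: "continuous_on UNIV g"
    using g holomorphic_on_imp_continuous_on by blast
  have [measurable]: "g \<in> borel_measurable borel"
    using contg by (rule borel_measurable_continuous_onI)
  have [measurable]: "ball z r \<in> sets borel" by simp
  have "(\<lambda>w. g (z + w)) holomorphic_on UNIV"
    using holomorphic_on_compose_gen[of "\<lambda>w. z + w" UNIV g UNIV] g
    by (simp add: o_def holomorphic_intros)
  from area_mean_powr_le_origin[OF this p r]
  have *: "ennreal (pi * r\<^sup>2 * cmod (g z) powr p)
    \<le> (\<integral>\<^sup>+w. indicator (ball 0 r) w * ennreal (cmod (g (z + w)) powr p) \<partial>lborel)"
    by simp
  also have "\<dots> = (\<integral>\<^sup>+w. indicator (ball z r) (z + w) * ennreal (cmod (g (z + w)) powr p) \<partial>lborel)"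
    by (intro nn_integral_cong) (auto simp: indicator_def dist_norm)
  also have "\<dots> = (\<integral>\<^sup>+w. indicator (ball z r) w * ennreal (cmod (g w) powr p) \<partial>lborel)"
    by (rule nn_integral_lborel_add) measurable
  finally have "ennreal (1 / pi) * ennreal (pi * r\<^sup>2 * cmod (g z) powr p)
    \<le> ennreal (1 / pi) * (\<integral>\<^sup>+w. indicator (ball z r) w * ennreal (cmod (g w) powr p) \<partial>lborel)"
    by (intro mult_left_mono) auto
  also have "\<dots> = (\<integral>\<^sup>+w. indicator (ball z r) w * ennreal (cmod (g w) powr p) \<partial>dA)"
    unfolding dA_def by (subst nn_integral_density) (auto simp: nn_integral_cmult[symmetric])
  finally show ?thesis
    by (simp add: ennreal_mult[symmetric])
qed

text \<open>This is the integrable majorant for the mass off the droplet. Since (1 + x^2)(1 + y^2)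
  \<le> (1 + |z|^2)^2, it is dominated by a product of one-dimensional Cauchy densities.\<close>

lemma nn_integral_inverse_quadratic_finite:
  "(\<integral>\<^sup>+z. ennreal (1 / (1 + (cmod z)\<^sup>2)\<^sup>2) \<partial>dA) < \<infinity>"
proof -
  have "set_integrable lborel UNIV (\<lambda>x::real. inverse (1 + x^2))"
    using integrable_inverse_1_plus_square by simp
  then have int: "integrable lborel (\<lambda>x::real. inverse (1 + x^2))"
    by (simp add: set_integrable_def)
  have 1: "(\<integral>\<^sup>+x. ennreal (inverse (1 + x\<^sup>2)) \<partial>lborel) < \<infinity>"
    using int by (subst nn_integral_eq_integral) (auto intro: add_nonneg_nonneg)
  have le: "ennreal (1 / (1 + (cmod (Complex x y))\<^sup>2)\<^sup>2)
     \<le> ennreal (inverse (1 + x\<^sup>2)) * ennreal (inverse (1 + y\<^sup>2))" for x y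
  proof -
    have "(1 + x\<^sup>2) * (1 + y\<^sup>2) \<le> (1 + (x\<^sup>2 + y\<^sup>2))\<^sup>2"
    proof -
      have "(1 + (x\<^sup>2 + y\<^sup>2))\<^sup>2 = (1 + x\<^sup>2) * (1 + y\<^sup>2) + (x\<^sup>2 + y\<^sup>2) + x\<^sup>2 * y\<^sup>2 + (x\<^sup>2)\<^sup>2 + (y\<^sup>2)\<^sup>2"
        by (simp add: power2_eq_square algebra_simps)
      then show ?thesis by simp
    qed
    then show ?thesis
      by (subst ennreal_mult[symmetric])
         (auto simp: cmod_power2 divide_simps add_pos_nonneg intro!: ennreal_leI)
  qed
  have "(\<integral>\<^sup>+z. ennreal (1 / (1 + (cmod z)\<^sup>2)\<^sup>2) \<partial>lborel) \<le>
     (\<integral>\<^sup>+x. \<integral>\<^sup>+y. ennreal (inverse (1 + x\<^sup>2)) * ennreal (inverse (1 + y\<^sup>2)) \<partial>lborel \<partial>lborel)"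
    by (subst nn_integral_complex(1)) (auto intro!: nn_integral_mono le)
  also have "\<dots> = (\<integral>\<^sup>+x. ennreal (inverse (1 + x\<^sup>2)) \<partial>lborel) * (\<integral>\<^sup>+x. ennreal (inverse (1 + x\<^sup>2)) \<partial>lborel)"
    by (simp add: nn_integral_cmult nn_integral_multc)
  also have "\<dots> < \<infinity>"
    using 1 by (simp add: ennreal_mult_less_top)
  finally have fin: "(\<integral>\<^sup>+z. ennreal (1 / (1 + (cmod z)\<^sup>2)\<^sup>2) \<partial>(lborel::complex measure)) < \<infinity>" .
  show ?thesis
    unfolding dA_def using fin
    by (subst nn_integral_density) (auto simp: nn_integral_cmult ennreal_mult_less_top)
qed

section \<open>Potentials in the obstacle class\<close>

lemma ereal_integral_mono:
  assumes "\<And>x. x \<in> space M \<Longrightarrow> f x \<le> g x"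
  shows "ereal_integral M f \<le> ereal_integral M g"
  unfolding ereal_integral_def
  by (intro ereal_minus_mono less_eq_ennreal.rep_eq[THEN iffD1] nn_integral_mono e2ennreal_mono)
     (auto simp: assms)

lemma ereal_integral_has_integral:
  fixes u :: "real \<Rightarrow> real"
  assumes cont: "continuous_on {a..b} u" and int: "(u has_integral I) {a..b}"
  shows "ereal_integral (restrict_space lborel {a..b}) (\<lambda>t. ereal (u t)) = ereal I"
proof -
  let ?M = "restrict_space lborel {a..b} :: real measure"
  have si: "set_integrable lborel {a..b} u"
    using borel_integrable_atLeastAtMost'[OF cont] by (simp add: set_integrable_def)
  then have i: "integrable ?M u"
    by (simp add: integrable_restrict_space set_integrable_def)
  have "(LINT t|?M. u t) = (LINT t:{a..b}|lborel. u t)"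
    by (simp add: integral_restrict_space set_lebesgue_integral_def)
  also have "\<dots> = I"
    using set_borel_integral_eq_integral(2)[OF si] int by (simp add: integral_unique)
  finally have I: "(LINT t|?M. u t) = I" .
  have fin: "(\<integral>\<^sup>+t. ennreal (u t) \<partial>?M) < \<infinity>" "(\<integral>\<^sup>+t. ennreal (- u t) \<partial>?M) < \<infinity>"
    using i unfolding real_integrable_def by (auto simp: less_top)
  have e: "enn2ereal x = ereal (enn2real x)" if "x < \<infinity>" for x
    using that by (cases x) auto
  show ?thesis
    unfolding ereal_integral_def
    using I real_lebesgue_integral_def[OF i] fin
    by (simp add: e)
qed

text \<open>Where \<open>F\<close> is positive, log F is touched from below at z by the harmonic
  function Re \<phi>, whose mean value property gives the sub-mean value inequality at z. At zeros
  of \<open>F\<close> the left-hand side is -\<infinity>.\<close>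

lemma subharmonic_lnI:
  assumes cont: "continuous_on UNIV F" and nonneg: "\<And>z. F z \<ge> 0"
    and touch: "\<And>z. F z > 0 \<Longrightarrow> \<exists>\<rho>>0. \<exists>\<phi>. \<phi> holomorphic_on ball z \<rho> \<and>
       F z = exp (Re (\<phi> z)) \<and> (\<forall>w\<in>ball z \<rho>. exp (Re (\<phi> w)) \<le> F w)"
  shows "subharmonic (\<lambda>z. if F z = 0 then - \<infinity> else ereal (ln (F z)))" (is "subharmonic ?f")
  unfolding subharmonic_def
proof (intro conjI allI)
  fix a :: ereal
  show "open {z. ?f z < a}"
  proof (cases a)
    case (real r)
    have "{z. ?f z < a} = F -` {..<exp r}"
    proof (intro set_eqI)
      fix z
      have "F z = 0 \<or> F z > 0" using nonneg[of z] by linarith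
      then show "z \<in> {z. ?f z < a} \<longleftrightarrow> z \<in> F -` {..<exp r}"
      proof
        assume "F z > 0"
        then show ?thesis using real ln_ge_iff[of "F z" r] by (auto simp: not_le[symmetric])
      qed (use real in auto)
    qed
    then show ?thesis
      using continuous_open_vimage[of "{..<exp r}" F] cont
      by (simp add: continuous_on_eq_continuous_at)
  qed (auto simp: less_ereal.simps)
next
  fix z
  show "\<exists>\<rho>>0. \<forall>r. 0 \<le> r \<and> r < \<rho> \<longrightarrow> ?f z \<le> ereal (1 / (2 * pi)) *
     ereal_integral (restrict_space lborel {0..2 * pi}) (\<lambda>t. ?f (z + complex_of_real r * cis t))"
  proof (cases "F z = 0")
    case False
    with nonneg[of z] have "F z > 0" by simp
    from touch[OF this] obtain \<rho> \<phi> where \<rho>: "\<rho> > 0" and hol: "\<phi> holomorphic_on ball z \<rho>"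
      and z: "F z = exp (Re (\<phi> z))" and le: "\<And>w. w \<in> ball z \<rho> \<Longrightarrow> exp (Re (\<phi> w)) \<le> F w"
      by blast
    show ?thesis
    proof (intro exI[of _ \<rho>] conjI allI impI \<rho>)
      fix r assume r: "0 \<le> r \<and> r < \<rho>"
      have inb: "z + complex_of_real r * cis t \<in> ball z \<rho>" for t
        using r by (simp add: dist_norm norm_mult)
      have "((\<lambda>t. \<phi> (z + complex_of_real r * cis t)) has_integral 2 * pi * \<phi> z) {0..2 * pi}"
        using circle_mean_holomorphic[OF hol] r by simp
      then have int: "((\<lambda>t. Re (\<phi> (z + complex_of_real r * cis t))) has_integral 2 * pi * Re (\<phi> z)) {0..2 * pi}"
        using has_integral_linear[OF _ bounded_linear_Re, of _ "2 * pi * \<phi> z"] by (simp add: o_def)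
      have cont: "continuous_on {0..2 * pi} (\<lambda>t. Re (\<phi> (z + complex_of_real r * cis t)))"
        using inb
        by (intro continuous_on_Re continuous_on_compose2[OF holomorphic_on_imp_continuous_on[OF hol]])
           (auto intro!: continuous_intros)
      have "?f z = ereal (1 / (2 * pi)) * ereal (2 * pi * Re (\<phi> z))"
        using z by simp
      also have "ereal (2 * pi * Re (\<phi> z)) = ereal_integral (restrict_space lborel {0..2 * pi})
          (\<lambda>t. ereal (Re (\<phi> (z + complex_of_real r * cis t))))"
        using ereal_integral_has_integral[OF cont int] by simp
      also have "\<dots> \<le> ereal_integral (restrict_space lborel {0..2 * pi})
          (\<lambda>t. ?f (z + complex_of_real r * cis t))"
      proof (rule ereal_integral_mono)
        fix t
        have "exp (Re (\<phi> (z + complex_of_real r * cis t))) \<le> F (z + complex_of_real r * cis t)"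
          by (rule le[OF inb])
        moreover from this have "F (z + complex_of_real r * cis t) > 0"
          using exp_gt_zero less_le_trans by blast
        ultimately show "ereal (Re (\<phi> (z + complex_of_real r * cis t))) \<le> ?f (z + complex_of_real r * cis t)"
          by (simp add: ln_ge_iff)
      qed
      finally show "?f z \<le> ereal (1 / (2 * pi)) * ereal_integral (restrict_space lborel {0..2 * pi})
          (\<lambda>t. ?f (z + complex_of_real r * cis t))"
        by (simp add: ereal_mult_left_mono)
    qed
  qed (auto intro: exI[of _ 1])
qed auto

section \<open>Products of affine moduli as members of the obstacle class\<close>

definition weight :: "(complex \<Rightarrow> ereal) \<Rightarrow> complex \<Rightarrow> real" where
  "weight Q z = (if Q z = \<infinity> then 0 else exp (- real_of_ereal (Q z)))"

text \<open>The obstacle class is used in multiplicative form: \<open>F\<close> stands for \<open>e\<^sup>f\<close>, and \<open>f \<le> Q\<close> becomes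
  \<open>F * weight Q \<le> 1\<close>. Maxima of two affine moduli cover both operations applied to zeros
  below: truncation and reflection in a circle.\<close>

definition affine_factor :: "(complex \<times> complex \<times> complex) \<Rightarrow> complex \<Rightarrow> real" where
  "affine_factor = (\<lambda>(a, p, q) z. max (cmod (z - a)) (cmod (p * z + q)))"

text \<open>A total exponent of at most 2 encodes the growth log |z|^2 + O(1) of the obstacle class.
  Strictly positive exponents make every factor continuous at its zeros, as
  \<open>0 powr 0 = 0\<close>.\<close>

definition affine_potentials :: "(complex \<Rightarrow> real) set" where
  "affine_potentials = {\<lambda>z. C * (\<Prod>k\<in>I. affine_factor (A k) z powr (2 * c k)) | C I A c.
     C > 0 \<and> finite (I :: nat set) \<and> (\<forall>k\<in>I. c k > 0) \<and> sum c I \<le> 1}"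

lemma affine_factor_nonneg [simp]: "affine_factor A z \<ge> 0"
  by (auto simp: affine_factor_def le_max_iff_disj split: prod.split)

text \<open>Whichever modulus attains the maximum at \<open>z\<close> is the minorant; it will
  provide the touching function required by \<open>subharmonic_lnI\<close>.\<close>

lemma affine_factor_touch:
  assumes "affine_factor A z > 0"
  obtains p q where "cmod (p * z + q) = affine_factor A z" "\<And>w. cmod (p * w + q) \<le> affine_factor A w"
proof -
  obtain a p q where A: "A = (a, p, q)" by (cases A)
  show thesis
  proof (cases "cmod (z - a) \<ge> cmod (p * z + q)")
    case True
    show ?thesis by (rule that[of 1 "- a"]) (use True in \<open>auto simp: A affine_factor_def\<close>)
  next
    case False
    show ?thesis by (rule that[of p q]) (use False in \<open>auto simp: A affine_factor_def\<close>)
  qed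
qed

lemma continuous_on_affine_factor [continuous_intros]: "continuous_on X (affine_factor A)"
  unfolding affine_factor_def by (auto split: prod.split intro!: continuous_intros)

lemma affine_factor_growth: "\<exists>K>0. \<forall>z. cmod z \<ge> 1 \<longrightarrow> affine_factor A z \<le> K * cmod z"
proof -
  obtain a p q where A: "A = (a, p, q)" by (cases A)
  have "affine_factor A z \<le> (1 + cmod a + cmod p + cmod q) * cmod z" if z: "cmod z \<ge> 1" for z
  proof -
    have "cmod (z - a) \<le> cmod z + cmod a" "cmod (p * z + q) \<le> cmod p * cmod z + cmod q"
      using norm_triangle_ineq[of "p * z" q] by (auto simp: norm_triangle_ineq4 norm_mult)
    moreover have "cmod a \<le> cmod a * cmod z" "cmod q \<le> cmod q * cmod z"
      using z by (simp_all add: mult_le_cancel_left1)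
    moreover have "cmod p * cmod z \<ge> 0" "cmod a * cmod z \<ge> 0" "cmod q * cmod z \<ge> 0" by simp_all
    ultimately have "cmod (z - a) \<le> (1 + cmod a + cmod p + cmod q) * cmod z"
      "cmod (p * z + q) \<le> (1 + cmod a + cmod p + cmod q) * cmod z"
      using z unfolding distrib_right by linarith+
    then show ?thesis
      by (simp add: A affine_factor_def)
  qed
  moreover have "1 + cmod a + cmod p + cmod q > 0"
    by (intro add_pos_nonneg) auto
  ultimately show ?thesis by blast
qed

text \<open>Replace each factor by the affine modulus that attains it at \<open>z\<close>. The
  resulting product lies below \<open>F\<close>, equals it at \<open>z\<close>, and is locally the
  modulus of the exponential of a holomorphic function.\<close>

lemma subharmonic_affine_potential:
  assumes "F \<in> affine_potentials"
  shows "subharmonic (\<lambda>z. if F z = 0 then - \<infinity> else ereal (ln (F z)))"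
proof -
  obtain C I A c where F: "F = (\<lambda>z. C * (\<Prod>k\<in>I. affine_factor (A k) z powr (2 * c k)))"
    and C: "C > 0" and I: "finite (I::nat set)" and c: "\<And>k. k \<in> I \<Longrightarrow> c k > 0"
    using assms unfolding affine_potentials_def by auto
  show ?thesis
  proof (rule subharmonic_lnI)
    show "continuous_on UNIV F"
      unfolding F using c
      by (intro continuous_intros continuous_on_prod continuous_on_powr') force+
    show "F z \<ge> 0" for z
      unfolding F using C by (simp add: prod_nonneg)
    fix z assume Fz: "F z > 0"
    have pos: "affine_factor (A k) z > 0" if "k \<in> I" for k
    proof (rule ccontr)
      assume "\<not> ?thesis"
      then have "affine_factor (A k) z = 0" using affine_factor_nonneg[of "A k" z] by linarith
      then have "(\<Prod>k\<in>I. affine_factor (A k) z powr (2 * c k)) = 0"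
        using that I by (auto intro!: prod_zero)
      then show False using Fz by (simp add: F)
    qed
    have "\<forall>k. \<exists>p q. k \<in> I \<longrightarrow> cmod (p * z + q) = affine_factor (A k) z \<and>
        (\<forall>w. cmod (p * w + q) \<le> affine_factor (A k) w)"
      using affine_factor_touch[OF pos] by metis
    then obtain p q where pq: "\<And>k. k \<in> I \<Longrightarrow> cmod (p k * z + q k) = affine_factor (A k) z"
      and le: "\<And>k w. k \<in> I \<Longrightarrow> cmod (p k * w + q k) \<le> affine_factor (A k) w"
      by metis
    define h where "h k w = p k * w + q k" for k w
    have hz: "h k z \<noteq> 0" if "k \<in> I" for k
      using pq[OF that] pos[OF that] by (auto simp: h_def)
    have "\<forall>\<^sub>F w in nhds z. \<forall>k\<in>I. Re (h k w / h k z) > 0"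
    proof (intro eventually_ball_finite I ballI)
      fix k assume k: "k \<in> I"
      have "isCont (\<lambda>w. Re (h k w / h k z)) z"
        unfolding h_def using hz[OF k, unfolded h_def] by (auto intro!: continuous_intros)
      then have "((\<lambda>w. Re (h k w / h k z)) \<longlongrightarrow> Re (h k z / h k z)) (nhds z)"
        unfolding isCont_def tendsto_at_iff_tendsto_nhds[of "\<lambda>w. Re (h k w / h k z)"] .
      then show "\<forall>\<^sub>F w in nhds z. Re (h k w / h k z) > 0"
        by (rule order_tendstoD) (use hz[OF k] in simp)
    qed
    then obtain \<rho> where \<rho>: "\<rho> > 0" and Re: "\<And>w k. w \<in> ball z \<rho> \<Longrightarrow> k \<in> I \<Longrightarrow> Re (h k w / h k z) > 0"
      unfolding eventually_nhds_metric by (auto simp: dist_commute)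
    \<comment> \<open>A logarithm of the minorant up to a constant phase. On the chosen disc the
      quotients \<open>h k w / h k z\<close> stay in the right half-plane, where the principal
      logarithm is holomorphic.\<close>
    define \<phi> where "\<phi> w = of_real (ln C) + (\<Sum>k\<in>I. of_real (2 * c k) *
        (of_real (ln (cmod (h k z))) + Ln (h k w / h k z)))" for w
    have exp_\<phi>: "exp (Re (\<phi> w)) = C * (\<Prod>k\<in>I. cmod (h k w) powr (2 * c k))" if w: "w \<in> ball z \<rho>" for w
    proof -
      have re: "Re (of_real (2 * c k) * (of_real (ln (cmod (h k z))) + Ln (h k w / h k z)))
         = 2 * c k * ln (cmod (h k w))" and nz: "h k w \<noteq> 0" if k: "k \<in> I" for k
      proof -
        show nz: "h k w \<noteq> 0" using Re[OF w k] by auto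
        have "ln (cmod (h k w / h k z)) = ln (cmod (h k w)) - ln (cmod (h k z))"
          using nz hz[OF k] by (simp add: norm_divide ln_div)
        then show "Re (of_real (2 * c k) * (of_real (ln (cmod (h k z))) + Ln (h k w / h k z)))
         = 2 * c k * ln (cmod (h k w))"
          using nz hz[OF k] by (simp add: Re_Ln)
      qed
      have "Re (\<phi> w) = ln C + (\<Sum>k\<in>I. 2 * c k * ln (cmod (h k w)))"
        unfolding \<phi>_def plus_complex.sel Re_sum using re by (auto intro!: sum.cong)
      then show ?thesis
        using C I nz by (simp add: exp_add exp_sum powr_def)
    qed
    show "\<exists>\<rho>>0. \<exists>\<phi>. \<phi> holomorphic_on ball z \<rho> \<and> F z = exp (Re (\<phi> z)) \<and>
        (\<forall>w\<in>ball z \<rho>. exp (Re (\<phi> w)) \<le> F w)"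
    proof (intro exI[of _ \<rho>] exI[of _ \<phi>] conjI ballI \<rho>)
      show "\<phi> holomorphic_on ball z \<rho>"
      proof -
        have "h k w / h k z \<notin> \<real>\<^sub>\<le>\<^sub>0" if "w \<in> ball z \<rho>" "k \<in> I" for k w
          using Re[OF that] by (auto simp: complex_nonpos_Reals_iff)
        then show ?thesis
          unfolding \<phi>_def using hz by (intro holomorphic_intros) (auto simp: h_def intro!: holomorphic_intros)
      qed
      show "F z = exp (Re (\<phi> z))"
        using \<rho> by (subst exp_\<phi>) (auto simp: F h_def pq)
      show "exp (Re (\<phi> w)) \<le> F w" if "w \<in> ball z \<rho>" for w
        using C c le by (subst exp_\<phi>[OF that])
          (auto simp: F h_def less_imp_le intro!: mult_left_mono prod_mono powr_mono2)
    qed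
  qed
qed

lemma affine_potential_growth:
  assumes "F \<in> affine_potentials"
  shows "\<exists>K>0. \<forall>z. cmod z \<ge> 1 \<longrightarrow> F z \<le> K * (cmod z)\<^sup>2"
proof -
  obtain C I A c where F: "F = (\<lambda>z. C * (\<Prod>k\<in>I. affine_factor (A k) z powr (2 * c k)))"
    and C: "C > 0" and I: "finite (I::nat set)" and c: "\<And>k. k \<in> I \<Longrightarrow> c k > 0" and sum: "sum c I \<le> 1"
    using assms unfolding affine_potentials_def by auto
  have "\<forall>k. \<exists>K>0. \<forall>z. cmod z \<ge> 1 \<longrightarrow> affine_factor (A k) z \<le> K * cmod z"
    using affine_factor_growth by blast
  from choice[OF this] obtain K where K: "\<And>k. K k > 0"
      "\<And>k z. cmod z \<ge> 1 \<Longrightarrow> affine_factor (A k) z \<le> K k * cmod z"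
    by blast
  have "F z \<le> (C * (\<Prod>k\<in>I. K k powr (2 * c k))) * (cmod z)\<^sup>2" if z: "cmod z \<ge> 1" for z
  proof -
    have "F z \<le> C * (\<Prod>k\<in>I. (K k * cmod z) powr (2 * c k))"
      unfolding F using C c K(2)[OF z]
      by (intro mult_left_mono prod_mono) (auto intro!: powr_mono2 simp: less_imp_le)
    also have "\<dots> = C * (\<Prod>k\<in>I. K k powr (2 * c k)) * (\<Prod>k\<in>I. cmod z powr (2 * c k))"
      using K(1) by (simp add: powr_mult less_imp_le prod.distrib)
    also have "(\<Prod>k\<in>I. cmod z powr (2 * c k)) = cmod z powr (\<Sum>k\<in>I. 2 * c k)"
      using z by (subst powr_sum) (auto simp: I)
    also have "\<dots> \<le> cmod z powr 2"
      using z sum by (intro powr_mono) (auto simp: sum_distrib_left[symmetric])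
    finally show ?thesis
      using C K(1) z by (simp add: mult_left_mono prod_nonneg powr_realpow)
  qed
  moreover have "C * (\<Prod>k\<in>I. K k powr (2 * c k)) > 0"
    using C K(1) by (intro mult_pos_pos prod_pos) (auto simp: less_imp_neq[symmetric])
  ultimately show ?thesis by blast
qed

lemma affine_potential_nonneg: "F \<in> affine_potentials \<Longrightarrow> F z \<ge> 0"
  by (auto simp: affine_potentials_def intro!: mult_nonneg_nonneg prod_nonneg)

lemma affine_potential_in_obstacle_class:
  assumes F: "F \<in> affine_potentials" and le: "\<And>z. F z * weight Q z \<le> 1"
    and Q: "\<And>z. Q z \<noteq> - \<infinity>"
  shows "(\<lambda>z. if F z = 0 then - \<infinity> else ereal (ln (F z))) \<in> obstacle_class Q" (is "?f \<in> _")
proof -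
  note nonneg = affine_potential_nonneg[OF F]
  have "?f z \<le> Q z" for z
  proof (cases "F z = 0 \<or> Q z = \<infinity>")
    case False
    then obtain x where x: "Q z = ereal x" using Q[of z] by (cases "Q z") auto
    have "F z \<le> exp x"
      using le[of z] False x by (simp add: weight_def exp_minus field_simps)
    moreover have "F z > 0" using nonneg[of z] False by simp
    ultimately have "ln (F z) \<le> x" using ln_le_cancel_iff[of "F z" "exp x"] by simp
    then show ?thesis using False x by simp
  qed auto
  moreover have "\<exists>C. \<forall>\<^sub>F z in at_infinity. ?f z \<le> ereal (ln ((cmod z)\<^sup>2) + C)"
  proof -
    obtain K where K: "K > 0" "\<And>z. cmod z \<ge> 1 \<Longrightarrow> F z \<le> K * (cmod z)\<^sup>2"
      using affine_potential_growth[OF F] by blast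
    have "?f z \<le> ereal (ln ((cmod z)\<^sup>2) + ln K)" if z: "cmod z \<ge> 1" for z
    proof (cases "F z = 0")
      case False
      then have "F z > 0" using nonneg[of z] by simp
      then have "ln (F z) \<le> ln (K * (cmod z)\<^sup>2)"
        using K(2)[OF z] by (subst ln_le_cancel_iff) auto
      also have "\<dots> = ln ((cmod z)\<^sup>2) + ln K"
        using K(1) z by (subst ln_mult) auto
      finally show ?thesis using False by simp
    qed auto
    then show ?thesis
      unfolding eventually_at_infinity by blast
  qed
  ultimately show ?thesis
    using subharmonic_affine_potential[OF F] by (simp add: obstacle_class_def)
qed

text \<open>Condition (4) at a single point, in multiplicative form: a real \<open>m\<close>
  strictly between the obstacle supremum and Q(z) gives F(z) \<le> e^m for all competitors at once.
  If Q(z) is infinite the weight is zero and \<open>q = 0\<close> works.\<close>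

lemma affine_potential_gap:
  assumes Q: "\<And>z. Q z \<noteq> - \<infinity>" and gap: "Q z > (SUP f\<in>obstacle_class Q. f z)"
  shows "\<exists>q<1. \<forall>F\<in>affine_potentials. (\<forall>w. F w * weight Q w \<le> 1) \<longrightarrow> F z * weight Q z \<le> q"
proof (cases "Q z = \<infinity>")
  case True
  then show ?thesis by (intro exI[of _ 0]) (auto simp: weight_def)
next
  case False
  then obtain x where x: "Q z = ereal x" using Q[of z] by (cases "Q z") auto
  obtain m where m: "(SUP f\<in>obstacle_class Q. f z) < ereal m" "m < x"
    using ereal_dense2[OF gap] x by auto
  show ?thesis
  proof (intro exI[of _ "exp (m - x)"] conjI ballI impI)
    fix F assume F: "F \<in> affine_potentials" "\<forall>w. F w * weight Q w \<le> 1"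
    have "(if F z = 0 then - \<infinity> else ereal (ln (F z))) \<le> (SUP f\<in>obstacle_class Q. f z)"
      by (rule SUP_upper2[OF affine_potential_in_obstacle_class[of F Q]]) (use F Q in auto)
    with m have *: "(if F z = 0 then - \<infinity> else ereal (ln (F z))) < ereal m" by simp
    have "F z \<le> exp m"
    proof (cases "F z = 0")
      case False
      then have "F z > 0" using affine_potential_nonneg[OF F(1), of z] by simp
      with * show ?thesis using ln_ge_iff[of "F z" m] by (auto simp: not_le)
    qed simp
    then show "F z * weight Q z \<le> exp (m - x)"
      using x by (simp add: weight_def exp_diff exp_minus field_simps)
  qed (use m in simp)
qed

section \<open>The uniform gap off the droplet\<close>

text \<open>Cauchy's estimate on circles of radius r/4 centred in the half disc bounds the
  derivative by 4B/r, and the half disc is convex.\<close>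

lemma holomorphic_bounded_lipschitz:
  fixes E :: "complex \<Rightarrow> complex"
  assumes hol: "E holomorphic_on ball z r" and bd: "\<And>y. y \<in> ball z r \<Longrightarrow> cmod (E y) \<le> B"
    and w: "w \<in> ball z (r / 2)"
  shows "cmod (E w - E z) \<le> 4 * B / r * cmod (w - z)"
proof -
  have r: "r > 0" using w zero_le_dist[of z w] unfolding mem_ball by linarith
  have "cmod (deriv E y) \<le> 4 * B / r" if y: "y \<in> ball z (r / 2)" for y
  proof -
    have sub: "cball y (r / 4) \<subseteq> ball z r"
    proof
      fix u assume "u \<in> cball y (r / 4)"
      then show "u \<in> ball z r"
        using y r dist_triangle[of z u y] by auto
    qed
    have "cmod ((deriv ^^ 1) E y) \<le> fact 1 * B / (r / 4) ^ 1"
    proof (rule Cauchy_inequality)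
      show "E holomorphic_on ball y (r / 4)"
        using holomorphic_on_subset[OF hol] sub by (meson ball_subset_cball order_trans)
      show "continuous_on (cball y (r / 4)) E"
        using holomorphic_on_imp_continuous_on[OF holomorphic_on_subset[OF hol sub]] .
      show "cmod (E x) \<le> B" if "cmod (y - x) = r / 4" for x
        using that sub by (intro bd) (auto simp: dist_norm subset_iff)
    qed (use r in auto)
    then show ?thesis by (simp add: mult.commute)
  qed
  then show ?thesis
    using holomorphic_derivI[OF hol open_ball] w r
    by (intro field_differentiable_bound[where S="ball z (r / 2)" and f'="deriv E"])
       (auto intro!: has_field_derivative_at_within)
qed

section \<open>Roots of moduli of polynomials and the Bernstein-Walsh inequality\<close>

definition poly_potentials :: "(complex \<Rightarrow> real) set" where
  "poly_potentials = {\<lambda>z. C * (\<Prod>k\<in>I. cmod (z - a k) powr (2 / real n)) | C I a n.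
     C > 0 \<and> finite (I :: nat set) \<and> n \<ge> 1 \<and> card I \<le> n}"

lemma poly_potentials_nonneg: "F \<in> poly_potentials \<Longrightarrow> F z \<ge> 0"
  by (auto simp: poly_potentials_def intro!: mult_nonneg_nonneg prod_nonneg)

lemma prod_powr_eq:
  fixes C :: real
  assumes "finite I"
  shows "C * (\<Prod>k\<in>I. cmod (h k) powr s) = C * cmod (\<Prod>k\<in>I. h k) powr s"
  by (simp add: prod_norm[symmetric] prod_powr_distrib)

text \<open>Passes between bounds on the potential C |p|^(2/n) and bounds on |p| itself, to which
  the maximum principle applies.\<close>

lemma powr_two_over_le_iff:
  assumes "C > 0" "n \<ge> 1" "x \<ge> 0" "M \<ge> 0"
  shows "C * x powr (2 / real n) \<le> M \<longleftrightarrow> x \<le> (M / C) powr (real n / 2)"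
proof
  assume "C * x powr (2 / real n) \<le> M"
  then have "x powr (2 / real n) \<le> M / C" using assms by (simp add: field_simps)
  then have "(x powr (2 / real n)) powr (real n / 2) \<le> (M / C) powr (real n / 2)"
    by (intro powr_mono2) auto
  then show "x \<le> (M / C) powr (real n / 2)" using assms by (simp add: powr_powr)
next
  assume "x \<le> (M / C) powr (real n / 2)"
  then have "x powr (2 / real n) \<le> ((M / C) powr (real n / 2)) powr (2 / real n)"
    using assms by (intro powr_mono2) auto
  then show "C * x powr (2 / real n) \<le> M" using assms by (simp add: powr_powr field_simps)
qed

text \<open>Inversion in the circle about s turns growth outside the disc into the maximum principle
  for the reversed polynomial. The bound does not depend on the degree, because of the n-th root in
  the potential.\<close>

lemma bernstein_walsh:
  assumes F: "F \<in> poly_potentials" and r: "r > 0" and M: "\<And>y. y \<in> cball s r \<Longrightarrow> F y \<le> M"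
  shows "F z \<le> M * (max 1 (cmod (z - s) / r))\<^sup>2"
proof (cases "z \<in> cball s r")
  case True
  then show ?thesis using M[OF True] r by (simp add: max_def divide_simps dist_norm norm_minus_commute)
next
  case False
  have M0: "M \<ge> 0"
    using M[of s] poly_potentials_nonneg[OF F, of s] r by force
  obtain C I a n where F: "F = (\<lambda>z. C * (\<Prod>k\<in>I. cmod (z - a k) powr (2 / real n)))"
    and C: "C > 0" and I: "finite (I::nat set)" and n: "n \<ge> 1" "card I \<le> n"
    using F unfolding poly_potentials_def by auto
  define M' where "M' = (M / C) powr (real n / 2)"
  define p where "p y = (\<Prod>k\<in>I. y - a k)" for y
  have Fp: "F y = C * cmod (p y) powr (2 / real n)" for y
    unfolding F p_def by (rule prod_powr_eq[OF I])
  have p_le: "cmod (p y) \<le> M'" if "y \<in> cball s r" for y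
    using M[OF that] C n M0 unfolding Fp M'_def by (subst (asm) powr_two_over_le_iff) auto
  \<comment> \<open>The reversed polynomial u^d p(s + 1/u) with \<open>d = card I\<close>, written
    so that it makes sense at u = 0.\<close>
  define q where "q u = (\<Prod>k\<in>I. 1 - (a k - s) * u)" for u
  have qp: "p (s + 1 / u) * u ^ card I = q u" if "u \<noteq> 0" for u
  proof -
    have "p (s + 1 / u) * u ^ card I = (\<Prod>k\<in>I. (s + 1 / u - a k) * u)"
      by (simp add: p_def prod.distrib)
    also have "\<dots> = q u"
      unfolding q_def using that by (intro prod.cong) (auto simp: field_simps)
    finally show ?thesis .
  qed
  have "cmod (q (1 / (z - s))) \<le> M' * (1 / r) ^ card I"
  proof (rule maximum_modulus_frontier[of q "cball 0 (1 / r)"])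
    show "q holomorphic_on interior (cball 0 (1 / r))"
      unfolding q_def by (intro holomorphic_intros)
    show "continuous_on (closure (cball 0 (1 / r))) q"
      unfolding q_def by (intro continuous_intros)
    show "cmod (q u) \<le> M' * (1 / r) ^ card I" if "u \<in> frontier (cball 0 (1 / r))" for u
    proof -
      have u: "cmod u = 1 / r" using that r by (simp add: frontier_cball)
      then have u0: "u \<noteq> 0" using r by auto
      have "s + 1 / u \<in> cball s r" using u r by (simp add: dist_norm norm_divide)
      then show ?thesis
        unfolding qp[OF u0, symmetric] using p_le u r
        by (simp add: norm_mult norm_power divide_right_mono power_one_over)
    qed
    show "1 / (z - s) \<in> cball 0 (1 / r)"
      using False r by (auto simp: norm_divide dist_norm norm_minus_commute divide_simps)
  qed auto
  moreover have zs: "z \<noteq> s" "cmod (z - s) \<ge> r" using False r by (auto simp: dist_norm norm_minus_commute)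
  ultimately have "cmod (p z) * (1 / cmod (z - s)) ^ card I \<le> M' * (1 / r) ^ card I"
    using qp[of "1 / (z - s)"] by (simp add: norm_mult[symmetric] norm_power[symmetric] norm_divide[symmetric])
      (metis norm_mult norm_power norm_divide norm_one power_one_over)
  then have "cmod (p z) \<le> M' * (cmod (z - s) / r) ^ card I"
    using zs r by (simp add: field_simps)
  \<comment> \<open>Outside the disc |z - s|/r is at least 1, so the exponent may be raised from the
    degree to \<open>n\<close>.\<close>
  also have "\<dots> \<le> M' * (cmod (z - s) / r) ^ n"
    using zs r n by (intro mult_left_mono power_increasing) (auto simp: M'_def)
  also have "\<dots> = (M * (cmod (z - s) / r)\<^sup>2 / C) powr (real n / 2)"
  proof -
    have "(cmod (z - s) / r) ^ n = (cmod (z - s) / r) powr (2 * (real n / 2))"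
      using zs r by (simp add: powr_realpow)
    also have "\<dots> = ((cmod (z - s) / r)\<^sup>2) powr (real n / 2)"
      using zs r by (subst powr_powr[symmetric]) (simp add: powr_realpow)
    finally show ?thesis
      using M0 C by (simp add: M'_def powr_mult[symmetric])
  qed
  finally have "F z \<le> M * (cmod (z - s) / r)\<^sup>2"
    unfolding Fp using C n M0 by (subst powr_two_over_le_iff) auto
  then show ?thesis using zs r by (simp add: max_def)
qed

section \<open>Poisson modification: reflecting the zeros in a circle\<close>

lemma norm_reflected_sub:
  assumes r: "r > 0"
  shows "(cmod (of_real r - cnj b * x / of_real r))\<^sup>2 - (cmod (x - b))\<^sup>2
     = (r\<^sup>2 - (cmod b)\<^sup>2) * (r\<^sup>2 - (cmod x)\<^sup>2) / r\<^sup>2"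
proof -
  have "complex_of_real ((cmod (of_real r - cnj b * x / of_real r))\<^sup>2 - (cmod (x - b))\<^sup>2)
     = (of_real r - cnj b * x / of_real r) * (of_real r - b * cnj x / of_real r) - (x - b) * (cnj x - cnj b)"
    by (simp only: of_real_diff complex_norm_square) simp
  also have "\<dots> = (of_real (r\<^sup>2) - b * cnj b) * (of_real (r\<^sup>2) - x * cnj x) / of_real (r\<^sup>2)"
    using r by (simp add: field_simps power2_eq_square)
  also have "\<dots> = complex_of_real ((r\<^sup>2 - (cmod b)\<^sup>2) * (r\<^sup>2 - (cmod x)\<^sup>2) / r\<^sup>2)"
    by (simp only: of_real_diff of_real_mult of_real_divide complex_norm_square)
  finally have "complex_of_real ((cmod (of_real r - cnj b * x / of_real r))\<^sup>2 - (cmod (x - b))\<^sup>2)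
     = complex_of_real ((r\<^sup>2 - (cmod b)\<^sup>2) * (r\<^sup>2 - (cmod x)\<^sup>2) / r\<^sup>2)" .
  then show ?thesis by (simp only: of_real_eq_iff)
qed

text \<open>Replacing \<open>|y - a|\<close> by \<open>reflected_factor z r a\<close> for all zeros \<open>a\<close> in the disc \<open>|y - z| < r\<close> is the
  Poisson modification: the potential is unchanged outside the disc and log-harmonic inside.\<close>

definition reflected_factor :: "complex \<Rightarrow> real \<Rightarrow> complex \<Rightarrow> complex \<times> complex \<times> complex" where
  "reflected_factor z r a =
     (if cmod (a - z) < r then (a, - cnj (a - z) / of_real r, of_real r + cnj (a - z) * z / of_real r)
      else (a, 0, 0))"

text \<open>For a zero inside the circle and a point on or outside it, the right-hand side of
  \<open>norm_reflected_sub\<close> is nonpositive, so the maximum is the original modulus.\<close>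

lemma reflected_factor_outside:
  assumes r: "r > 0" and y: "cmod (y - z) \<ge> r"
  shows "affine_factor (reflected_factor z r a) y = cmod (y - a)"
proof (cases "cmod (a - z) < r")
  case True
  have "(cmod (a - z))\<^sup>2 \<le> r\<^sup>2" "(cmod (y - z))\<^sup>2 \<ge> r\<^sup>2"
    using True y r by (auto intro!: power_mono)
  then have "(r\<^sup>2 - (cmod (a - z))\<^sup>2) * (r\<^sup>2 - (cmod (y - z))\<^sup>2) / r\<^sup>2 \<le> 0"
    by (intro divide_nonpos_nonneg mult_nonneg_nonpos) auto
  then have "(cmod (of_real r - cnj (a - z) * (y - z) / of_real r))\<^sup>2 \<le> (cmod ((y - z) - (a - z)))\<^sup>2"
    using norm_reflected_sub[OF r, of "a - z" "y - z"] by linarith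
  then have "cmod (of_real r - cnj (a - z) * (y - z) / of_real r) \<le> cmod (y - a)"
    using power2_le_imp_le[of _ "cmod (y - a)"] by simp
  moreover have "- cnj (a - z) / of_real r * y + (of_real r + cnj (a - z) * z / of_real r)
      = of_real r - cnj (a - z) * (y - z) / of_real r"
    using r by (simp add: field_simps)
  then have "affine_factor (reflected_factor z r a) y
      = max (cmod (y - a)) (cmod (of_real r - cnj (a - z) * (y - z) / of_real r))"
    using True by (simp only: reflected_factor_def affine_factor_def if_True split_conv)
  ultimately show ?thesis
    using True by simp
qed (simp add: reflected_factor_def affine_factor_def)

text \<open>Here both differences in \<open>norm_reflected_sub\<close> are nonnegative and the
  reflected modulus wins. Thus a single affine function describes the factor on the whole closed
  disc.\<close>

lemma reflected_factor_inside:
  assumes r: "r > 0" and y: "cmod (y - z) \<le> r"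
  shows "affine_factor (reflected_factor z r a) y =
    cmod (if cmod (a - z) < r then of_real r - cnj (a - z) * (y - z) / of_real r else y - a)"
proof (cases "cmod (a - z) < r")
  case True
  have "(cmod (a - z))\<^sup>2 \<le> r\<^sup>2" "(cmod (y - z))\<^sup>2 \<le> r\<^sup>2"
    using True y r by (auto intro!: power_mono)
  then have "(r\<^sup>2 - (cmod (a - z))\<^sup>2) * (r\<^sup>2 - (cmod (y - z))\<^sup>2) / r\<^sup>2 \<ge> 0"
    by (intro divide_nonneg_nonneg mult_nonneg_nonneg) auto
  then have "(cmod (of_real r - cnj (a - z) * (y - z) / of_real r))\<^sup>2 \<ge> (cmod ((y - z) - (a - z)))\<^sup>2"
    using norm_reflected_sub[OF r, of "a - z" "y - z"] by linarith
  then have "cmod (of_real r - cnj (a - z) * (y - z) / of_real r) \<ge> cmod (y - a)"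
    using power2_le_imp_le[of "cmod (y - a)"] by simp
  moreover have "- cnj (a - z) / of_real r * y + (of_real r + cnj (a - z) * z / of_real r)
      = of_real r - cnj (a - z) * (y - z) / of_real r"
    using r by (simp add: field_simps)
  then have "affine_factor (reflected_factor z r a) y
      = max (cmod (y - a)) (cmod (of_real r - cnj (a - z) * (y - z) / of_real r))"
    using True by (simp only: reflected_factor_def affine_factor_def if_True split_conv)
  ultimately show ?thesis
    using True by simp
qed (simp add: reflected_factor_def affine_factor_def)

lemma affine_factor_reflected_ge: "cmod (y - a) \<le> affine_factor (reflected_factor z r a) y"
  by (auto simp: reflected_factor_def affine_factor_def)

text \<open>On the closed disc \<open>G\<close> is a power of the modulus of a polynomial without
  zeros in the open disc. The maximum principle bounds it by its boundary values, where it equals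
  \<open>F\<close>; zero-freeness gives a holomorphic \<open>E\<close> with |E| = G, to which the
  Lipschitz bound applies.\<close>

lemma reflected_potential_bounds:
  fixes F :: "complex \<Rightarrow> real"
  assumes C: "C > 0" and I: "finite (I::nat set)" and n: "n \<ge> 1" and r: "r > 0"
    and F: "\<And>y. F y = C * (\<Prod>k\<in>I. cmod (y - a k) powr (2 / real n))"
    and G: "\<And>y. G y = C * (\<Prod>k\<in>I. affine_factor (reflected_factor z r (a k)) y powr (2 / real n))"
    and B: "\<forall>y\<in>sphere z r. F y \<le> B"
  shows "\<And>y. cmod (y - z) \<ge> r \<Longrightarrow> G y = F y"
    and "\<And>y. F y \<le> G y"
    and "\<And>y. cmod (y - z) \<le> r \<Longrightarrow> G y \<le> B"
    and "\<And>w. w \<in> ball z (r / 2) \<Longrightarrow> G w \<le> G z + 4 * B / r * cmod (w - z)"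
proof -
  show out: "G y = F y" if "cmod (y - z) \<ge> r" for y
    unfolding F G by (simp add: reflected_factor_outside[OF r that])
  show "F y \<le> G y" for y
    unfolding F G using C affine_factor_reflected_ge
    by (intro mult_left_mono prod_mono conjI powr_mono2) auto
  define h where "h k y = (if cmod (a k - z) < r then of_real r - cnj (a k - z) * (y - z) / of_real r else y - a k)" for k y
  have G_eq: "G y = C * cmod (\<Prod>k\<in>I. h k y) powr (2 / real n)" if "cmod (y - z) \<le> r" for y
    unfolding G prod_powr_eq[OF I, symmetric] h_def reflected_factor_inside[OF r that] ..
  have hol_h: "h k holomorphic_on X" for k X
    unfolding h_def using r by (cases "cmod (a k - z) < r") (auto intro!: holomorphic_intros)
  have [simp]: "sphere z r \<noteq> {}" using r by simp
  then obtain y0 where y0: "y0 \<in> sphere z r" by blast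
  have "F y0 \<ge> 0" unfolding F using C by (intro mult_nonneg_nonneg prod_nonneg) auto
  then have B0: "B \<ge> 0" using bspec[OF B y0] by simp
  show le_B: "G y \<le> B" if y: "cmod (y - z) \<le> r" for y
  proof -
    have "cmod (\<Prod>k\<in>I. h k y) \<le> (B / C) powr (real n / 2)"
    proof (rule maximum_modulus_frontier[of "\<lambda>y. \<Prod>k\<in>I. h k y" "cball z r"])
      show "(\<lambda>y. \<Prod>k\<in>I. h k y) holomorphic_on interior (cball z r)"
        by (intro holomorphic_on_prod hol_h)
      show "continuous_on (closure (cball z r)) (\<lambda>y. \<Prod>k\<in>I. h k y)"
        by (intro continuous_on_prod) (rule holomorphic_on_imp_continuous_on[OF hol_h])
      fix u assume "u \<in> frontier (cball z r)"
      then have u: "u \<in> sphere z r" using r by (simp add: frontier_cball)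
      then have "cmod (u - z) = r" by (simp add: dist_norm norm_minus_commute)
      then have "C * cmod (\<Prod>k\<in>I. h k u) powr (2 / real n) \<le> B"
        using bspec[OF B u] out[of u] G_eq[of u] by simp
      then show "cmod (\<Prod>k\<in>I. h k u) \<le> (B / C) powr (real n / 2)"
        using C n B0 by (subst (asm) powr_two_over_le_iff) auto
    qed (use y in \<open>auto simp: dist_norm norm_minus_commute\<close>)
    then show ?thesis
      unfolding G_eq[OF y] using C n B0 by (subst powr_two_over_le_iff) auto
  qed
  define A where "A k = (if cmod (a k - z) < r then of_real r else z - a k)" for k
  \<comment> \<open>The zero of \<open>h k\<close>, if it has one, is
    \<open>z + 1 / \<xi> k\<close>. It lies on or outside the circle, whence |\<xi>| \<le> 1/r and
    the factorization \<open>h_eq\<close> with \<open>1 - \<xi> k * (y - z)\<close> in the right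
    half-plane.\<close>
  define \<xi> where "\<xi> k = (if cmod (a k - z) < r then cnj (a k - z) / (of_real r)\<^sup>2 else 1 / (a k - z))" for k
  have A0: "A k \<noteq> 0" for k using r by (auto simp: A_def)
  have h_eq: "h k y = A k * (1 - \<xi> k * (y - z))" for k y
  proof (cases "cmod (a k - z) < r")
    case True
    then show ?thesis using r by (simp add: h_def A_def \<xi>_def field_simps power2_eq_square)
  next
    case False
    then have "a k - z \<noteq> 0" using r by auto
    then have "(z - a k) * (1 / (a k - z) * (y - z)) = z - y" by (simp add: field_simps)
    then show ?thesis using False by (simp add: h_def A_def \<xi>_def right_diff_distrib)
  qed
  have \<xi>: "cmod (\<xi> k) \<le> 1 / r" for k
  proof (cases "cmod (a k - z) < r")
    case True
    have "cmod (\<xi> k) = cmod (a k - z) / r\<^sup>2"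
      using True by (simp add: \<xi>_def norm_divide norm_power complex_mod_cnj[of "a k - z", simplified])
    also have "\<dots> \<le> r / r\<^sup>2" using True by (intro divide_right_mono) auto
    finally show ?thesis using r by (simp add: power2_eq_square)
  next
    case False
    then show ?thesis using r by (simp add: \<xi>_def norm_divide frac_le)
  qed
  have pos: "Re (1 - \<xi> k * (y - z)) > 0" if y: "y \<in> ball z r" for k y
  proof -
    have "cmod (\<xi> k * (y - z)) \<le> (1 / r) * cmod (y - z)"
      unfolding norm_mult by (intro mult_right_mono \<xi>) auto
    also have "\<dots> < 1" using y r by (simp add: dist_norm norm_minus_commute)
    finally show ?thesis using complex_Re_le_cmod[of "\<xi> k * (y - z)"] by simp
  qed
  \<comment> \<open>A holomorphic branch of C times the product of the \<open>h k\<close> to the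
    power 2/n, up to phase; only its modulus matters.\<close>
  define E where "E y = exp (of_real (ln C) + (\<Sum>k\<in>I. of_real (2 / real n) * (of_real (ln (cmod (A k))) + Ln (1 - \<xi> k * (y - z)))))" for y
  have norm_E: "cmod (E y) = G y" if y: "y \<in> ball z r" for y
  proof -
    have nz: "1 - \<xi> k * (y - z) \<noteq> 0" for k
      using pos[OF y, of k] by (metis less_irrefl zero_complex.sel(1))
    have h0: "h k y \<noteq> 0" for k using nz A0 by (simp add: h_eq)
    have re: "Re (of_real (2 / real n) * (of_real (ln (cmod (A k))) + Ln (1 - \<xi> k * (y - z))))
        = 2 / real n * ln (cmod (h k y))" for k
      using nz[of k] A0[of k] by (simp add: h_eq norm_mult ln_mult)
    have "cmod (E y) = exp (ln C + (\<Sum>k\<in>I. 2 / real n * ln (cmod (h k y))))"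
      unfolding E_def norm_exp_eq_Re plus_complex.sel Re_sum re by simp
    also have "\<dots> = C * (\<Prod>k\<in>I. cmod (h k y) powr (2 / real n))"
      using C h0 I by (simp add: exp_add exp_sum powr_def)
    also have "\<dots> = G y"
      using y by (subst G_eq) (auto simp: prod_powr_eq[OF I] dist_norm norm_minus_commute)
    finally show ?thesis .
  qed
  have hol: "E holomorphic_on ball z r"
  proof -
    have "1 - \<xi> k * (y - z) \<notin> \<real>\<^sub>\<le>\<^sub>0" if "y \<in> ball z r" for k y
      using pos[OF that, of k] by (auto simp: complex_nonpos_Reals_iff)
    then show ?thesis
      unfolding E_def by (intro holomorphic_intros) auto
  qed
  show "G w \<le> G z + 4 * B / r * cmod (w - z)" if w: "w \<in> ball z (r / 2)" for w
  proof -
    have "cmod (E w - E z) \<le> 4 * B / r * cmod (w - z)"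
      by (rule holomorphic_bounded_lipschitz[OF hol _ w])
         (auto simp: norm_E dist_norm norm_minus_commute intro!: le_B)
    moreover have "cmod (E w) - cmod (E z) \<le> cmod (E w - E z)"
      by (rule norm_triangle_ineq2)
    moreover have "w \<in> ball z r" using w r by auto
    ultimately show ?thesis using r by (simp add: norm_E)
  qed
qed

text \<open>The truncated distance is the affine factor whose second function is the constant
  \<open>r\<close>; a fresh index \<open>m\<close> carries it with exponent share t. The other
  shares are scaled to (1 - t)/n, so they add up to at most 1 - t and stay positive.\<close>

lemma affine_potential_interpolation:
  assumes C: "C > 0" and I: "finite (I::nat set)" and n: "n \<ge> 1" "card I \<le> n"
    and t: "0 < t" "t < 1" and R: "R > 0" and r: "r > 0"
  shows "(\<lambda>y. (C * (\<Prod>k\<in>I. affine_factor (A k) y powr (2 / real n))) powr (1 - t) *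
      ((max (cmod (y - z)) r / R)\<^sup>2) powr t) \<in> affine_potentials" (is "?g \<in> _")
proof -
  obtain m where m: "m \<notin> I" using I ex_new_if_finite infinite_UNIV_nat by blast
  define A' where "A' k = (if k = m then (z, 0, of_real r) else A k)" for k
  define c where "c k = (if k = m then t else (1 - t) / real n)" for k
  have I_eq: "A' k = A k" "c k = (1 - t) / real n" if "k \<in> I" for k
    using that m by (auto simp: A'_def c_def)
  have "?g = (\<lambda>y. (C powr (1 - t) * (1 / R) powr (2 * t)) * (\<Prod>k\<in>insert m I. affine_factor (A' k) y powr (2 * c k)))"
  proof
    fix y
    have "(C * (\<Prod>k\<in>I. affine_factor (A k) y powr (2 / real n))) powr (1 - t)
       = C powr (1 - t) * (\<Prod>k\<in>I. affine_factor (A k) y powr (2 / real n)) powr (1 - t)"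
      using C by (simp add: powr_mult prod_nonneg)
    also have "(\<Prod>k\<in>I. affine_factor (A k) y powr (2 / real n)) powr (1 - t)
       = (\<Prod>k\<in>I. affine_factor (A' k) y powr (2 * c k))"
      by (subst prod_powr_distrib) (auto simp: powr_powr I_eq mult.commute intro!: prod.cong)
    finally have 1: "(C * (\<Prod>k\<in>I. affine_factor (A k) y powr (2 / real n))) powr (1 - t)
       = C powr (1 - t) * (\<Prod>k\<in>I. affine_factor (A' k) y powr (2 * c k))" .
    have pos: "max (cmod (y - z)) r > 0" using r by simp
    have "((max (cmod (y - z)) r / R)\<^sup>2) powr t = (max (cmod (y - z)) r / R) powr (2 * t)"
      using pos R by (subst powr_powr[symmetric]) (simp add: powr_realpow)
    also have "\<dots> = max (cmod (y - z)) r powr (2 * t) * (1 / R) powr (2 * t)"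
      using pos R by (subst powr_mult[symmetric]) auto
    finally have "((max (cmod (y - z)) r / R)\<^sup>2) powr t
       = max (cmod (y - z)) r powr (2 * t) * (1 / R) powr (2 * t)" .
    moreover have "max (cmod (y - z)) r = affine_factor (A' m) y"
      using r by (simp add: A'_def affine_factor_def)
    ultimately have 2: "((max (cmod (y - z)) r / R)\<^sup>2) powr t
       = affine_factor (A' m) y powr (2 * t) * (1 / R) powr (2 * t)"
      by simp
    show "?g y = (C powr (1 - t) * (1 / R) powr (2 * t)) * (\<Prod>k\<in>insert m I. affine_factor (A' k) y powr (2 * c k))"
      unfolding 1 2 using m I by (simp add: c_def)
  qed
  moreover have "sum c (insert m I) \<le> 1"
  proof -
    have "sum c (insert m I) = t + real (card I) * ((1 - t) / real n)"
      using m I by (simp add: c_def[of m] I_eq)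
    also have "real (card I) * ((1 - t) / real n) \<le> real n * ((1 - t) / real n)"
      using n t by (intro mult_right_mono) auto
    finally show ?thesis using n by simp
  qed
  moreover have "\<forall>k\<in>insert m I. c k > 0"
    using t n by (auto simp: c_def)
  moreover have "C powr (1 - t) * (1 / R) powr (2 * t) > 0" using C R by simp
  ultimately show ?thesis
    unfolding affine_potentials_def mem_Collect_eq using I finite_insert[of m I] by blast
qed

section \<open>From the pointwise to the uniform gap, for an abstract weight in place of
  e^(-Q)\<close>

locale weighted_droplet =
  fixes v :: "complex \<Rightarrow> real" and S :: "complex set"
  assumes v_nonneg: "v z \<ge> 0"
    and v_usc: "open {z. v z < x}"
    and v_decay: "\<exists>\<epsilon>>0. \<exists>R\<ge>1. \<forall>z. cmod z \<ge> R \<longrightarrow> v z \<le> cmod z powr (- 2 - \<epsilon>)"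
    and v_lower: "\<exists>s r m. r > 0 \<and> m > 0 \<and> (\<forall>z\<in>cball s r. v z \<ge> m)"
    and gap: "z \<notin> S \<Longrightarrow>
      \<exists>q<1. \<forall>F\<in>affine_potentials. (\<forall>w. F w * v w \<le> 1) \<longrightarrow> F z * v z \<le> q"
begin

definition admissible :: "(complex \<Rightarrow> real) set" where
  "admissible = {F \<in> poly_potentials. \<forall>w. F w * v w \<le> 1}"

text \<open>On a compact disc finitely many of the open sets \<open>{z. v z < real k}\<close>
  suffice; beyond it the decay of \<open>v\<close> takes over.\<close>

lemma v_bounded: "\<exists>V>0. \<forall>z. v z * (1 + cmod z)\<^sup>2 \<le> V"
proof -
  obtain \<epsilon> R where \<epsilon>: "\<epsilon> > 0" "R \<ge> 1" and dec: "\<And>z. cmod z \<ge> R \<Longrightarrow> v z \<le> cmod z powr (- 2 - \<epsilon>)"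
    using v_decay by blast
  have "\<exists>b. \<forall>z\<in>cball 0 R. v z \<le> b"
  proof -
    have "cball 0 R \<subseteq> (\<Union>k::nat. {z. v z < real k})"
      using reals_Archimedean2 by auto
    then obtain T where T: "finite T" "cball 0 R \<subseteq> (\<Union>k\<in>T. {z. v z < real k})"
      using compactE_image[of "cball (0::complex) R" UNIV "\<lambda>k::nat. {z. v z < real k}"] v_usc
      by (metis compact_cball)
    have "v z \<le> real (Max T)" if z: "z \<in> cball 0 R" for z
    proof -
      obtain k where "k \<in> T" "v z < real k" using subsetD[OF T(2) z] by blast
      then show ?thesis using Max_ge[OF T(1), of k] by linarith
    qed
    then show ?thesis by blast
  qed
  then obtain b where b: "\<And>z. z \<in> cball 0 R \<Longrightarrow> v z \<le> b" by blast
  have b0: "b \<ge> 0" using b[of 0] v_nonneg[of 0] \<epsilon> by simp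
  have "v z * (1 + cmod z)\<^sup>2 \<le> b * (1 + R)\<^sup>2 + 4" for z
  proof (cases "cmod z \<le> R")
    case True
    then have "v z * (1 + cmod z)\<^sup>2 \<le> b * (1 + R)\<^sup>2"
      using b[of z] v_nonneg[of z] by (intro mult_mono power_mono) auto
    then show ?thesis by simp
  next
    case False
    then have z: "cmod z \<ge> 1" "cmod z \<ge> R" using \<epsilon> by auto
    have "v z \<le> cmod z powr (- 2)"
      using dec[OF z(2)] powr_mono[of "- 2 - \<epsilon>" "- 2" "cmod z"] z \<epsilon> by simp
    then have "v z * (1 + cmod z)\<^sup>2 \<le> cmod z powr (- 2) * (2 * cmod z)\<^sup>2"
      using z v_nonneg[of z] by (intro mult_mono power_mono) auto
    also have "\<dots> = 4"
    proof -
      have "cmod z powr (- 2) = inverse ((cmod z)\<^sup>2)"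
        using z by (simp add: powr_minus powr_realpow)
      moreover have "z \<noteq> 0" using z by auto
      ultimately show ?thesis by (simp add: power2_eq_square field_simps)
    qed
    finally show ?thesis using b0 by (simp add: add_increasing)
  qed
  moreover have "b * (1 + R)\<^sup>2 + 4 > 0" using b0 by (intro add_nonneg_pos) auto
  ultimately show ?thesis by blast
qed

text \<open>Every admissible function is at most 1/m on the disc from \<open>v_lower\<close>.
  Bernstein-Walsh propagates this to the plane uniformly in the function and its degree.\<close>

lemma admissible_bounded: "\<exists>B>0. \<forall>F\<in>admissible. \<forall>z. F z \<le> B * (1 + cmod z)\<^sup>2"
proof -
  obtain s r m where r: "r > 0" and m: "m > 0" and v: "\<And>z. z \<in> cball s r \<Longrightarrow> v z \<ge> m"
    using v_lower by blast
  define b where "b = 1 + (1 + cmod s) / r"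
  have b: "b \<ge> 1" using r by (simp add: b_def)
  have "F z \<le> ((1 / m) * b\<^sup>2) * (1 + cmod z)\<^sup>2" if F: "F \<in> admissible" for F z
  proof -
    have "F z \<le> (1 / m) * (max 1 (cmod (z - s) / r))\<^sup>2"
    proof (rule bernstein_walsh)
      show "F y \<le> 1 / m" if "y \<in> cball s r" for y
      proof -
        have "F y * m \<le> F y * v y"
          using v[OF that] F by (intro mult_left_mono) (auto simp: admissible_def poly_potentials_nonneg)
        also have "\<dots> \<le> 1" using F by (simp add: admissible_def)
        finally show ?thesis using m by (simp add: field_simps)
      qed
    qed (use F r in \<open>auto simp: admissible_def\<close>)
    moreover have "max 1 (cmod (z - s) / r) \<le> b * (1 + cmod z)"
    proof -
      have "cmod (z - s) \<le> (1 + cmod s) * (1 + cmod z)"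
        using norm_triangle_ineq4[of z s] mult_nonneg_nonneg[OF norm_ge_zero[of s] norm_ge_zero[of z]]
        unfolding distrib_left distrib_right by linarith
      then have "cmod (z - s) / r \<le> ((1 + cmod s) / r) * (1 + cmod z)"
        using r by (simp add: divide_right_mono)
      moreover have "((1 + cmod s) / r) * (1 + cmod z) \<le> b * (1 + cmod z)"
        unfolding b_def by (intro mult_right_mono) auto
      moreover have "1 \<le> b * (1 + cmod z)" using b mult_mono[of 1 b 1 "1 + cmod z"] by simp
      ultimately show ?thesis by simp
    qed
    then have "(1 / m) * (max 1 (cmod (z - s) / r))\<^sup>2 \<le> (1 / m) * (b * (1 + cmod z))\<^sup>2"
      using m by (intro mult_left_mono power_mono) auto
    ultimately show ?thesis
      by (simp add: power_mult_distrib)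
  qed
  moreover have "(1 / m) * b\<^sup>2 > 0" using m b by (intro mult_pos_pos) auto
  ultimately show ?thesis by blast
qed

text \<open>If the gap at \<open>z\<close> failed to be locally uniform, then some admissible \<open>F\<close> would nearly attain, at a point
  very close to \<open>z\<close>, the local supremum \<open>\<Lambda> \<ge> 1 / v z\<close>. Its Poisson modification is nearly \<open>\<Lambda>\<close> at \<open>z\<close> itself,
  but may violate the obstacle inside the disc of radius \<open>r\<close>. A weighted geometric mean with the
  truncation of \<open>|y - z|\<^sup>2 / R\<^sup>2\<close> at radius \<open>r\<close> restores the obstacle condition and yields a member of the class
  with \<open>g z * v z\<close> arbitrarily close to 1.\<close>

lemma local_gap:
  assumes z: "z \<notin> S"
  shows "\<exists>\<rho>>0. \<exists>q<1. \<forall>w\<in>ball z \<rho>. \<forall>F\<in>admissible. F w * v w \<le> q"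
proof (rule ccontr)
  assume "\<not> ?thesis"
  then have neg: "\<exists>w\<in>ball z \<rho>. \<exists>F\<in>admissible. F w * v w > q" if "\<rho> > 0" "q < 1" for \<rho> q
    using that by (meson not_le)
  obtain V where V: "V > 0" "\<And>z. v z * (1 + cmod z)\<^sup>2 \<le> V" using v_bounded by blast
  obtain B where B: "B > 0" "\<And>F z. F \<in> admissible \<Longrightarrow> F z \<le> B * (1 + cmod z)\<^sup>2"
    using admissible_bounded by blast
  have adm_nonneg: "F w \<ge> 0" if "F \<in> admissible" for F w
    using that by (simp add: admissible_def poly_potentials_nonneg)
  \<comment> \<open>The levels reached by admissible functions arbitrarily near \<open>z\<close>.
    The supremum \<Lambda> is the upper limit at \<open>z\<close> of the pointwise supremum of the
    class.\<close>
  define T where "T = {x. \<forall>\<rho>>0. \<exists>w\<in>ball z \<rho>. \<exists>F\<in>admissible. F w \<ge> x}"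
  define \<Lambda> where "\<Lambda> = Sup T"
  have T0: "0 \<in> T"
    unfolding T_def using neg[of _ 0] adm_nonneg by fastforce
  have Tb: "x \<le> B * (2 + cmod z)\<^sup>2" if x: "x \<in> T" for x
  proof -
    obtain w F where w: "w \<in> ball z 1" and F: "F \<in> admissible" "F w \<ge> x"
      using x unfolding T_def by (auto dest: spec[of _ 1])
    have "cmod w \<le> 1 + cmod z"
      using w norm_triangle_ineq2[of w z] by (simp add: dist_norm norm_minus_commute)
    then have "B * (1 + cmod w)\<^sup>2 \<le> B * (2 + cmod z)\<^sup>2"
      using B by (intro mult_left_mono power_mono) auto
    then show ?thesis using B(2)[OF F(1), of w] F by linarith
  qed
  have bdd: "bdd_above T" using Tb by (rule bdd_aboveI)
  have \<Lambda>0: "\<Lambda> \<ge> 0" unfolding \<Lambda>_def by (rule cSup_upper[OF T0 bdd])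
  have upper: "\<exists>\<rho>>0. \<forall>w\<in>ball z \<rho>. \<forall>F\<in>admissible. F w < \<Lambda> + e" if "e > 0" for e
  proof -
    have "\<Lambda> + e \<notin> T" using cSup_upper[OF _ bdd, of "\<Lambda> + e"] that by (auto simp: \<Lambda>_def)
    then show ?thesis unfolding T_def by (auto simp: not_le)
  qed
  have lower: "\<exists>w\<in>ball z \<rho>. \<exists>F\<in>admissible. F w > \<Lambda> - e" if e: "e > 0" and \<rho>: "\<rho> > 0" for e \<rho>
  proof -
    have "\<Lambda> - e < Sup T" using e by (simp add: \<Lambda>_def)
    then obtain x where x: "x \<in> T" "x > \<Lambda> - e"
      using less_cSupD[of T "\<Lambda> - e"] T0 by blast
    then have "\<exists>w\<in>ball z \<rho>. \<exists>F\<in>admissible. F w \<ge> x"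
      unfolding T_def using \<rho> by blast
    with x(2) show ?thesis by (meson less_le_trans)
  qed
  have v_near: "\<exists>\<rho>>0. \<forall>w\<in>ball z \<rho>. v w < v z + e" if "e > 0" for e
  proof -
    have "z \<in> {w. v w < v z + e}" using that by simp
    then obtain \<rho> where "\<rho> > 0" "ball z \<rho> \<subseteq> {w. v w < v z + e}"
      using v_usc[of "v z + e"] open_contains_ball by blast
    then show ?thesis by blast
  qed
  have \<Lambda>v: "\<Lambda> * v z \<ge> 1"
  proof (rule ccontr)
    assume "\<not> ?thesis"
    then have lt: "\<Lambda> * v z < 1" by simp
    define D where "D = \<Lambda> + v z + 1"
    \<comment> \<open>Small enough that (\<Lambda> + e)(v z + e) < 1: the increase e(\<Lambda> + v z
      + e) is at most \<open>e * D\<close>, half of the deficit. This product bounds all F w * v w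
      near \<open>z\<close>, contradicting \<open>neg\<close>.\<close>
    define e where "e = min 1 ((1 - \<Lambda> * v z) / (2 * D))"
    have D: "D \<ge> 1" using \<Lambda>0 v_nonneg[of z] by (simp add: D_def)
    have e: "e > 0" "e \<le> 1" "e * D \<le> (1 - \<Lambda> * v z) / 2"
    proof -
      show "e > 0" using lt D by (simp add: e_def)
      show "e \<le> 1" by (simp add: e_def)
      have "e * D \<le> ((1 - \<Lambda> * v z) / (2 * D)) * D" using D by (intro mult_right_mono) (auto simp: e_def)
      then show "e * D \<le> (1 - \<Lambda> * v z) / 2" using D by simp
    qed
    obtain \<rho>1 where \<rho>1: "\<rho>1 > 0" "\<And>w F. w \<in> ball z \<rho>1 \<Longrightarrow> F \<in> admissible \<Longrightarrow> F w < \<Lambda> + e"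
      using upper[OF e(1)] by blast
    obtain \<rho>2 where \<rho>2: "\<rho>2 > 0" "\<And>w. w \<in> ball z \<rho>2 \<Longrightarrow> v w < v z + e"
      using v_near[OF e(1)] by blast
    have "(\<Lambda> + e) * (v z + e) < 1"
    proof -
      have "(\<Lambda> + e) * (v z + e) = \<Lambda> * v z + e * (\<Lambda> + v z + e)" by (simp add: algebra_simps)
      also have "e * (\<Lambda> + v z + e) \<le> e * D" using e by (intro mult_left_mono) (auto simp: D_def)
      finally show ?thesis using e(3) lt by simp
    qed
    from neg[OF _ this, of "min \<rho>1 \<rho>2"] obtain w F where w: "w \<in> ball z \<rho>1" "w \<in> ball z \<rho>2"
      and F: "F \<in> admissible" and gt: "F w * v w > (\<Lambda> + e) * (v z + e)"
      using \<rho>1(1) \<rho>2(1) by auto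
    have "F w * v w \<le> (\<Lambda> + e) * (v z + e)"
      using \<rho>1(2)[OF w(1) F] \<rho>2(2)[OF w(2)] adm_nonneg[OF F] v_nonneg[of w] \<Lambda>0 e
      by (intro mult_mono) auto
    with gt show False by simp
  qed
  have vz: "v z > 0" and \<Lambda>: "\<Lambda> > 0"
    using \<Lambda>v \<Lambda>0 v_nonneg[of z] by (smt (verit) mult_eq_0_iff)+
  obtain q where q: "q < 1" "\<And>F. F \<in> affine_potentials \<Longrightarrow> (\<And>w. F w * v w \<le> 1) \<Longrightarrow> F z * v z \<le> q"
    using gap[OF z] by blast
  \<comment> \<open>Makes 1 - 4\<eta> exceed the pointwise gap constant \<open>q\<close>; the
    competitor built below reaches at least 1 - 4\<eta> at \<open>z\<close>.\<close>
  define \<eta> where "\<eta> = min (1/8) ((1 - q) / 8)"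
  have \<eta>: "\<eta> > 0" "\<eta> \<le> 1/8" "1 - 4 * \<eta> > q" using q(1) by (auto simp: \<eta>_def min_def field_simps)
  \<comment> \<open>With this scale |y - z|^2 / R^2 itself satisfies the obstacle condition on the
    whole plane, as \<open>vR\<close> states.\<close>
  define R where "R = sqrt V * (1 + cmod z)"
  have R: "R > 0" using V by (simp add: R_def add_pos_nonneg)
  have vR: "v y * (cmod (y - z) / R)\<^sup>2 \<le> 1" for y
  proof -
    have "cmod (y - z) \<le> (1 + cmod y) * (1 + cmod z)"
      using norm_triangle_ineq4[of y z] mult_nonneg_nonneg[OF norm_ge_zero[of y] norm_ge_zero[of z]]
      unfolding distrib_left distrib_right by linarith
    then have "v y * (cmod (y - z))\<^sup>2 \<le> v y * ((1 + cmod y) * (1 + cmod z))\<^sup>2"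
      using v_nonneg by (intro mult_left_mono power_mono) auto
    also have "\<dots> \<le> V * (1 + cmod z)\<^sup>2"
      using V(2)[of y] by (simp add: power_mult_distrib mult.assoc[symmetric] mult_right_mono)
    also have "\<dots> = R\<^sup>2" using V by (simp add: R_def power_mult_distrib)
    finally show ?thesis using R by (simp add: power_divide divide_simps)
  qed
  obtain \<rho>1 where \<rho>1: "\<rho>1 > 0" "\<And>w F. w \<in> ball z \<rho>1 \<Longrightarrow> F \<in> admissible \<Longrightarrow> F w < \<Lambda> + \<eta> * \<Lambda>"
    using upper[of "\<eta> * \<Lambda>"] \<eta> \<Lambda> by auto
  obtain \<rho>2 where \<rho>2: "\<rho>2 > 0" "\<And>w. w \<in> ball z \<rho>2 \<Longrightarrow> v w < v z + \<eta> * v z"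
    using v_near[of "\<eta> * v z"] \<eta> vz by auto
  \<comment> \<open>Radii up to this one make the truncated quadratic small against the weight near
    \<open>z\<close>, giving \<open>Y < 1\<close>.\<close>
  define \<rho>3 where "\<rho>3 = R / (2 * sqrt (1 + v z))"
  have \<rho>3: "\<rho>3 > 0" using R vz by (simp add: \<rho>3_def)
  define r where "r = min (min (\<rho>1 / 2) (\<rho>2 / 2)) \<rho>3"
  have r: "r > 0" "r < \<rho>1" "r < \<rho>2" "r \<le> \<rho>3" using \<rho>1(1) \<rho>2(1) \<rho>3 by (auto simp: r_def)
  \<comment> \<open>The Lipschitz constant of the Poisson modification is 4B'/r, so moving from
    \<open>w\<close> to \<open>z\<close> costs at most B'\<eta>/2, hence at most
    \<eta>\<Lambda>.\<close>
  obtain w F where w: "w \<in> ball z (\<eta> * r / 8)" and F: "F \<in> admissible" and Fw: "F w > \<Lambda> - \<eta> * \<Lambda>"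
    using lower[of "\<eta> * \<Lambda>" "\<eta> * r / 8"] \<eta> \<Lambda> r by auto
  obtain C I a n where F_eq: "F = (\<lambda>z. C * (\<Prod>k\<in>I. cmod (z - a k) powr (2 / real n)))"
    and C: "C > 0" and I: "finite (I::nat set)" and n: "n \<ge> 1" "card I \<le> n"
    using F unfolding admissible_def poly_potentials_def by auto
  define G where "G y = C * (\<Prod>k\<in>I. affine_factor (reflected_factor z r (a k)) y powr (2 / real n))" for y
  define B' where "B' = (1 + \<eta>) * \<Lambda>"
  have B': "B' > 0" using \<eta> \<Lambda> by (simp add: B'_def)
  have FB: "\<forall>y\<in>sphere z r. F y \<le> B'"
    using \<rho>1(2)[OF _ F] r by (force simp: B'_def algebra_simps intro: less_imp_le)
  note G = reflected_potential_bounds[OF C I n(1) r(1), of F a G, OF fun_cong[OF F_eq] G_def FB]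
  have G0: "G y \<ge> 0" for y
    unfolding G_def using C by (intro mult_nonneg_nonneg prod_nonneg) auto
  \<comment> \<open>\<open>X\<close> and \<open>Y\<close> bound, inside the disc, the weight times
    the Poisson modification and times the truncated quadratic. The first may violate the obstacle
    by a factor slightly above 1, the second has room to spare.\<close>
  define X where "X = B' * ((1 + \<eta>) * v z)"
  define Y where "Y = (r / R)\<^sup>2 * ((1 + \<eta>) * v z)"
  have X: "X > 1"
  proof -
    have "X = (1 + \<eta>)\<^sup>2 * (\<Lambda> * v z)" by (simp add: X_def B'_def power2_eq_square)
    also have "\<dots> \<ge> (1 + \<eta>)\<^sup>2 * 1" using \<Lambda>v by (intro mult_left_mono) auto
    finally have "X \<ge> (1 + \<eta>)\<^sup>2" by simp
    moreover have "(1 + \<eta>)\<^sup>2 > 1" using \<eta> by (simp add: one_less_power)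
    ultimately show ?thesis by linarith
  qed
  have Y: "Y > 0" "Y < 1"
  proof -
    show "Y > 0" using r R \<eta> vz by (simp add: Y_def)
    have "(r / R)\<^sup>2 \<le> (\<rho>3 / R)\<^sup>2"
      using r R by (intro power_mono divide_right_mono) auto
    also have "\<dots> = 1 / (4 * (1 + v z))"
      using R vz by (simp add: \<rho>3_def power_divide power_mult_distrib)
    finally have "Y \<le> 1 / (4 * (1 + v z)) * ((1 + \<eta>) * v z)"
      unfolding Y_def using \<eta> vz by (intro mult_right_mono) auto
    also have "\<dots> < 1"
    proof -
      have "(1 + \<eta>) * v z \<le> 2 * v z" using \<eta> vz by (intro mult_right_mono) auto
      also have "2 * v z < 4 * (1 + v z)" using vz by simp
      finally have "(1 + \<eta>) * v z < 4 * (1 + v z)" .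
      then show ?thesis using vz by (simp add: divide_simps)
    qed
    finally show "Y < 1" .
  qed
  \<comment> \<open>The mixing parameter solving
    \<open>X powr (1 - t) * Y powr t = 1\<close>.\<close>
  define t where "t = ln X / (ln X - ln Y)"
  have lnX: "ln X > 0" and lnY: "ln Y < 0" using X Y by auto
  have t: "0 < t" "t < 1" using lnX lnY by (auto simp: t_def divide_simps)
  have XY: "X powr (1 - t) * Y powr t = 1"
  proof -
    have "(1 - t) * ln X + t * ln Y = ln X - t * (ln X - ln Y)" by (simp add: algebra_simps)
    also have "\<dots> = 0" using lnX lnY by (simp add: t_def)
    finally show ?thesis using X Y by (simp add: powr_def exp_add[symmetric])
  qed
  define g where "g y = G y powr (1 - t) * ((max (cmod (y - z)) r / R)\<^sup>2) powr t" for y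
  have "g \<in> affine_potentials"
    unfolding g_def G_def by (rule affine_potential_interpolation[OF C I n t R r(1)])
  \<comment> \<open>Outside the disc G = F, so both ingredients satisfy the obstacle condition and
    so does their geometric mean. Inside, the choice of t balances excess against room.\<close>
  moreover have "g y * v y \<le> 1" for y
  proof (cases "cmod (y - z) \<ge> r")
    case True
    show ?thesis
    proof (cases "v y = 0")
      case False
      then have vy: "v y > 0" using v_nonneg[of y] by simp
      have "v y = v y powr (1 - t) * v y powr t" using vy by (simp add: powr_add[symmetric])
      then have "g y * v y = (F y * v y) powr (1 - t) * (v y * (cmod (y - z) / R)\<^sup>2) powr t"
        using True G(1)[OF True] adm_nonneg[OF F, of y] vy
        by (simp add: g_def max_absorb1 powr_mult mult_ac)
      also have "\<dots> \<le> 1 powr (1 - t) * 1 powr t"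
        using F vR[of y] t vy adm_nonneg[OF F, of y] unfolding admissible_def
        by (intro mult_mono powr_mono2) auto
      finally show ?thesis by simp
    qed simp
  next
    case False
    then have y: "cmod (y - z) \<le> r" by simp
    have vy: "v y \<le> (1 + \<eta>) * v z"
      using \<rho>2(2)[of y] y r by (simp add: dist_norm norm_minus_commute algebra_simps)
    have "g y * v y \<le> (B' powr (1 - t) * ((r / R)\<^sup>2) powr t) * ((1 + \<eta>) * v z)"
      using y vy G(3)[OF y] G0[of y] v_nonneg[of y] t unfolding g_def
      by (intro mult_mono powr_mono2) (auto simp: max_absorb2)
    also have "\<dots> = X powr (1 - t) * Y powr t"
    proof -
      have pos: "(1 + \<eta>) * v z > 0" using \<eta> vz by simp
      then have "(1 + \<eta>) * v z = ((1 + \<eta>) * v z) powr (1 - t) * ((1 + \<eta>) * v z) powr t"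
        by (simp add: powr_add[symmetric])
      then show ?thesis
        unfolding X_def Y_def powr_mult[of B'] powr_mult[of "(r / R)\<^sup>2"] using pos B' by simp
    qed
    finally show ?thesis using XY by simp
  qed
  ultimately have gz: "g z * v z \<le> q" by (rule q(2))
  have Gz: "G z \<ge> (1 - 2 * \<eta>) * \<Lambda>"
  proof -
    have "\<eta> * r \<le> 1 / 8 * r" using \<eta> r by (intro mult_right_mono) auto
    then have wr: "w \<in> ball z (r / 2)" using w r unfolding mem_ball by linarith
    have dw: "cmod (w - z) < \<eta> * r / 8" using w by (simp add: dist_norm norm_minus_commute)
    have "4 * B' / r * cmod (w - z) \<le> 4 * B' / r * (\<eta> * r / 8)"
      using dw B' r by (intro mult_left_mono) auto
    also have "\<dots> = B' * \<eta> / 2" using r by simp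
    also have "\<dots> \<le> \<eta> * \<Lambda>"
    proof -
      have "(1 + \<eta>) * (\<Lambda> * \<eta>) \<le> 2 * (\<Lambda> * \<eta>)"
        using \<eta> \<Lambda> by (intro mult_right_mono) auto
      then show ?thesis by (simp add: B'_def mult_ac)
    qed
    finally have "G w \<le> G z + \<eta> * \<Lambda>" using G(4)[OF wr] by simp
    moreover have "F w \<le> G w" by (rule G(2))
    ultimately show ?thesis using Fw by (simp add: algebra_simps)
  qed
  have "(1 - 2 * \<eta>) / (1 + \<eta>)\<^sup>2 \<le> g z * v z"
  proof -
    \<comment> \<open>Since x \<le> 1, raising it to the power 1 - t only increases it. The lower
      bound for \<open>g z * v z\<close> is therefore free of t and of the radius.\<close>
    define x where "x = G z / B'"
    have "(1 - 2 * \<eta>) * \<Lambda> > 0" using \<eta> \<Lambda> by (intro mult_pos_pos) auto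
    with Gz have Gz_pos: "G z > 0" by linarith
    have x: "0 < x" "x \<le> 1" using G(3)[of z] r B' Gz_pos by (simp_all add: x_def)
    have pos: "(1 + \<eta>) * v z > 0" using \<eta> vz by simp
    have "x \<le> x powr (1 - t)" using powr_mono'[of "1 - t" 1 x] x t by simp
    also have "x powr (1 - t) = x powr (1 - t) * (X powr (1 - t) * Y powr t)" using XY by simp
    also have "\<dots> = (x * X) powr (1 - t) * Y powr t"
      using x X by (simp add: powr_mult)
    also have "x * X = G z * ((1 + \<eta>) * v z)" using B' by (simp add: x_def X_def)
    also have "(G z * ((1 + \<eta>) * v z)) powr (1 - t) * Y powr t
       = g z * (((1 + \<eta>) * v z) powr (1 - t) * ((1 + \<eta>) * v z) powr t)"
    proof -
      have "max (cmod (z - z)) r = r" using r by simp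
      then show ?thesis
        unfolding Y_def g_def powr_mult[of "G z"] powr_mult[of "(r / R)\<^sup>2"] by (simp only: mult_ac)
    qed
    also have "((1 + \<eta>) * v z) powr (1 - t) * ((1 + \<eta>) * v z) powr t = (1 + \<eta>) * v z"
      using pos by (simp add: powr_add[symmetric])
    finally have "x / (1 + \<eta>) \<le> g z * v z" using \<eta> by (simp add: field_simps)
    moreover have "(1 - 2 * \<eta>) \<le> G z / \<Lambda>"
      using Gz \<Lambda> by (simp add: pos_le_divide_eq)
    then have "(1 - 2 * \<eta>) / (1 + \<eta>) \<le> G z / \<Lambda> / (1 + \<eta>)"
      using \<eta> by (intro divide_right_mono) auto
    then have "(1 - 2 * \<eta>) / (1 + \<eta>) \<le> x"
      by (simp add: x_def B'_def mult.commute)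
    then have "(1 - 2 * \<eta>) / (1 + \<eta>) / (1 + \<eta>) \<le> x / (1 + \<eta>)"
      using \<eta> by (intro divide_right_mono) auto
    ultimately show ?thesis by (simp add: power2_eq_square)
  qed
  moreover have "(1 - 2 * \<eta>) / (1 + \<eta>)\<^sup>2 \<ge> 1 - 4 * \<eta>"
  proof -
    have "(1 - 4 * \<eta>) * (1 + \<eta>)\<^sup>2 = 1 - 2 * \<eta> - 7 * \<eta>\<^sup>2 - 4 * \<eta> ^ 3"
      by (simp add: power2_eq_square power3_eq_cube algebra_simps)
    also have "\<dots> \<le> 1 - 2 * \<eta>"
      using \<eta> zero_le_power2[of \<eta>] zero_le_power[of \<eta> 3] by linarith
    finally show ?thesis using \<eta> by (simp add: divide_simps)
  qed
  ultimately show False using gz \<eta> by linarith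
qed

text \<open>Local gaps give a uniform one on the compact part off \<open>U\<close>; far out, the
  decay of the weight beats quadratic growth. The extra negative power of 1 + |y|^2 will make the
  n-th powers integrable.\<close>

lemma uniform_gap:
  assumes U: "open U" "S \<subseteq> U"
  shows "\<exists>q \<eta>. 0 < q \<and> q < 1 \<and> \<eta> > 0 \<and>
    (\<forall>F\<in>admissible. \<forall>y. y \<notin> U \<longrightarrow> F y * v y \<le> q * (1 + (cmod y)\<^sup>2) powr (- \<eta>))"
proof -
  obtain \<epsilon> R where \<epsilon>: "\<epsilon> > 0" "R \<ge> 1" and dec: "\<And>z. cmod z \<ge> R \<Longrightarrow> v z \<le> cmod z powr (- 2 - \<epsilon>)"
    using v_decay by blast
  obtain B where B: "B > 0" "\<And>F z. F \<in> admissible \<Longrightarrow> F z \<le> B * (1 + cmod z)\<^sup>2"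
    using admissible_bounded by blast
  \<comment> \<open>Ensures 8B \<le> |y|^(\<epsilon>/2) from this radius on: half of the decay
    |y|^(-\<epsilon>) absorbs the constants, the other half remains.\<close>
  define R1 where "R1 = max (max R 2) ((8 * B) powr (2 / \<epsilon>))"
  have R1: "R1 \<ge> R" "R1 \<ge> 2" by (auto simp: R1_def)
  have far: "F y * v y \<le> 1 / 2 * (1 + (cmod y)\<^sup>2) powr (- (\<epsilon> / 8))"
    if F: "F \<in> admissible" and y: "cmod y \<ge> R1" for F y
  proof -
    have y2: "cmod y \<ge> R" "cmod y \<ge> 2" using y R1 by auto
    have "F y * v y \<le> B * (1 + cmod y)\<^sup>2 * (cmod y powr (- 2 - \<epsilon>))"
      using B(2)[OF F, of y] dec[OF y2(1)] v_nonneg[of y] B(1)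
      by (intro mult_mono) auto
    also have "\<dots> \<le> B * (2 * cmod y)\<^sup>2 * (cmod y powr (- 2 - \<epsilon>))"
      using y2 B(1) by (intro mult_right_mono mult_left_mono power_mono) auto
    also have "\<dots> = 4 * B * ((cmod y)\<^sup>2 * cmod y powr (- 2 - \<epsilon>))"
      by (simp add: power_mult_distrib)
    also have "(cmod y)\<^sup>2 * cmod y powr (- 2 - \<epsilon>) = cmod y powr (- (\<epsilon> / 2)) * cmod y powr (- (\<epsilon> / 2))"
    proof -
      have "(cmod y)\<^sup>2 = cmod y powr 2" using y2 by (simp add: powr_realpow)
      then show ?thesis by (simp only: powr_add[symmetric]) simp
    qed
    also have "4 * B * (cmod y powr (- (\<epsilon> / 2)) * cmod y powr (- (\<epsilon> / 2)))
        \<le> 1 / 2 * cmod y powr (- (\<epsilon> / 2))"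
    proof -
      have "8 * B = ((8 * B) powr (2 / \<epsilon>)) powr (\<epsilon> / 2)" using B(1) \<epsilon> by (simp add: powr_powr)
      also have "\<dots> \<le> cmod y powr (\<epsilon> / 2)"
        using y \<epsilon> by (intro powr_mono2) (auto simp: R1_def)
      finally have "8 * B * cmod y powr (- (\<epsilon> / 2)) \<le> cmod y powr (\<epsilon> / 2) * cmod y powr (- (\<epsilon> / 2))"
        by (intro mult_right_mono) auto
      also have "\<dots> = 1" using y2 by (auto simp: powr_add[symmetric])
      finally have "4 * B * cmod y powr (- (\<epsilon> / 2)) \<le> 1 / 2" by simp
      from mult_right_mono[OF this, of "cmod y powr (- (\<epsilon> / 2))"] show ?thesis by (simp add: mult.assoc)
    qed
    \<comment> \<open>The fourth power dominates 1 + |y|^2 once |y| \<ge> 2, which is the origin of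
      the exponent \<epsilon>/8.\<close>
    also have "cmod y powr (- (\<epsilon> / 2)) = ((cmod y) ^ 4) powr (- (\<epsilon> / 8))"
    proof -
      have "(cmod y) ^ 4 = cmod y powr 4" using y2 by (simp add: powr_realpow)
      then show ?thesis by (simp only: powr_powr) simp
    qed
    also have "1 / 2 * ((cmod y) ^ 4) powr (- (\<epsilon> / 8)) \<le> 1 / 2 * (1 + (cmod y)\<^sup>2) powr (- (\<epsilon> / 8))"
    proof -
      have "2\<^sup>2 \<le> (cmod y)\<^sup>2" using y2 by (intro power_mono) auto
      then have "4 \<le> (cmod y)\<^sup>2" by simp
      moreover from this have "4 * (cmod y)\<^sup>2 \<le> (cmod y)\<^sup>2 * (cmod y)\<^sup>2" by (intro mult_right_mono) auto
      moreover have "(cmod y) ^ 4 = (cmod y)\<^sup>2 * (cmod y)\<^sup>2" by (simp add: power2_eq_square power4_eq_xxxx)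
      ultimately have "1 + (cmod y)\<^sup>2 \<le> (cmod y) ^ 4" by linarith
      then show ?thesis
        using \<epsilon> by (intro mult_left_mono powr_mono2') (auto intro: add_pos_nonneg)
    qed
    finally show ?thesis .
  qed
  let ?K = "cball 0 R1 - U"
  have "\<exists>q<1. \<forall>w\<in>?K. \<forall>F\<in>admissible. F w * v w \<le> q"
  proof -
    have "\<forall>z\<in>?K. \<exists>\<rho> q. \<rho> > 0 \<and> q < 1 \<and> (\<forall>w\<in>ball z \<rho>. \<forall>F\<in>admissible. F w * v w \<le> q)"
      using local_gap U(2) by blast
    then obtain \<rho> q where \<rho>q: "\<And>z. z \<in> ?K \<Longrightarrow> \<rho> z > 0 \<and> q z < (1::real) \<and>
        (\<forall>w\<in>ball z (\<rho> z). \<forall>F\<in>admissible. F w * v w \<le> q z)"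
      by metis
    have "compact ?K" using U(1) by (intro compact_diff) auto
    moreover have "?K \<subseteq> (\<Union>z\<in>?K. ball z (\<rho> z))" using \<rho>q by force
    ultimately obtain T where T: "T \<subseteq> ?K" "finite T" "?K \<subseteq> (\<Union>z\<in>T. ball z (\<rho> z))"
      using compactE_image[of ?K ?K "\<lambda>z. ball z (\<rho> z)"] by auto
    \<comment> \<open>Inserting 0 keeps the maximum defined when the finite cover is empty.\<close>
    define q0 where "q0 = Max (insert 0 (q ` T))"
    have "q0 < 1" unfolding q0_def using T \<rho>q by (subst Max_less_iff) auto
    moreover have "F w * v w \<le> q0" if w: "w \<in> ?K" and F: "F \<in> admissible" for w F
    proof -
      obtain z where z: "z \<in> T" "w \<in> ball z (\<rho> z)" using T(3) w by blast
      then have "F w * v w \<le> q z" using \<rho>q[of z] T(1) F by blast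
      also have "q z \<le> q0" unfolding q0_def using z T(2) by (intro Max_ge) auto
      finally show ?thesis .
    qed
    ultimately show ?thesis by blast
  qed
  then obtain q' where q': "q' < 1" "\<And>w F. w \<in> ?K \<Longrightarrow> F \<in> admissible \<Longrightarrow> F w * v w \<le> q'" by blast
  define q1 where "q1 = max q' (1 / 2)"
  have q1: "1 / 2 \<le> q1" "q1 < 1" "q' \<le> q1" using q' by (auto simp: q1_def)
  define q where "q = (1 + q1) / 2"
  have q: "q1 < q" "q < 1" using q1 by (auto simp: q_def)
  define L where "L = 1 + R1\<^sup>2"
  have L: "L > 1" using R1 by (simp add: L_def)
  \<comment> \<open>The room between \<open>q1\<close> and \<open>q\<close> pays for the decaying
    factor on the disc, where 1 + |y|^2 \<le> L: this choice gives L^\<eta> \<le> q/q1.\<close>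
  define \<eta> where "\<eta> = min (\<epsilon> / 8) (ln (q / q1) / ln L)"
  have "ln (q / q1) > 0" using q q1 by (intro ln_gt_zero) auto
  then have \<eta>: "\<eta> > 0" "\<eta> \<le> \<epsilon> / 8" "\<eta> * ln L \<le> ln (q / q1)"
    using L \<epsilon> by (auto simp: \<eta>_def min_def field_simps)
  have near: "q1 \<le> q * (1 + (cmod y)\<^sup>2) powr (- \<eta>)" if y: "cmod y \<le> R1" for y
  proof -
    have "exp (\<eta> * ln L) \<le> exp (ln (q / q1))" using \<eta>(3) by simp
    moreover have "q / q1 > 0" using q q1 by simp
    ultimately have "L powr \<eta> \<le> q / q1" using L by (simp add: powr_def)
    then have "q1 * L powr \<eta> \<le> q" using q1 by (simp add: field_simps)
    then have "q1 * L powr \<eta> * L powr (- \<eta>) \<le> q * L powr (- \<eta>)" by (intro mult_right_mono) auto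
    then have "q1 \<le> q * L powr (- \<eta>)" using L by (simp add: mult.assoc powr_add[symmetric])
    also have "\<dots> \<le> q * (1 + (cmod y)\<^sup>2) powr (- \<eta>)"
      using q q1 \<eta> y unfolding L_def
      by (intro mult_left_mono powr_mono2') (auto intro: add_pos_nonneg power_mono)
    finally show ?thesis .
  qed
  have "F y * v y \<le> q * (1 + (cmod y)\<^sup>2) powr (- \<eta>)" if F: "F \<in> admissible" and y: "y \<notin> U" for F y
  proof (cases "cmod y \<le> R1")
    case True
    then show ?thesis using q'(2)[of y F] y F near[OF True] q1 by auto
  next
    case False
    have "(1 + (cmod y)\<^sup>2) powr (- (\<epsilon> / 8)) \<le> (1 + (cmod y)\<^sup>2) powr (- \<eta>)"
      using \<eta> by (intro powr_mono) auto
    then have "1 / 2 * (1 + (cmod y)\<^sup>2) powr (- (\<epsilon> / 8)) \<le> q * (1 + (cmod y)\<^sup>2) powr (- \<eta>)"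
      using q q1 by (intro mult_mono) auto
    then show ?thesis using far[OF F, of y] False by simp
  qed
  then show ?thesis using q q1 \<eta> by (intro exI[of _ q] exI[of _ \<eta>]) auto
qed

end

section \<open>The weight of an external potential\<close>

lemma real_linear_complex_eq:
  assumes "linear (f :: complex \<Rightarrow> real)"
  shows "f h = Re ((f 1 - \<i> * f \<i>) * h)"
proof -
  have "h = Re h *\<^sub>R 1 + Im h *\<^sub>R \<i>" by (simp add: complex_eq_iff)
  then have "f h = f (Re h *\<^sub>R 1 + Im h *\<^sub>R \<i>)" by simp
  also have "\<dots> = Re h * f 1 + Im h * f \<i>"
    using assms by (simp add: linear_add linear_scale)
  finally show ?thesis by (simp add: algebra_simps)
qed

text \<open>The second derivative is bounded on a compact neighbourhood, and the mean value
  inequality is used twice, for \<open>f'\<close> and for the remainder along the segment. Writing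
  the linear term as the real part of a complex linear function later turns it into the modulus of
  an entire exponential.\<close>

lemma C2_taylor_uniform:
  assumes f: "C2_smooth_on f U" and U: "open U" and S: "compact S" "S \<subseteq> U"
  shows "\<exists>\<rho>>0. \<exists>A\<ge>0. \<exists>c. \<forall>s\<in>S. \<forall>z\<in>ball s (2 * \<rho>). \<forall>w\<in>ball z \<rho>.
     w \<in> U \<and> \<bar>f w - f z - Re (c z * (w - z))\<bar> \<le> A * (cmod (w - z))\<^sup>2"
proof -
  obtain f' f'' where d1: "\<And>z. z \<in> U \<Longrightarrow> (f has_derivative blinfun_apply (f' z)) (at z)"
    and d2: "\<And>z. z \<in> U \<Longrightarrow> (f' has_derivative blinfun_apply (f'' z)) (at z)"
    and cont: "continuous_on U f''"
    using f unfolding C2_smooth_on_def by blast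
  obtain e where e: "e > 0" "(\<Union>x\<in>S. ball x e) \<subseteq> U"
    using compact_subset_open_imp_ball_epsilon_subset[OF S(1) U S(2)] by blast
  \<comment> \<open>Points within \<rho> of a point within 2\<rho> of \<open>S\<close> are within
    3\<rho> < e of \<open>S\<close>, hence in \<open>U\<close>.\<close>
  define \<rho> where "\<rho> = e / 4"
  have \<rho>: "\<rho> > 0" using e by (simp add: \<rho>_def)
  define K where "K = {x + y | x y. x \<in> S \<and> y \<in> cball 0 (3 * \<rho>)}"
  have K: "compact K" unfolding K_def by (intro compact_sums S compact_cball)
  have "K \<subseteq> U"
  proof
    fix u assume "u \<in> K"
    then obtain x y where "x \<in> S" "u = x + y" "cmod y \<le> 3 * \<rho>" unfolding K_def by auto
    then have "u \<in> ball x e" using \<rho> by (simp add: \<rho>_def dist_norm)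
    then show "u \<in> U" using e \<open>x \<in> S\<close> by blast
  qed
  have "bounded (f'' ` K)"
    by (intro compact_imp_bounded compact_continuous_image continuous_on_subset[OF cont \<open>K \<subseteq> U\<close>] K)
  then obtain A where A: "A > 0" "\<And>x. x \<in> K \<Longrightarrow> norm (f'' x) \<le> A"
    unfolding bounded_pos by auto
  define c where "c z = of_real (blinfun_apply (f' z) 1) - \<i> * of_real (blinfun_apply (f' z) \<i>)" for z
  have "w \<in> U \<and> \<bar>f w - f z - Re (c z * (w - z))\<bar> \<le> A * (cmod (w - z))\<^sup>2"
    if s: "s \<in> S" and z: "z \<in> ball s (2 * \<rho>)" and w: "w \<in> ball z \<rho>" for s z w
  proof -
    have sub: "ball z \<rho> \<subseteq> K"
    proof
      fix u assume "u \<in> ball z \<rho>"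
      then have "cmod (u - s) \<le> 3 * \<rho>"
        using z dist_triangle[of s u z] by (simp add: dist_norm norm_minus_commute)
      then show "u \<in> K" unfolding K_def using s by (intro CollectI exI[of _ s] exI[of _ "u - s"]) auto
    qed
    then have subU: "ball z \<rho> \<subseteq> U" using \<open>K \<subseteq> U\<close> by blast
    have zin: "z \<in> ball z \<rho>" using \<rho> by simp
    have lip: "norm (f' x - f' z) \<le> A * norm (x - z)" if "x \<in> ball z \<rho>" for x
    proof (rule differentiable_bound[OF convex_ball[of z \<rho>]])
      show "(f' has_derivative blinfun_apply (f'' x)) (at x within ball z \<rho>)" if "x \<in> ball z \<rho>" for x
        using d2 subU that by (blast intro: has_derivative_at_withinI)
      show "onorm (blinfun_apply (f'' x)) \<le> A" if "x \<in> ball z \<rho>" for x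
        using A(2)[of x] sub that by (auto simp: norm_blinfun.rep_eq)
    qed (use that zin in auto)
    have seg: "closed_segment z w \<subseteq> ball z \<rho>"
      using zin w by (simp add: closed_segment_subset)
    have "norm ((f w - f' z w) - (f z - f' z z)) \<le> (A * norm (w - z)) * norm (w - z)"
    proof (rule differentiable_bound[OF convex_closed_segment[of z w]])
      fix x assume x: "x \<in> closed_segment z w"
      then have xb: "x \<in> ball z \<rho>" using seg by blast
      show "((\<lambda>w. f w - f' z w) has_derivative blinfun_apply (f' x - f' z)) (at x within closed_segment z w)"
      proof -
        have "((\<lambda>w. f w - f' z w) has_derivative (\<lambda>h. f' x h - f' z h)) (at x within closed_segment z w)"
          by (intro has_derivative_diff has_derivative_at_withinI[OF d1] bounded_linear_imp_has_derivative
                blinfun.bounded_linear_right) (use xb subU in auto)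
        then show ?thesis by (simp add: blinfun.diff_left[abs_def] minus_blinfun.rep_eq)
      qed
      have "norm (f' x - f' z) \<le> A * norm (x - z)" by (rule lip[OF xb])
      also have "\<dots> \<le> A * norm (w - z)"
        using A(1) segment_bound1[OF x] by (intro mult_left_mono) auto
      finally show "onorm (blinfun_apply (f' x - f' z)) \<le> A * norm (w - z)"
        by (simp add: norm_blinfun.rep_eq)
    qed auto
    moreover have "(f w - f' z w) - (f z - f' z z) = f w - f z - Re (c z * (w - z))"
      using real_linear_complex_eq[OF bounded_linear.linear[OF blinfun.bounded_linear_right], of "f' z" "w - z"]
      by (simp add: c_def blinfun.diff_right)
    ultimately show ?thesis using w subU by (auto simp: power2_eq_square)
  qed
  then show ?thesis using \<rho> A(1) by (intro exI[of _ \<rho>] conjI exI[of _ A] exI[of _ c]) auto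
qed

text \<open>Otherwise the open null sets cover the space, and by Lindelof countably many of them do,
  so the total mass would be zero.\<close>

lemma measure_support_nonempty:
  fixes \<mu> :: "'a :: second_countable_topology measure"
  assumes "prob_space \<mu>" "sets \<mu> = sets borel"
  shows "measure_support \<mu> \<noteq> {}"
proof
  interpret prob_space \<mu> by fact
  assume "measure_support \<mu> = {}"
  then have cover: "\<Union>{U. open U \<and> emeasure \<mu> U = 0} = UNIV"
    unfolding measure_support_def by (auto simp: zero_less_iff_neq_zero)
  obtain \<U> where \<U>: "\<U> \<subseteq> {U. open U \<and> emeasure \<mu> U = 0}" "countable \<U>" "\<Union>\<U> = UNIV"
    using Lindelof[of "{U. open U \<and> emeasure \<mu> U = 0}"] cover by auto
  have "(\<Union>U\<in>\<U>. U) \<in> null_sets \<mu>"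
    using \<U> assms(2) by (intro null_sets_UN') (auto simp: null_sets_def)
  then have "emeasure \<mu> UNIV = 0" using \<U>(3) by auto
  moreover have "space \<mu> = UNIV" using sets_eq_imp_space_eq[OF assms(2)] by simp
  ultimately show False using emeasure_space_1 by simp
qed

section \<open>Semicontinuity, decay and positivity of the weight e^(-Q)\<close>

lemma weight_nonneg [simp]: "weight Q z \<ge> 0"
  by (simp add: weight_def)

lemma weight_less_iff:
  assumes "Q z \<noteq> - \<infinity>" "x > 0"
  shows "weight Q z < x \<longleftrightarrow> Q z > ereal (- ln x)"
proof (cases "Q z")
  case (real q)
  have "exp (- q) < x \<longleftrightarrow> - q < ln x" using assms(2) by (metis exp_less_cancel_iff exp_ln)
  then show ?thesis using real by (auto simp: weight_def)
qed (use assms in \<open>auto simp: weight_def\<close>)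

text \<open>A real y strictly between 1 and the lower limit yields the weight bound |z|^(-2y), so
  \<epsilon> = 2y - 2. Restricting to |z| \<ge> 2 keeps the logarithm positive.\<close>

lemma weight_decay:
  assumes Q: "external_potential Q"
  shows "\<exists>\<epsilon>>0. \<exists>R\<ge>1. \<forall>z. cmod z \<ge> R \<longrightarrow> weight Q z \<le> cmod z powr (- 2 - \<epsilon>)"
proof -
  have "1 < Liminf at_infinity (\<lambda>z. Q z / ereal (2 * ln (cmod z)))"
    using Q by (simp add: external_potential_def)
  then obtain y where y: "1 < ereal y" "ereal y < Liminf at_infinity (\<lambda>z. Q z / ereal (2 * ln (cmod z)))"
    using ereal_dense2 by blast
  from less_LiminfD[OF y(2)] obtain b where b: "\<And>z. cmod z \<ge> b \<Longrightarrow> ereal y < Q z / ereal (2 * ln (cmod z))"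
    unfolding eventually_at_infinity by blast
  have "weight Q z \<le> cmod z powr (- 2 - (2 * y - 2))" if z: "cmod z \<ge> max b 2" for z
  proof (cases "Q z")
    case (real q)
    have ln: "ln (cmod z) > 0" using z by (intro ln_gt_zero) auto
    have "y < q / (2 * ln (cmod z))" using b[of z] z real ln by simp
    then have "- q \<le> - (2 * y) * ln (cmod z)" using ln by (simp add: field_simps)
    then have "exp (- q) \<le> exp (- (2 * y) * ln (cmod z))" by simp
    then show ?thesis using real z by (auto simp: weight_def powr_def)
  next
    case MInf
    then show ?thesis using Q by (auto simp: external_potential_def)
  qed (simp add: weight_def)
  then show ?thesis using y(1) by (intro exI[of _ "2 * y - 2"] conjI exI[of _ "max b 2"]) auto
qed

text \<open>Around a droplet point Q is finite and continuous, hence bounded above on a disc; this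
  is the starting disc for Bernstein-Walsh.\<close>

lemma weight_lower:
  assumes "C2_near Q S" "S \<noteq> {}" and Q: "\<And>z. Q z \<noteq> - \<infinity>"
  shows "\<exists>s r m. r > 0 \<and> m > 0 \<and> (\<forall>z\<in>cball s r. weight Q z \<ge> m)"
proof -
  obtain U where U: "open U" "S \<subseteq> U" "\<And>z. z \<in> U \<Longrightarrow> Q z < \<infinity>" "C2_smooth_on (\<lambda>z. real_of_ereal (Q z)) U"
    using assms(1) unfolding C2_near_def by blast
  obtain s where s: "s \<in> S" using assms(2) by blast
  let ?f = "\<lambda>z. real_of_ereal (Q z)"
  have "isCont ?f s"
    using U(2,4) s unfolding C2_smooth_on_def by (meson has_derivative_continuous subsetD)
  then have "\<forall>\<^sub>F z in nhds s. ?f z < ?f s + 1"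
    using order_tendstoD(2)[of ?f "?f s" "nhds s"] by (simp add: isCont_def tendsto_at_iff_tendsto_nhds[of ?f])
  moreover have "\<forall>\<^sub>F z in nhds s. z \<in> U" using U(1,2) s by (auto intro: eventually_nhds_in_open)
  ultimately have "\<forall>\<^sub>F z in nhds s. ?f z < ?f s + 1 \<and> z \<in> U" by eventually_elim auto
  then obtain r where r: "r > 0" "\<And>z. dist z s < r \<Longrightarrow> ?f z < ?f s + 1 \<and> z \<in> U"
    unfolding eventually_nhds_metric by blast
  have "weight Q z \<ge> exp (- ?f s - 1)" if "z \<in> cball s (r / 2)" for z
  proof -
    have "?f z < ?f s + 1" "z \<in> U" using r(2)[of z] that r(1) by (auto simp: dist_commute)
    then show ?thesis using U(3)[of z] by (auto simp: weight_def)
  qed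
  then show ?thesis using r(1) by (intro exI[of _ s] exI[of _ "r / 2"] exI[of _ "exp (- ?f s - 1)"]) auto
qed

lemma weighted_droplet_weight:
  assumes Q: "external_potential Q" and S: "C2_near Q S" "S \<noteq> {}"
    and gap: "\<And>\<zeta>. \<zeta> \<notin> S \<Longrightarrow> Q \<zeta> > (SUP f\<in>obstacle_class Q. f \<zeta>)"
  shows "weighted_droplet (weight Q) S"
proof
  have Q0: "\<And>z. Q z \<noteq> - \<infinity>" and Qlsc: "\<And>a. open {z. Q z > a}"
    using Q by (auto simp: external_potential_def)
  show "weight Q z \<ge> 0" for z by simp
  show "open {z. weight Q z < x}" for x
  proof (cases "x > 0")
    case True
    then show ?thesis using Qlsc by (simp add: weight_less_iff Q0)
  next
    case False
    then have "{z. weight Q z < x} = {}" using weight_nonneg[of Q] by (auto simp: not_less intro: order_trans)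
    then show ?thesis by simp
  qed
  show "\<exists>\<epsilon>>0. \<exists>R\<ge>1. \<forall>z. cmod z \<ge> R \<longrightarrow> weight Q z \<le> cmod z powr (- 2 - \<epsilon>)"
    by (rule weight_decay[OF Q])
  show "\<exists>s r m. r > 0 \<and> m > 0 \<and> (\<forall>z\<in>cball s r. weight Q z \<ge> m)"
    by (rule weight_lower[OF S Q0])
  show "\<exists>q<1. \<forall>F\<in>affine_potentials. (\<forall>w. F w * weight Q w \<le> 1) \<longrightarrow> F z * weight Q z \<le> q"
    if "z \<notin> S" for z
    by (rule affine_potential_gap[OF Q0 gap[OF that]])
qed

section \<open>Weighted polynomials near the droplet\<close>

text \<open>The expansion point ranges over the 2\<rho>-neighbourhood of \<open>S\<close>, although
  \<open>nbhd\<close> has radius \<rho>: the sub-mean value property is also applied at points up to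
  1/sqrt n \<le> \<rho> away from \<open>nbhd\<close>.\<close>

locale regular_droplet = weighted_droplet +
  fixes \<rho> A :: real and c :: "complex \<Rightarrow> complex" and f :: "complex \<Rightarrow> real"
  assumes \<rho>: "\<rho> > 0" and A: "A \<ge> 0" and S: "bounded S" "S \<noteq> {}"
    and v_exp: "s \<in> S \<Longrightarrow> z \<in> ball s (2 * \<rho>) \<Longrightarrow> w \<in> ball z \<rho> \<Longrightarrow> v w = exp (- f w)"
    and taylor: "s \<in> S \<Longrightarrow> z \<in> ball s (2 * \<rho>) \<Longrightarrow> w \<in> ball z \<rho> \<Longrightarrow>
      \<bar>f w - f z - Re (c z * (w - z))\<bar> \<le> A * (cmod (w - z))\<^sup>2"
begin

definition nbhd :: "complex set" where "nbhd = (\<Union>s\<in>S. ball s \<rho>)"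

text \<open>The function \<open>G\<close> of the introduction. With \<open>I = {1..n} - {j}\<close>
  its \<beta>-th power is the unnormalized conditional density of the j-th point, and
  \<open>wpoly_mass\<close> is the normalization.\<close>

definition wpoly :: "nat \<Rightarrow> nat set \<Rightarrow> (nat \<Rightarrow> complex) \<Rightarrow> complex \<Rightarrow> real" where
  "wpoly n I a y = (\<Prod>k\<in>I. (cmod (y - a k))\<^sup>2) * v y ^ n"

definition wpoly_mass :: "real \<Rightarrow> nat \<Rightarrow> nat set \<Rightarrow> (nat \<Rightarrow> complex) \<Rightarrow> ennreal" where
  "wpoly_mass \<beta> n I a = (\<integral>\<^sup>+y. ennreal (wpoly n I a y powr \<beta>) \<partial>dA)"

lemma wpoly_nonneg: "wpoly n I a y \<ge> 0"
  by (simp add: wpoly_def prod_nonneg v_nonneg)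

lemma v_measurable [measurable]: "v \<in> borel_measurable borel"
  by (rule borel_measurableI_less) (use v_usc in simp)

lemma wpoly_measurable [measurable]: "wpoly n I a \<in> borel_measurable borel"
  unfolding wpoly_def by measurable

lemma open_nbhd: "open nbhd" and S_subset_nbhd: "S \<subseteq> nbhd"
  using \<rho> by (auto simp: nbhd_def)

text \<open>The entire function \<open>g\<close> of the introduction: e^(-nf/2) is replaced by the
  exponential of the first-order expansion of f at \<open>z\<close>, which makes it holomorphic in
  \<open>w\<close>.\<close>

definition local_poly :: "nat \<Rightarrow> nat set \<Rightarrow> (nat \<Rightarrow> complex) \<Rightarrow> complex \<Rightarrow> complex \<Rightarrow> complex" where
  "local_poly n I a z w =
     (\<Prod>k\<in>I. w - a k) * exp (- of_real (real n / 2) * (of_real (f z) + c z * (w - z)))"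

lemma local_poly_holomorphic: "local_poly n I a z holomorphic_on X"
  unfolding local_poly_def by (intro holomorphic_intros)

text \<open>The two sides differ by the exponential of n times the Taylor remainder. At r = n^(-1/2)
  the factor becomes the constant e^A.\<close>

lemma local_poly_bounds:
  assumes s: "s \<in> S" "z \<in> ball s (2 * \<rho>)" and r: "r \<le> \<rho>" and w: "w \<in> ball z r"
  shows "(cmod (local_poly n I a z w))\<^sup>2 \<le> exp (real n * A * r\<^sup>2) * wpoly n I a w"
    and "wpoly n I a w \<le> exp (real n * A * r\<^sup>2) * (cmod (local_poly n I a z w))\<^sup>2"
    and "(cmod (local_poly n I a z z))\<^sup>2 = wpoly n I a z"
proof -
  have w\<rho>: "w \<in> ball z \<rho>" using w r by simp
  have r0: "cmod (w - z) \<le> r" using w by (simp add: dist_norm norm_minus_commute)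
  define P where "P u = (\<Prod>k\<in>I. (cmod (u - a k))\<^sup>2)" for u
  have P0: "P u \<ge> 0" for u by (simp add: P_def prod_nonneg)
  have lp: "(cmod (local_poly n I a z u))\<^sup>2 = P u * exp (- real n * (f z + Re (c z * (u - z))))" for u
  proof -
    define X where "X = of_real (f z) + c z * (u - z)"
    have "(cmod (exp (- of_real (real n / 2) * X)))\<^sup>2 = exp (2 * (- (real n / 2) * Re X))"
      unfolding norm_exp_eq_Re exp_double by (simp flip: of_real_divide)
    also have "\<dots> = exp (- real n * Re X)" by simp
    also have "Re X = f z + Re (c z * (u - z))" unfolding X_def plus_complex.sel by simp
    finally show ?thesis
      unfolding local_poly_def X_def[symmetric] norm_mult power_mult_distrib P_def
      by (simp add: prod_power_distrib prod_norm[symmetric])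
  qed
  have wp: "wpoly n I a u = P u * exp (- real n * f u)" if "u \<in> ball z \<rho>" for u
    using v_exp[OF s that] by (simp add: wpoly_def P_def exp_of_nat_mult[symmetric])
  have T: "\<bar>f w - f z - Re (c z * (w - z))\<bar> \<le> A * r\<^sup>2"
    using taylor[OF s w\<rho>] mult_left_mono[OF power_mono[OF r0, of 2] A] by simp
  have nT: "\<bar>real n * (f w - f z - Re (c z * (w - z)))\<bar> \<le> real n * A * r\<^sup>2"
    using mult_left_mono[OF T, of "real n"] by (simp add: abs_mult mult.assoc)
  have "exp (- real n * (f z + Re (c z * (w - z)))) \<le> exp (real n * A * r\<^sup>2) * exp (- real n * f w)"
    unfolding exp_add[symmetric] using nT by (simp add: algebra_simps abs_le_iff)
  from mult_left_mono[OF this P0[of w]]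
  show "(cmod (local_poly n I a z w))\<^sup>2 \<le> exp (real n * A * r\<^sup>2) * wpoly n I a w"
    unfolding lp wp[OF w\<rho>] by (simp only: mult_ac)
  have "exp (- real n * f w) \<le> exp (real n * A * r\<^sup>2) * exp (- real n * (f z + Re (c z * (w - z))))"
    unfolding exp_add[symmetric] using nT by (simp add: algebra_simps abs_le_iff)
  from mult_left_mono[OF this P0[of w]]
  show "wpoly n I a w \<le> exp (real n * A * r\<^sup>2) * (cmod (local_poly n I a z w))\<^sup>2"
    unfolding lp wp[OF w\<rho>] by (simp only: mult_ac)
  show "(cmod (local_poly n I a z z))\<^sup>2 = wpoly n I a z"
    unfolding lp using wp[of z] \<rho> by simp
qed

text \<open>The area mean inequality with exponent 2\<beta> on the disc of radius n^(-1/2): its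
  normalized area 1/n produces the factor n, and passing back to \<open>wpoly\<close> costs
  e^(A\<beta>).\<close>

lemma wpoly_submean:
  assumes s: "s \<in> S" "z \<in> ball s (2 * \<rho>)" and n: "n \<ge> 1" "1 / sqrt (real n) \<le> \<rho>" and \<beta>: "\<beta> \<ge> 1"
  shows "ennreal (wpoly n I a z powr \<beta>) \<le> ennreal (real n * exp (\<beta> * A)) * wpoly_mass \<beta> n I a"
proof -
  define r where "r = 1 / sqrt (real n)"
  have r: "r > 0" "r \<le> \<rho>" "r\<^sup>2 = 1 / real n" using n by (auto simp: r_def power_divide)
  have nA: "real n * A * r\<^sup>2 = A" using n r by simp
  define E where "E = exp (\<beta> * A)"
  have E: "E > 0" by (simp add: E_def)
  have sq: "x powr (2 * \<beta>) = (x\<^sup>2) powr \<beta>" if "x \<ge> 0" for x :: real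
  proof (cases "x = 0")
    case False
    then have "x > 0" using that by simp
    then show ?thesis by (subst powr_powr[symmetric]) simp
  qed simp
  have le: "cmod (local_poly n I a z w) powr (2 * \<beta>) \<le> E * wpoly n I a w powr \<beta>" if "w \<in> ball z r" for w
  proof -
    have "((cmod (local_poly n I a z w))\<^sup>2) powr \<beta> \<le> (exp A * wpoly n I a w) powr \<beta>"
      using local_poly_bounds(1)[OF s r(2) that, of n I a] \<beta> unfolding nA by (intro powr_mono2) auto
    also have "\<dots> = E * wpoly n I a w powr \<beta>"
      by (simp add: powr_mult E_def wpoly_nonneg) (simp add: powr_def mult.commute)
    finally show ?thesis by (simp add: sq)
  qed
  have "ennreal (r\<^sup>2 * cmod (local_poly n I a z z) powr (2 * \<beta>))
     \<le> (\<integral>\<^sup>+w. indicator (ball z r) w * ennreal (cmod (local_poly n I a z w) powr (2 * \<beta>)) \<partial>dA)"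
    using r \<beta> by (intro area_mean_powr_le local_poly_holomorphic) auto
  also have "\<dots> \<le> (\<integral>\<^sup>+w. ennreal E * ennreal (wpoly n I a w powr \<beta>) \<partial>dA)"
    using le E by (intro nn_integral_mono) (auto simp: indicator_def ennreal_mult[symmetric] intro!: ennreal_leI)
  also have "\<dots> = ennreal E * wpoly_mass \<beta> n I a"
    unfolding wpoly_mass_def by (rule nn_integral_cmult) (simp add: dA_def)
  also have "r\<^sup>2 * cmod (local_poly n I a z z) powr (2 * \<beta>) = (1 / real n) * wpoly n I a z powr \<beta>"
    using local_poly_bounds(3)[OF s order_refl, of z n I a] \<rho> by (simp add: sq r)
  finally have "ennreal (real n) * ennreal ((1 / real n) * wpoly n I a z powr \<beta>)
     \<le> ennreal (real n) * (ennreal E * wpoly_mass \<beta> n I a)"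
    by (rule mult_left_mono) simp
  then show ?thesis
    using n E by (simp add: ennreal_mult[symmetric] mult.assoc[symmetric] E_def)
qed

lemma wpoly_pos:
  assumes I: "finite I"
  shows "\<exists>s\<in>S. \<exists>z\<in>ball s \<rho>. wpoly n I a z > 0"
proof -
  obtain s where s: "s \<in> S" using S by blast
  have "infinite (ball s \<rho>)"
    using \<rho> uncountable_ball countable_finite by blast
  then have "\<not> ball s \<rho> \<subseteq> a ` I" using I finite_subset by blast
  then obtain z where z: "z \<in> ball s \<rho>" "z \<notin> a ` I" by blast
  have "v z = exp (- f z)" using v_exp[OF s, of z z] z \<rho> by auto
  then have "wpoly n I a z > 0"
    using z(2) by (auto simp: wpoly_def intro!: mult_pos_pos prod_pos)
  then show ?thesis using s z by blast
qed

lemma wpoly_mass_pos: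
  assumes I: "finite I" and n: "n \<ge> 1" "1 / sqrt (real n) \<le> \<rho>" and \<beta>: "\<beta> \<ge> 1"
  shows "wpoly_mass \<beta> n I a > 0"
proof -
  obtain s z where s: "s \<in> S" "z \<in> ball s \<rho>" "wpoly n I a z > 0" using wpoly_pos[OF I] by blast
  then have "z \<in> ball s (2 * \<rho>)" using \<rho> by auto
  from wpoly_submean[OF s(1) this n \<beta>, of I a] show ?thesis
    using s(3) by (cases "wpoly_mass \<beta> n I a = 0") (auto simp: zero_less_iff_neq_zero)
qed

text \<open>Each linear factor is at most (1 + |a|)(1 + |y|), and v^n absorbs the resulting (1 +
  |y|)^(2n).\<close>

lemma wpoly_bdd_above:
  assumes I: "finite I" "card I \<le> n"
  shows "bdd_above (range (wpoly n I a))"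
proof -
  obtain V where V: "V > 0" "\<And>z. v z * (1 + cmod z)\<^sup>2 \<le> V" using v_bounded by blast
  have "wpoly n I a y \<le> (\<Prod>k\<in>I. (1 + cmod (a k))\<^sup>2) * V ^ n" for y
  proof -
    have "(\<Prod>k\<in>I. (cmod (y - a k))\<^sup>2) \<le> (\<Prod>k\<in>I. (1 + cmod (a k))\<^sup>2 * (1 + cmod y)\<^sup>2)"
    proof (intro prod_mono conjI)
      fix k
      have "cmod (y - a k) \<le> (1 + cmod (a k)) * (1 + cmod y)"
        using norm_triangle_ineq4[of y "a k"] mult_nonneg_nonneg[OF norm_ge_zero[of "a k"] norm_ge_zero[of y]]
        unfolding distrib_left distrib_right by linarith
      then show "(cmod (y - a k))\<^sup>2 \<le> (1 + cmod (a k))\<^sup>2 * (1 + cmod y)\<^sup>2"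
        unfolding power_mult_distrib[symmetric] by (intro power_mono) auto
    qed auto
    also have "\<dots> = (\<Prod>k\<in>I. (1 + cmod (a k))\<^sup>2) * ((1 + cmod y)\<^sup>2) ^ card I"
      by (simp add: prod.distrib)
    also have "\<dots> \<le> (\<Prod>k\<in>I. (1 + cmod (a k))\<^sup>2) * ((1 + cmod y)\<^sup>2) ^ n"
      using I by (intro mult_left_mono power_increasing prod_nonneg) (auto simp: one_le_power)
    finally have "wpoly n I a y \<le> (\<Prod>k\<in>I. (1 + cmod (a k))\<^sup>2) * ((1 + cmod y)\<^sup>2) ^ n * v y ^ n"
      unfolding wpoly_def by (intro mult_right_mono) (auto simp: v_nonneg)
    also have "\<dots> = (\<Prod>k\<in>I. (1 + cmod (a k))\<^sup>2) * (v y * (1 + cmod y)\<^sup>2) ^ n"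
      by (simp add: power_mult_distrib mult_ac)
    also have "\<dots> \<le> (\<Prod>k\<in>I. (1 + cmod (a k))\<^sup>2) * V ^ n"
      using V(2)[of y] v_nonneg by (intro mult_left_mono power_mono prod_nonneg) auto
    finally show ?thesis .
  qed
  then show ?thesis by (intro bdd_aboveI) auto
qed

text \<open>With \<open>M\<close> the supremum, the n-th root of wpoly/M is an admissible function
  times the weight, so the uniform gap can be raised to the n-th power. Since \<open>wpoly\<close>
  is then strictly smaller off \<open>nbhd\<close>, the supremum must be nearly attained
  inside.\<close>

lemma wpoly_outside_nbhd:
  assumes q: "0 < q" "q < 1" and \<eta>: "\<eta> > 0"
    and gap': "\<forall>F\<in>admissible. \<forall>y. y \<notin> nbhd \<longrightarrow> F y * v y \<le> q * (1 + (cmod y)\<^sup>2) powr (- \<eta>)"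
    and I: "finite I" "card I \<le> n" and n: "n \<ge> 1"
  shows "\<exists>M>0. (\<exists>z\<in>nbhd. M \<le> 2 * wpoly n I a z) \<and>
    (\<forall>y. y \<notin> nbhd \<longrightarrow> wpoly n I a y \<le> M * (q ^ n * (1 + (cmod y)\<^sup>2) powr (- \<eta> * real n)))"
proof -
  define M where "M = (SUP y. wpoly n I a y)"
  note bdd = wpoly_bdd_above[OF I, of a]
  have leM: "wpoly n I a y \<le> M" for y unfolding M_def by (rule cSUP_upper[OF UNIV_I bdd])
  obtain z0 where "wpoly n I a z0 > 0" using wpoly_pos[OF I(1)] by blast
  then have M: "M > 0" using leM[of z0] by linarith
  define F where "F y = M powr (- (1 / real n)) * (\<Prod>k\<in>I. cmod (y - a k) powr (2 / real n))" for y
  have F_pow: "(F y * v y) ^ n = wpoly n I a y / M" for y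
  proof -
    have "(x powr (2 / real n)) ^ n = x\<^sup>2" if "x \<ge> 0" for x :: real
    proof (cases "x = 0")
      case True
      then show ?thesis using n by (simp add: power_0_left)
    next
      case False
      then have x: "x > 0" using that by simp
      then have "(x powr (2 / real n)) ^ n = (x powr (2 / real n)) powr real n" by (simp add: powr_realpow)
      also have "\<dots> = x powr 2" using n by (simp add: powr_powr)
      finally show ?thesis using x by (simp add: powr_realpow)
    qed
    moreover have "(M powr (- (1 / real n))) ^ n = 1 / M"
    proof -
      have "(M powr (- (1 / real n))) ^ n = (M powr (- (1 / real n))) powr real n" using M by (simp add: powr_realpow)
      also have "\<dots> = M powr (- 1)" using n by (simp only: powr_powr) simp
      finally show ?thesis using M by (simp add: powr_minus_divide)
    qed
    ultimately show ?thesis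
      by (simp add: F_def wpoly_def power_mult_distrib prod_power_distrib)
  qed
  have F0: "F y * v y \<ge> 0" for y
    unfolding F_def using v_nonneg[of y] by (intro mult_nonneg_nonneg prod_nonneg) auto
  have "F \<in> poly_potentials"
    unfolding poly_potentials_def mem_Collect_eq
    by (intro exI[of _ "M powr (- (1 / real n))"] exI[of _ I] exI[of _ a] exI[of _ n])
       (use M I n in \<open>auto simp: F_def\<close>)
  moreover have "F y * v y \<le> 1" for y
  proof (rule power_le_imp_le_base[of _ "n - 1"])
    have "(F y * v y) ^ n \<le> 1" unfolding F_pow using leM[of y] M by simp
    then show "(F y * v y) ^ Suc (n - 1) \<le> 1 ^ Suc (n - 1)" using n by simp
  qed simp
  ultimately have Fadm: "F \<in> admissible" by (simp add: admissible_def)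
  have out: "wpoly n I a y \<le> M * (q ^ n * (1 + (cmod y)\<^sup>2) powr (- \<eta> * real n))" if y: "y \<notin> nbhd" for y
  proof -
    have "wpoly n I a y / M \<le> (q * (1 + (cmod y)\<^sup>2) powr (- \<eta>)) ^ n"
      unfolding F_pow[symmetric] by (rule power_mono[OF gap'[rule_format, OF Fadm y] F0])
    also have "\<dots> = q ^ n * (1 + (cmod y)\<^sup>2) powr (- \<eta> * real n)"
    proof -
      have "1 + (cmod y)\<^sup>2 > 0" by (intro add_pos_nonneg) auto
      then show ?thesis by (simp add: power_mult_distrib powr_realpow[symmetric] powr_powr)
    qed
    finally show ?thesis using M by (simp add: field_simps)
  qed
  have "\<exists>z\<in>nbhd. M \<le> 2 * wpoly n I a z"
  proof (rule ccontr)
    assume "\<not> ?thesis"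
    then have ins: "wpoly n I a z \<le> M * (1 / 2)" if "z \<in> nbhd" for z using that by force
    \<comment> \<open>If \<open>wpoly\<close> were at most M/2 on \<open>nbhd\<close>, it would be
      at most \<open>M * m\<close> everywhere, contradicting that \<open>M\<close> is the
      supremum.\<close>
    define m where "m = max (1 / 2) q"
    have m: "m < 1" using q by (simp add: m_def)
    have "wpoly n I a y \<le> M * m" for y
    proof (cases "y \<in> nbhd")
      case True
      have "M * (1 / 2) \<le> M * m" using M by (intro mult_left_mono) (auto simp: m_def)
      then show ?thesis using ins[OF True] by linarith
    next
      case False
      have "q ^ n \<le> q ^ 1" using q n by (intro power_decreasing) auto
      moreover have "(1 + (cmod y)\<^sup>2) powr (- \<eta> * real n) \<le> 1 powr (- \<eta> * real n)"
        using \<eta> by (intro powr_mono2') auto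
      ultimately have "q ^ n * (1 + (cmod y)\<^sup>2) powr (- \<eta> * real n) \<le> q * 1"
        using q by (intro mult_mono) auto
      then have "M * (q ^ n * (1 + (cmod y)\<^sup>2) powr (- \<eta> * real n)) \<le> M * m"
        using M by (intro mult_left_mono) (auto simp: m_def)
      then show ?thesis using out[OF False] by linarith
    qed
    then have "M \<le> M * m" unfolding M_def by (intro cSUP_least) auto
    then show False using M m by simp
  qed
  then show ?thesis using M out by blast
qed

text \<open>The sub-mean value property at a near-maximum point bounds M^\<beta> by n (2
  e^A)^\<beta> times the mass, while off \<open>nbhd\<close> the integral is at most a constant
  times M^\<beta> q^(n\<beta>). The exponential gain wins uniformly in \<beta> \<ge> 1.\<close>

lemma wpoly_localization:
  "\<exists>K::real. K \<ge> 0 \<and> (\<forall>\<^sub>F n in sequentially. \<forall>\<beta> I a. \<beta> \<ge> 1 \<longrightarrow> finite I \<longrightarrow> card I \<le> n \<longrightarrow>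
     (\<integral>\<^sup>+y. indicator (- nbhd) y * ennreal (wpoly n I a y powr \<beta>) \<partial>dA)
       \<le> ennreal (K / real n ^ 3) * wpoly_mass \<beta> n I a)"
proof -
  obtain q \<eta> where q: "0 < q" "q < 1" and \<eta>: "\<eta> > 0"
    and gap': "\<forall>F\<in>admissible. \<forall>y. y \<notin> nbhd \<longrightarrow> F y * v y \<le> q * (1 + (cmod y)\<^sup>2) powr (- \<eta>)"
    using uniform_gap[OF open_nbhd S_subset_nbhd] by blast
  obtain K where K: "(\<integral>\<^sup>+z. ennreal (1 / (1 + (cmod z)\<^sup>2)\<^sup>2) \<partial>dA) = ennreal K" "K \<ge> 0"
    using nn_integral_inverse_quadratic_finite
    by (cases "\<integral>\<^sup>+z. ennreal (1 / (1 + (cmod z)\<^sup>2)\<^sup>2) \<partial>dA") auto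
  \<comment> \<open>Splits q^n into two factors p^n. One brings the base 2 e^A p^n below 1, so that
    its \<beta>-th power is harmless for every \<beta>; the other gives n^(-4).\<close>
  define p where "p = sqrt q"
  have p: "0 < p" "p < 1" "q = p * p" using q by (auto simp: p_def)
  have ev1: "\<forall>\<^sub>F n in sequentially. 2 * exp A * p ^ n \<le> 1"
  proof -
    have "(\<lambda>n. 2 * exp A * p ^ n) \<longlonglongrightarrow> 2 * exp A * 0"
      using p by (intro tendsto_mult_left LIMSEQ_realpow_zero) auto
    from order_tendstoD(2)[OF this, of 1] have "\<forall>\<^sub>F n in sequentially. 2 * exp A * p ^ n < 1" by simp
    then show ?thesis by eventually_elim simp
  qed
  have ev2: "\<forall>\<^sub>F n in sequentially. real n ^ 4 * p ^ n \<le> 1"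
  proof -
    \<comment> \<open>The fourth root of \<open>p\<close>, so that n^4 p^n is the fourth power of n
      x^n.\<close>
    define x where "x = sqrt (sqrt p)"
    have x: "0 < x" "x < 1" using p by (auto simp: x_def)
    have "x ^ 4 = (x\<^sup>2)\<^sup>2" by (simp flip: power_mult)
    then have "x ^ 4 = p" using p by (simp add: x_def)
    then have "(real n * x ^ n) ^ 4 = real n ^ 4 * p ^ n" for n
      by (metis power_mult_distrib power_commutes power_mult mult.commute)
    moreover have "(\<lambda>n. (real n * x ^ n) ^ 4) \<longlonglongrightarrow> 0 ^ 4"
      using powser_times_n_limit_0[of x] x by (intro tendsto_power) simp
    ultimately have "(\<lambda>n. real n ^ 4 * p ^ n) \<longlonglongrightarrow> 0" by simp
    from order_tendstoD(2)[OF this, of 1] have "\<forall>\<^sub>F n in sequentially. real n ^ 4 * p ^ n < 1" by simp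
    then show ?thesis by eventually_elim simp
  qed
  have ev3: "\<forall>\<^sub>F n in sequentially. real n \<ge> max (max 1 (2 / \<eta>)) (1 / \<rho>\<^sup>2)"
    using filterlim_real_sequentially unfolding filterlim_at_top by blast
  have "\<forall>\<^sub>F n in sequentially. \<forall>\<beta> I a. \<beta> \<ge> 1 \<longrightarrow> finite I \<longrightarrow> card I \<le> n \<longrightarrow>
     (\<integral>\<^sup>+y. indicator (- nbhd) y * ennreal (wpoly n I a y powr \<beta>) \<partial>dA)
       \<le> ennreal (K / real n ^ 3) * wpoly_mass \<beta> n I a"
    using ev1 ev2 ev3
  proof eventually_elim
    case (elim n)
    show ?case
    proof (intro allI impI)
      fix \<beta> :: real and I :: "nat set" and a
      assume \<beta>: "\<beta> \<ge> 1" and I: "finite I" "card I \<le> n"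
      have n: "n \<ge> 1" using elim(3) by simp
      have n\<rho>: "1 / sqrt (real n) \<le> \<rho>"
      proof -
        have "1 \<le> real n * \<rho>\<^sup>2" using elim(3) \<rho> by (simp add: field_simps)
        then have "sqrt 1 \<le> sqrt (real n * \<rho>\<^sup>2)" by (rule real_sqrt_le_mono)
        then show ?thesis using n \<rho> by (simp add: real_sqrt_mult field_simps)
      qed
      \<comment> \<open>Makes the decaying factor at most (1 + |y|^2)^(-2), the integrable
        majorant.\<close>
      have \<eta>n: "\<eta> * real n * \<beta> \<ge> 2"
      proof -
        have "2 \<le> \<eta> * real n" using elim(3) \<eta> by (simp add: field_simps)
        also have "\<dots> * 1 \<le> \<eta> * real n * \<beta>" using \<beta> \<eta> by (intro mult_left_mono) auto
        finally show ?thesis by simp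
      qed
      obtain M z where M: "M > 0" and z: "z \<in> nbhd" "M \<le> 2 * wpoly n I a z"
        and out: "\<And>y. y \<notin> nbhd \<Longrightarrow> wpoly n I a y \<le> M * (q ^ n * (1 + (cmod y)\<^sup>2) powr (- \<eta> * real n))"
        using wpoly_outside_nbhd[OF q \<eta> gap' I n] by blast
      obtain s where s: "s \<in> S" "z \<in> ball s (2 * \<rho>)" using z(1) \<rho> by (auto simp: nbhd_def)
      have "M powr \<beta> \<le> (2 * wpoly n I a z) powr \<beta>" using M z \<beta> by (intro powr_mono2) auto
      then have "ennreal (M powr \<beta>) \<le> ennreal (2 powr \<beta>) * ennreal (wpoly n I a z powr \<beta>)"
        by (simp add: ennreal_mult[symmetric] powr_mult wpoly_nonneg ennreal_leI)
      also have "\<dots> \<le> ennreal (2 powr \<beta>) * (ennreal (real n * exp (\<beta> * A)) * wpoly_mass \<beta> n I a)"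
        by (intro mult_left_mono wpoly_submean[OF s n n\<rho> \<beta>]) auto
      finally have MB: "ennreal (M powr \<beta>) \<le> ennreal (2 powr \<beta> * (real n * exp (\<beta> * A))) * wpoly_mass \<beta> n I a"
        by (simp add: ennreal_mult[symmetric] mult.assoc[symmetric])
      have "(\<integral>\<^sup>+y. indicator (- nbhd) y * ennreal (wpoly n I a y powr \<beta>) \<partial>dA)
         \<le> (\<integral>\<^sup>+y. ennreal (M powr \<beta> * (q ^ n) powr \<beta>) * ennreal (1 / (1 + (cmod y)\<^sup>2)\<^sup>2) \<partial>dA)"
      proof (intro nn_integral_mono)
        fix y
        show "indicator (- nbhd) y * ennreal (wpoly n I a y powr \<beta>)
            \<le> ennreal (M powr \<beta> * (q ^ n) powr \<beta>) * ennreal (1 / (1 + (cmod y)\<^sup>2)\<^sup>2)"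
        proof (cases "y \<in> nbhd")
          case False
          define L where "L = 1 + (cmod y)\<^sup>2"
          have L: "L \<ge> 1" by (simp add: L_def)
          have "wpoly n I a y powr \<beta> \<le> (M * (q ^ n * L powr (- \<eta> * real n))) powr \<beta>"
            unfolding L_def using out[OF False] \<beta> wpoly_nonneg by (intro powr_mono2) auto
          also have "\<dots> = M powr \<beta> * (q ^ n) powr \<beta> * L powr (- (\<eta> * real n * \<beta>))"
            using M q L by (simp add: powr_mult powr_powr mult.assoc)
          also have "\<dots> \<le> M powr \<beta> * (q ^ n) powr \<beta> * L powr (- 2)"
            using \<eta>n L by (intro mult_left_mono powr_mono) auto
          also have "L powr (- 2) = 1 / L\<^sup>2"
            using L by (simp add: powr_minus_divide powr_realpow)
          finally show ?thesis
            using False by (simp add: ennreal_mult[symmetric] L_def ennreal_leI)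
        qed simp
      qed
      also have "\<dots> = ennreal (M powr \<beta> * (q ^ n) powr \<beta>) * ennreal K"
        unfolding K(1)[symmetric] by (rule nn_integral_cmult) (simp add: dA_def)
      also have "\<dots> = ennreal (M powr \<beta>) * ennreal ((q ^ n) powr \<beta> * K)"
        using K(2) by (simp add: ennreal_mult[symmetric] mult.assoc)
      also have "\<dots> \<le> ennreal (2 powr \<beta> * (real n * exp (\<beta> * A))) * wpoly_mass \<beta> n I a * ennreal ((q ^ n) powr \<beta> * K)"
        by (intro mult_right_mono MB) auto
      also have "\<dots> = ennreal (2 powr \<beta> * (real n * exp (\<beta> * A)) * ((q ^ n) powr \<beta> * K)) * wpoly_mass \<beta> n I a"
        using K(2) by (simp add: ennreal_mult mult_ac)
      also have "\<dots> \<le> ennreal (K / real n ^ 3) * wpoly_mass \<beta> n I a"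
      proof (intro mult_right_mono ennreal_leI)
        have "2 powr \<beta> * exp (\<beta> * A) * (q ^ n) powr \<beta> = (2 * exp A * p ^ n) powr \<beta> * (p ^ n) powr \<beta>"
        proof -
          have "exp (\<beta> * A) = exp A powr \<beta>" by (simp add: powr_def)
          moreover have "q ^ n = p ^ n * p ^ n" by (simp add: p(3) power_mult_distrib)
          ultimately show ?thesis using p by (simp add: powr_mult mult.assoc)
        qed
        also have "\<dots> \<le> 1 powr \<beta> * (p ^ n) powr 1"
          using elim(1) p \<beta> by (intro mult_mono powr_mono2 powr_mono') (auto simp: power_le_one)
        also have "\<dots> = p ^ n" using p by simp
        also have "\<dots> \<le> 1 / real n ^ 4" using elim(2) n by (simp add: field_simps)
        finally have "2 powr \<beta> * exp (\<beta> * A) * (q ^ n) powr \<beta> * (real n * K) \<le> 1 / real n ^ 4 * (real n * K)"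
          using K(2) by (intro mult_right_mono) auto
        also have "\<dots> = K / real n ^ 3" using n by (simp add: field_simps power_eq_if)
        finally show "2 powr \<beta> * (real n * exp (\<beta> * A)) * ((q ^ n) powr \<beta> * K) \<le> K / real n ^ 3"
          by (simp add: mult_ac)
      qed auto
      finally show "(\<integral>\<^sup>+y. indicator (- nbhd) y * ennreal (wpoly n I a y powr \<beta>) \<partial>dA)
         \<le> ennreal (K / real n ^ 3) * wpoly_mass \<beta> n I a" .
    qed
  qed
  then show ?thesis using K(2) by blast
qed

end

section \<open>Separation of points from a lower bound on the conditional density\<close>

context regular_droplet
begin

text \<open>Sub-mean value and the mass hypothesis give G(w)^\<beta> \<le> n^4 e^(A\<beta>)
  G(z0)^\<beta>. Because n^4 = exp(4 log n) \<le> exp(4\<beta>/c0), the \<beta>-th root of the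
  prefactor is bounded; this is where logarithmic growth of \<beta> enters.\<close>

lemma wpoly_local_bound:
  assumes s: "s \<in> S" "z0 \<in> ball s \<rho>" and n: "n \<ge> 1" "1 / sqrt (real n) \<le> \<rho>" and \<beta>: "\<beta> \<ge> 1"
    and c0: "c0 > 0" "\<beta> \<ge> c0 * ln (real n)"
    and mass: "wpoly_mass \<beta> n I a \<le> ennreal (real n ^ 3) * ennreal (wpoly n I a z0 powr \<beta>)"
    and w: "w \<in> ball z0 (1 / sqrt (real n))"
  shows "wpoly n I a w \<le> exp (A + 4 / c0) * wpoly n I a z0"
proof -
  have w\<rho>: "w \<in> ball s (2 * \<rho>)"
    using s(2) w n(2) dist_triangle[of s w z0] by auto
  have "ennreal (wpoly n I a w powr \<beta>) \<le> ennreal (real n * exp (\<beta> * A)) * wpoly_mass \<beta> n I a"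
    by (rule wpoly_submean[OF s(1) w\<rho> n \<beta>])
  also have "\<dots> \<le> ennreal (real n * exp (\<beta> * A)) * (ennreal (real n ^ 3) * ennreal (wpoly n I a z0 powr \<beta>))"
    by (intro mult_left_mono mass) auto
  also have "\<dots> = ennreal (real n ^ 4 * exp (\<beta> * A) * wpoly n I a z0 powr \<beta>)"
    by (simp add: ennreal_mult[symmetric] mult_ac power_eq_if)
  finally have "wpoly n I a w powr \<beta> \<le> real n ^ 4 * exp (\<beta> * A) * wpoly n I a z0 powr \<beta>"
    by (subst (asm) ennreal_le_iff) auto
  also have "real n ^ 4 * exp (\<beta> * A) \<le> exp (A + 4 / c0) powr \<beta>"
  proof -
    have "real n ^ 4 = exp (4 * ln (real n))"
      using n(1) by (simp add: exp_of_nat_mult[of 4, simplified])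
    also have "4 * ln (real n) \<le> \<beta> * (4 / c0)" using c0 by (simp add: field_simps)
    finally have "real n ^ 4 \<le> exp (\<beta> * (4 / c0))" by simp
    then have "real n ^ 4 * exp (\<beta> * A) \<le> exp (\<beta> * (4 / c0)) * exp (\<beta> * A)" by (intro mult_right_mono) auto
    also have "\<dots> = exp (A + 4 / c0) powr \<beta>"
      by (simp add: powr_def exp_add[symmetric] algebra_simps)
    finally show ?thesis .
  qed
  finally have "wpoly n I a w powr \<beta> \<le> exp (A + 4 / c0) powr \<beta> * wpoly n I a z0 powr \<beta>"
    by (simp add: mult_right_mono)
  then have "wpoly n I a w powr \<beta> \<le> (exp (A + 4 / c0) * wpoly n I a z0) powr \<beta>"
    by (simp add: powr_mult wpoly_nonneg)
  then show ?thesis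
    using powr_less_mono2[of \<beta> "exp (A + 4 / c0) * wpoly n I a z0" "wpoly n I a w"] \<beta> wpoly_nonneg[of n I a z0]
    by (auto simp: not_le[symmetric])
qed

text \<open>With d the distance of the two points, dividing \<open>g\<close> by w - a_k and applying
  the maximum principle on radius r/2 gives |h(a_j)| \<le> M |g(a_j)| / (r/2 - d). Since |g(a_j)| =
  d |h(a_j)| > 0, this forces r/2 \<le> (1 + M) d.\<close>

lemma points_separated:
  assumes z0: "a j \<in> nbhd" and I: "finite I" "k \<in> I" and n: "n \<ge> 1" "1 / sqrt (real n) \<le> \<rho>"
    and \<beta>: "\<beta> \<ge> 1" and c0: "c0 > 0" "\<beta> \<ge> c0 * ln (real n)"
    and mass: "wpoly_mass \<beta> n I a \<le> ennreal (real n ^ 3) * ennreal (wpoly n I a (a j) powr \<beta>)"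
  shows "1 / (2 * (1 + exp (A + 2 / c0))) \<le> sqrt (real n) * cmod (a j - a k)"
proof -
  obtain s where s: "s \<in> S" "a j \<in> ball s \<rho>" using z0 by (auto simp: nbhd_def)
  then have s2: "a j \<in> ball s (2 * \<rho>)" using \<rho> by auto
  define r where "r = 1 / sqrt (real n)"
  have r: "r > 0" "r \<le> \<rho>" "r\<^sup>2 = 1 / real n" using n by (auto simp: r_def power_divide)
  have nA: "real n * A * r\<^sup>2 = A" using n r by simp
  \<comment> \<open>The square root of e^A e^(A + 4/c0): one factor from comparing \<open>g\<close>
    with \<open>wpoly\<close>, the other from \<open>wpoly_local_bound\<close>.\<close>
  define M where "M = exp (A + 2 / c0)"
  define g where "g = local_poly n I a (a j)"
  have g0: "(cmod (g (a j)))\<^sup>2 = wpoly n I a (a j)"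
    unfolding g_def using local_poly_bounds(3)[OF s(1) s2 order_refl, of "a j" n I a] \<rho> by simp
  \<comment> \<open>A zero of the density at \<open>a j\<close> would force the mass to vanish; in
    particular the two points cannot coincide.\<close>
  have pos: "wpoly n I a (a j) > 0"
  proof (rule ccontr)
    assume "\<not> ?thesis"
    then have "wpoly n I a (a j) = 0" using wpoly_nonneg[of n I a "a j"] by simp
    then have "wpoly_mass \<beta> n I a = 0" using mass by simp
    then show False using wpoly_mass_pos[OF I(1) n \<beta>, of a] by simp
  qed
  have g_pos: "cmod (g (a j)) > 0" using g0 pos by (metis zero_less_norm_iff power_zero_numeral norm_zero less_irrefl)
  have g_le: "cmod (g w) \<le> M * cmod (g (a j))" if w: "w \<in> ball (a j) r" for w
  proof -
    have "(cmod (g w))\<^sup>2 \<le> exp A * wpoly n I a w"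
      using local_poly_bounds(1)[OF s(1) s2 r(2) w, of n I a] unfolding nA g_def .
    also have "\<dots> \<le> exp A * (exp (A + 4 / c0) * wpoly n I a (a j))"
      by (intro mult_left_mono wpoly_local_bound[OF s n \<beta> c0 mass]) (use w in \<open>auto simp: r_def\<close>)
    also have "\<dots> = (M * cmod (g (a j)))\<^sup>2"
      by (simp add: g0 power_mult_distrib M_def exp_double[symmetric] exp_add[symmetric] mult.assoc[symmetric] algebra_simps)
    finally show ?thesis by (rule power2_le_imp_le) (simp add: M_def)
  qed
  define d where "d = cmod (a j - a k)"
  have d: "d > 0"
  proof (rule ccontr)
    assume "\<not> ?thesis"
    then have "a j - a k = 0" by (simp add: d_def)
    then have "g (a j) = 0" unfolding g_def local_poly_def using I by (auto intro!: prod_zero)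
    then show False using g_pos by simp
  qed
  have "r / 2 \<le> (1 + M) * d"
  proof (cases "d < r / 2")
    case False
    have "1 * d \<le> (1 + M) * d" using d by (intro mult_right_mono) (auto simp: M_def)
    then show ?thesis using False by simp
  next
    case True
    \<comment> \<open>\<open>g\<close> with the zero at \<open>a k\<close> divided out. Radius r/2
      is used because the bound on \<open>g\<close> holds in the open disc of radius r.\<close>
    define h where "h w = (\<Prod>l\<in>I - {k}. w - a l) *
       exp (- of_real (real n / 2) * (of_real (f (a j)) + c (a j) * (w - a j)))" for w
    have gh: "g w = (w - a k) * h w" for w
      unfolding g_def local_poly_def h_def using prod.remove[OF I, of "\<lambda>l. w - a l"] by simp
    have hol: "h holomorphic_on X" for X unfolding h_def by (intro holomorphic_intros)
    have "cmod (h (a j)) \<le> M * cmod (g (a j)) / (r / 2 - d)"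
    proof (rule maximum_modulus_frontier[of h "cball (a j) (r / 2)"])
      fix w assume "w \<in> frontier (cball (a j) (r / 2))"
      then have w: "cmod (w - a j) = r / 2" using r(1) by (simp add: frontier_cball dist_norm norm_minus_commute)
      then have "cmod (w - a k) \<ge> r / 2 - d"
        using norm_triangle_ineq2[of "w - a k" "a j - a k"] norm_triangle_ineq4[of "w - a k" "a j - a k"] 
          norm_triangle_ineq2[of "w - a j" "a k - a j"] by (simp add: d_def norm_minus_commute)
      then have "cmod (h w) * (r / 2 - d) \<le> cmod (h w) * cmod (w - a k)" by (intro mult_left_mono) auto
      also have "\<dots> = cmod (g w)" by (simp add: gh norm_mult)
      also have "\<dots> \<le> M * cmod (g (a j))"
        using w r(1) by (intro g_le) (simp add: dist_norm norm_minus_commute)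
      finally show "cmod (h w) \<le> M * cmod (g (a j)) / (r / 2 - d)" using True by (simp add: field_simps)
    qed (use r(1) hol holomorphic_on_imp_continuous_on[OF hol] in auto)
    moreover have "cmod (g (a j)) = d * cmod (h (a j))" by (simp add: gh norm_mult d_def)
    ultimately have "cmod (h (a j)) * (r / 2 - d) \<le> M * (d * cmod (h (a j)))"
      using True by (simp add: pos_le_divide_eq)
    moreover have "cmod (h (a j)) > 0" using g_pos by (auto simp: gh norm_mult zero_less_mult_iff)
    ultimately have "r / 2 - d \<le> M * d"
      by (metis mult.commute mult.left_commute mult_le_cancel_left_pos)
    then show ?thesis by (simp add: algebra_simps)
  qed
  then have "r \<le> 2 * ((1 + M) * d)" by simp
  then have "1 \<le> 2 * ((1 + M) * d) * sqrt (real n)"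
    using n(1) unfolding r_def by (simp only: divide_le_eq) simp
  then have "1 \<le> sqrt (real n) * d * (2 * (1 + M))"
    by (simp only: mult_ac)
  moreover have "2 * (1 + M) > 0" by (simp add: M_def add_pos_pos)
  ultimately show ?thesis
    unfolding M_def[symmetric] d_def[symmetric] by (simp only: pos_divide_le_eq)
qed

end

section \<open>The Gibbs measure\<close>

lemma sets_dA [measurable_cong, simp]: "sets dA = sets borel"
  and space_dA [simp]: "space dA = UNIV"
  by (simp_all add: dA_def)

lemma sigma_finite_dA: "sigma_finite_measure dA"
  unfolding dA_def by (subst sigma_finite_measure.sigma_finite_iff_density_finite[OF sigma_finite_lborel]) auto

interpretation dA: sigma_finite_measure dA by (rule sigma_finite_dA)

interpretation dA_prod: product_sigma_finite "\<lambda>_::nat. dA"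
  by (simp add: product_sigma_finite_def sigma_finite_dA)

lemma sum_ereal_neq_MInfty:
  fixes f :: "'a \<Rightarrow> ereal"
  shows "(\<And>x. x \<in> A \<Longrightarrow> f x \<noteq> - \<infinity>) \<Longrightarrow> sum f A \<noteq> - \<infinity>"
  by (induction A rule: infinite_finite_induct) auto

text \<open>The exponential of minus the Hamiltonian. The product runs over ordered pairs, so each
  pair of points contributes its squared distance.\<close>

definition interaction :: "(complex \<Rightarrow> real) \<Rightarrow> nat \<Rightarrow> nat set \<Rightarrow> (nat \<Rightarrow> complex) \<Rightarrow> real" where
  "interaction v n J \<zeta> = (\<Prod>i\<in>J. \<Prod>k\<in>J - {i}. cmod (\<zeta> i - \<zeta> k)) * (\<Prod>i\<in>J. v (\<zeta> i) ^ n)"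

text \<open>The two ordered pairs joining j to another point supply the squares; the split-off
  factor is the \<open>wpoly\<close> of the remaining points at the j-th point.\<close>

lemma interaction_remove:
  assumes J: "finite J" "j \<in> J"
  shows "interaction v n J \<zeta> = interaction v n (J - {j}) \<zeta> *
    ((\<Prod>k\<in>J - {j}. (cmod (\<zeta> j - \<zeta> k))\<^sup>2) * v (\<zeta> j) ^ n)"
proof -
  let ?I = "J - {j}"
  have "(\<Prod>i\<in>J. \<Prod>k\<in>J - {i}. cmod (\<zeta> i - \<zeta> k))
      = (\<Prod>k\<in>?I. cmod (\<zeta> j - \<zeta> k)) * (\<Prod>i\<in>?I. \<Prod>k\<in>J - {i}. cmod (\<zeta> i - \<zeta> k))"
    using J by (simp add: prod.remove)
  also have "(\<Prod>i\<in>?I. \<Prod>k\<in>J - {i}. cmod (\<zeta> i - \<zeta> k))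
      = (\<Prod>i\<in>?I. cmod (\<zeta> j - \<zeta> i) * (\<Prod>k\<in>?I - {i}. cmod (\<zeta> i - \<zeta> k)))"
  proof (intro prod.cong refl)
    fix i assume i: "i \<in> ?I"
    have "J - {i} - {j} = ?I - {i}" by auto
    then show "(\<Prod>k\<in>J - {i}. cmod (\<zeta> i - \<zeta> k)) = cmod (\<zeta> j - \<zeta> i) * (\<Prod>k\<in>?I - {i}. cmod (\<zeta> i - \<zeta> k))"
      using J i by (subst prod.remove[of _ j]) (auto simp: norm_minus_commute)
  qed
  also have "\<dots> = (\<Prod>i\<in>?I. cmod (\<zeta> j - \<zeta> i)) * (\<Prod>i\<in>?I. \<Prod>k\<in>?I - {i}. cmod (\<zeta> i - \<zeta> k))"
    by (rule prod.distrib)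
  moreover have "(\<Prod>i\<in>J. v (\<zeta> i) ^ n) = v (\<zeta> j) ^ n * (\<Prod>i\<in>?I. v (\<zeta> i) ^ n)"
    using J by (simp add: prod.remove)
  ultimately show ?thesis
    by (simp add: interaction_def power2_eq_square prod.distrib mult_ac)
qed

text \<open>If two points coincide or Q is infinite at one of them, the energy is +\<infinity>, no
  summand being -\<infinity>, and the product has a zero factor. Otherwise everything is real and
  exponentiates termwise.\<close>

lemma boltzmann_weight_eq:
  assumes Q: "\<And>z. Q z \<noteq> - \<infinity>" and \<beta>: "\<beta> > 0" and n: "n \<ge> 1"
  shows "boltzmann_weight Q \<beta> n \<zeta> = ennreal (interaction (weight Q) n {1..n} \<zeta> powr \<beta>)"
proof (cases "\<exists>i\<in>{1..n}. Q (\<zeta> i) = \<infinity> \<or> (\<exists>k\<in>{1..n} - {i}. \<zeta> i = \<zeta> k)")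
  case True
  then obtain i where i: "i \<in> {1..n}" and d: "Q (\<zeta> i) = \<infinity> \<or> (\<exists>k\<in>{1..n} - {i}. \<zeta> i = \<zeta> k)" by blast
  have lk: "log_kernel z w \<noteq> - \<infinity>" for z w by (simp add: log_kernel_def)
  have s1: "(\<Sum>k\<in>{1..n} - {j}. log_kernel (\<zeta> j) (\<zeta> k)) \<noteq> - \<infinity>" for j
    by (rule sum_ereal_neq_MInfty) (rule lk)
  have s2: "(\<Sum>j\<in>{1..n}. \<Sum>k\<in>{1..n} - {j}. log_kernel (\<zeta> j) (\<zeta> k)) \<noteq> - \<infinity>"
    by (rule sum_ereal_neq_MInfty) (rule s1)
  have s3: "(\<Sum>j\<in>{1..n}. Q (\<zeta> j)) \<noteq> - \<infinity>"
    by (rule sum_ereal_neq_MInfty) (rule Q)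
  have "hamiltonian Q n \<zeta> = \<infinity>"
  proof (cases "Q (\<zeta> i) = \<infinity>")
    case True
    then have "(\<Sum>j\<in>{1..n}. Q (\<zeta> j)) = \<infinity>" using i unfolding sum_Pinfty by auto
    then show ?thesis unfolding hamiltonian_def using s2 n by (simp del: One_nat_def)
  next
    case False
    then obtain k where "k \<in> {1..n} - {i}" "\<zeta> i = \<zeta> k" using d by blast
    then have "(\<Sum>k\<in>{1..n} - {i}. log_kernel (\<zeta> i) (\<zeta> k)) = \<infinity>"
      unfolding sum_Pinfty by (auto simp: log_kernel_def)
    then have 1: "(\<Sum>j\<in>{1..n}. \<Sum>k\<in>{1..n} - {j}. log_kernel (\<zeta> j) (\<zeta> k)) = \<infinity>"
      using i unfolding sum_Pinfty by blast
    have "ereal (real n) * (\<Sum>j\<in>{1..n}. Q (\<zeta> j)) \<noteq> - \<infinity>"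
      using s3 n by (cases "\<Sum>j\<in>{1..n}. Q (\<zeta> j)") auto
    then show ?thesis unfolding hamiltonian_def 1 by simp
  qed
  moreover have "interaction (weight Q) n {1..n} \<zeta> = 0"
    using d
  proof
    assume "Q (\<zeta> i) = \<infinity>"
    then have "weight Q (\<zeta> i) ^ n = 0" using n by (simp add: weight_def)
    then have "(\<Prod>i\<in>{1..n}. weight Q (\<zeta> i) ^ n) = 0" using i by (intro prod_zero) auto
    then show ?thesis by (simp add: interaction_def)
  next
    assume "\<exists>k\<in>{1..n} - {i}. \<zeta> i = \<zeta> k"
    then have "(\<Prod>k\<in>{1..n} - {i}. cmod (\<zeta> i - \<zeta> k)) = 0" by (intro prod_zero) auto
    then have "(\<Prod>i\<in>{1..n}. \<Prod>k\<in>{1..n} - {i}. cmod (\<zeta> i - \<zeta> k)) = 0" using i by (intro prod_zero) auto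
    then show ?thesis by (simp add: interaction_def)
  qed
  ultimately show ?thesis using \<beta> by (simp add: boltzmann_weight_def ereal_exp_def)
next
  case False
  define q where "q i = real_of_ereal (Q (\<zeta> i))" for i
  have q: "Q (\<zeta> i) = ereal (q i)" if "i \<in> {1..n}" for i
    using False that Q[of "\<zeta> i"] by (cases "Q (\<zeta> i)") (auto simp: q_def)
  have ne: "\<zeta> i \<noteq> \<zeta> k" if "i \<in> {1..n}" "k \<in> {1..n} - {i}" for i k using False that by blast
  define H where "H = (\<Sum>j\<in>{1..n}. \<Sum>k\<in>{1..n} - {j}. ln (1 / cmod (\<zeta> j - \<zeta> k))) + real n * (\<Sum>j\<in>{1..n}. q j)"
  have "(\<Sum>k\<in>{1..n} - {j}. log_kernel (\<zeta> j) (\<zeta> k)) = ereal (\<Sum>k\<in>{1..n} - {j}. ln (1 / cmod (\<zeta> j - \<zeta> k)))"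
    if "j \<in> {1..n}" for j
    unfolding sum_ereal[symmetric] using ne[OF that] by (intro sum.cong) (auto simp: log_kernel_def)
  moreover have "(\<Sum>j\<in>{1..n}. Q (\<zeta> j)) = ereal (\<Sum>j\<in>{1..n}. q j)"
    unfolding sum_ereal[symmetric] using q by (intro sum.cong) auto
  ultimately have H: "hamiltonian Q n \<zeta> = ereal H"
    by (simp add: hamiltonian_def H_def del: One_nat_def)
  have "- H = (\<Sum>j\<in>{1..n}. \<Sum>k\<in>{1..n} - {j}. - ln (1 / cmod (\<zeta> j - \<zeta> k))) + (\<Sum>j\<in>{1..n}. real n * (- q j))"
    by (simp add: H_def sum_negf sum_distrib_left)
  then have "exp (- H) = (\<Prod>j\<in>{1..n}. \<Prod>k\<in>{1..n} - {j}. exp (- ln (1 / cmod (\<zeta> j - \<zeta> k)))) * (\<Prod>j\<in>{1..n}. exp (- q j) ^ n)"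
    by (simp only: exp_add exp_sum exp_of_nat_mult finite_atLeastAtMost finite_Diff)
  also have "(\<Prod>j\<in>{1..n}. exp (- q j) ^ n) = (\<Prod>j\<in>{1..n}. weight Q (\<zeta> j) ^ n)"
    using q by (intro prod.cong) (auto simp: weight_def)
  also have "(\<Prod>j\<in>{1..n}. \<Prod>k\<in>{1..n} - {j}. exp (- ln (1 / cmod (\<zeta> j - \<zeta> k))))
      = (\<Prod>j\<in>{1..n}. \<Prod>k\<in>{1..n} - {j}. cmod (\<zeta> j - \<zeta> k))"
    using ne by (intro prod.cong refl) (auto simp: ln_div)
  finally have "interaction (weight Q) n {1..n} \<zeta> = exp (- H)" by (simp add: interaction_def)
  then show ?thesis
    unfolding boltzmann_weight_def H by (simp add: ereal_exp_def powr_def mult.commute)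
qed

section \<open>Conditional probabilities under the Gibbs measure\<close>

locale coulomb_gas = regular_droplet "weight Q" S \<rho> A c f
  for Q :: "complex \<Rightarrow> ereal" and S \<rho> A c f +
  assumes Q: "Q z \<noteq> - \<infinity>"
begin

lemma component_measurable:
  "i \<in> J \<Longrightarrow> (\<lambda>\<zeta>. \<zeta> i) \<in> borel_measurable (\<Pi>\<^sub>M j\<in>J. dA)"
  using measurable_component_singleton[of i J "\<lambda>_. dA"] measurable_cong_sets[OF refl sets_dA] by blast

lemma boltzmann_weight_measurable:
  assumes "\<beta> > 0" "n \<ge> 1"
  shows "boltzmann_weight Q \<beta> n \<in> borel_measurable (dA_n n)"
proof -
  have [measurable]: "interaction (weight Q) n {1..n} \<in> borel_measurable (dA_n n)"
    unfolding interaction_def[abs_def] dA_n_def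
    by (intro borel_measurable_times borel_measurable_prod borel_measurable_power borel_measurable_norm
        borel_measurable_diff component_measurable measurable_compose[OF component_measurable v_measurable]) auto
  have "boltzmann_weight Q \<beta> n = (\<lambda>\<zeta>. ennreal (interaction (weight Q) n {1..n} \<zeta> powr \<beta>))"
    by (intro ext boltzmann_weight_eq Q assms)
  then show ?thesis by (simp only:) measurable
qed

lemma prob_space_gibbs:
  assumes "\<beta> > 0" "n \<ge> 1" "0 < partition_function Q \<beta> n" "partition_function Q \<beta> n < \<infinity>"
  shows "prob_space (gibbs_measure Q \<beta> n)"
proof
  note [measurable] = boltzmann_weight_measurable[OF assms(1,2)]
  have "emeasure (gibbs_measure Q \<beta> n) (space (gibbs_measure Q \<beta> n))
      = (\<integral>\<^sup>+\<zeta>. boltzmann_weight Q \<beta> n \<zeta> * inverse (partition_function Q \<beta> n) \<partial>dA_n n)"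
    unfolding gibbs_measure_def by (simp add: emeasure_density divide_ennreal_def cong: nn_integral_cong)
  also have "\<dots> = partition_function Q \<beta> n * inverse (partition_function Q \<beta> n)"
    by (simp add: nn_integral_multc partition_function_def)
  also have "\<dots> = 1" using assms(3,4) by (simp add: ennreal_divide_self[unfolded divide_ennreal_def])
  finally show "emeasure (gibbs_measure Q \<beta> n) (space (gibbs_measure Q \<beta> n)) = 1" .
qed

lemma wpoly_cong:
  "(\<And>k. k \<in> I \<Longrightarrow> a k = b k) \<Longrightarrow> wpoly n I a = wpoly n I b"
  by (auto simp: wpoly_def fun_eq_iff)

text \<open>Disintegration by Fubini: the factor depending on the other points is constant in the
  inner integral, so a bound on the conditional probability of \<open>B\<close> valid for every
  \<open>x\<close> integrates to a bound on its probability.\<close>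

lemma gibbs_conditional_bound:
  assumes \<beta>: "\<beta> > 0" and n: "n \<ge> 1" and j: "j \<in> {1..n}"
    and Z: "0 < partition_function Q \<beta> n" "partition_function Q \<beta> n < \<infinity>"
    and B: "B \<in> sets (dA_n n)"
    and cond: "\<And>x. (\<integral>\<^sup>+y. indicator B (x(j := y)) * ennreal (wpoly n ({1..n} - {j}) x y powr \<beta>) \<partial>dA)
       \<le> \<epsilon> * wpoly_mass \<beta> n ({1..n} - {j}) x"
  shows "emeasure (gibbs_measure Q \<beta> n) B \<le> \<epsilon>"
proof -
  let ?I = "{1..n} - {j}" and ?Z = "partition_function Q \<beta> n" and ?W = "boltzmann_weight Q \<beta> n"
  note [measurable] = boltzmann_weight_measurable[OF \<beta> n] B
  have ins: "insert j ?I = {1..n}" using j by auto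
  have split: "?W (x(j := y)) = ennreal (interaction (weight Q) n ?I x powr \<beta>) * ennreal (wpoly n ?I x y powr \<beta>)" for x y
  proof -
    have "interaction (weight Q) n {1..n} (x(j := y)) = interaction (weight Q) n ?I x * wpoly n ?I x y"
    proof -
      have "interaction (weight Q) n ?I (x(j := y)) = interaction (weight Q) n ?I x"
        unfolding interaction_def by (intro arg_cong2[of _ _ _ _ "(*)"] prod.cong) auto
      moreover have "(\<Prod>k\<in>?I. (cmod (y - (x(j := y)) k))\<^sup>2) = (\<Prod>k\<in>?I. (cmod (y - x k))\<^sup>2)"
        by (intro prod.cong) auto
      ultimately show ?thesis
        using interaction_remove[of "{1..n}" j "weight Q" n "x(j := y)"] j by (simp add: wpoly_def)
    qed
    moreover have "interaction (weight Q) n ?I x \<ge> 0"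
      unfolding interaction_def by (intro mult_nonneg_nonneg prod_nonneg) auto
    ultimately show ?thesis
      unfolding boltzmann_weight_eq[OF Q \<beta> n] by (simp add: powr_mult wpoly_nonneg ennreal_mult)
  qed
  have fubini: "(\<integral>\<^sup>+\<zeta>. g \<zeta> \<partial>dA_n n) = (\<integral>\<^sup>+x. \<integral>\<^sup>+y. g (x(j := y)) \<partial>dA \<partial>(\<Pi>\<^sub>M i\<in>?I. dA))"
    if "g \<in> borel_measurable (dA_n n)" for g
    using dA_prod.product_nn_integral_insert[of ?I j g] that unfolding ins dA_n_def by simp
  have upd: "(\<lambda>y. x(j := y)) \<in> measurable dA (dA_n n)" if "x \<in> space (\<Pi>\<^sub>M i\<in>?I. dA)" for x
    unfolding dA_n_def using that ins
    by (intro measurable_fun_upd[where J="?I"]) auto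
  have "(\<integral>\<^sup>+\<zeta>. indicator B \<zeta> * ?W \<zeta> \<partial>dA_n n)
     = (\<integral>\<^sup>+x. \<integral>\<^sup>+y. indicator B (x(j := y)) * ?W (x(j := y)) \<partial>dA \<partial>(\<Pi>\<^sub>M i\<in>?I. dA))"
    by (rule fubini) measurable
  also have "\<dots> \<le> (\<integral>\<^sup>+x. \<epsilon> * (\<integral>\<^sup>+y. ?W (x(j := y)) \<partial>dA) \<partial>(\<Pi>\<^sub>M i\<in>?I. dA))"
  proof (rule nn_integral_mono)
    fix x assume x: "x \<in> space (\<Pi>\<^sub>M i\<in>?I. dA)"
    let ?R = "ennreal (interaction (weight Q) n ?I x powr \<beta>)"
    have Bm: "(\<lambda>y. indicator B (x(j := y)) :: ennreal) \<in> borel_measurable dA"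
      using upd[OF x] by measurable
    have "(\<integral>\<^sup>+y. indicator B (x(j := y)) * ?W (x(j := y)) \<partial>dA)
       = (\<integral>\<^sup>+y. ?R * (indicator B (x(j := y)) * ennreal (wpoly n ?I x y powr \<beta>)) \<partial>dA)"
      by (simp add: split mult_ac)
    also have "\<dots> = ?R * (\<integral>\<^sup>+y. indicator B (x(j := y)) * ennreal (wpoly n ?I x y powr \<beta>) \<partial>dA)"
      by (intro nn_integral_cmult borel_measurable_times_ennreal Bm) measurable
    also have "\<dots> \<le> ?R * (\<epsilon> * wpoly_mass \<beta> n ?I x)"
      by (intro mult_left_mono cond) auto
    also have "\<dots> = \<epsilon> * (\<integral>\<^sup>+y. ?W (x(j := y)) \<partial>dA)"
      unfolding split wpoly_mass_def by (subst nn_integral_cmult) (measurable, simp add: mult_ac)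
    finally show "(\<integral>\<^sup>+y. indicator B (x(j := y)) * ?W (x(j := y)) \<partial>dA) \<le> \<epsilon> * (\<integral>\<^sup>+y. ?W (x(j := y)) \<partial>dA)" .
  qed
  also have "\<dots> = (\<integral>\<^sup>+x. \<integral>\<^sup>+y. \<epsilon> * ?W (x(j := y)) \<partial>dA \<partial>(\<Pi>\<^sub>M i\<in>?I. dA))"
    by (intro nn_integral_cong nn_integral_cmult[symmetric]
          measurable_compose[OF upd boltzmann_weight_measurable[OF \<beta> n]])
  also have "\<dots> = (\<integral>\<^sup>+\<zeta>. \<epsilon> * ?W \<zeta> \<partial>dA_n n)"
    by (rule fubini[symmetric]) measurable
  also have "\<dots> = \<epsilon> * ?Z" by (simp add: nn_integral_cmult partition_function_def)
  finally have le: "(\<integral>\<^sup>+\<zeta>. indicator B \<zeta> * ?W \<zeta> \<partial>dA_n n) \<le> \<epsilon> * ?Z" .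
  have "emeasure (gibbs_measure Q \<beta> n) B = (\<integral>\<^sup>+\<zeta>. (indicator B \<zeta> * ?W \<zeta>) * inverse ?Z \<partial>dA_n n)"
    unfolding gibbs_measure_def by (simp add: emeasure_density divide_ennreal_def mult_ac)
  also have "\<dots> = (\<integral>\<^sup>+\<zeta>. indicator B \<zeta> * ?W \<zeta> \<partial>dA_n n) * inverse ?Z"
    by (rule nn_integral_multc) measurable
  also have "\<dots> \<le> \<epsilon> * ?Z * inverse ?Z" by (rule mult_right_mono[OF le]) simp
  also have "\<dots> = \<epsilon>"
    using Z by (simp add: mult.assoc ennreal_divide_self[unfolded divide_ennreal_def])
  finally show ?thesis .
qed

lemma emeasure_nbhd_finite: "emeasure dA nbhd < \<infinity>"
proof -
  obtain R where R: "\<And>s. s \<in> S \<Longrightarrow> cmod s \<le> R" using S(1) unfolding bounded_iff by blast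
  have "nbhd \<subseteq> ball 0 (R + \<rho>)"
  proof
    fix z assume "z \<in> nbhd"
    then obtain s where "s \<in> S" "dist s z < \<rho>" by (auto simp: nbhd_def)
    then show "z \<in> ball 0 (R + \<rho>)" using R[of s] norm_triangle_ineq2[of z s] by (simp add: dist_norm norm_minus_commute)
  qed
  then have "emeasure lborel nbhd < \<infinity>"
    using bounded_ball bounded_subset emeasure_bounded_finite by blast
  moreover have "emeasure dA nbhd = ennreal (1 / pi) * emeasure lborel nbhd"
    unfolding dA_def using open_nbhd by (simp add: emeasure_density nn_integral_cmult_indicator)
  ultimately show ?thesis by (simp add: ennreal_mult_less_top)
qed

text \<open>Given the other points, the second alternative has small conditional probability because there the
  density of \<open>\<zeta>\<^sub>j\<close> is below \<open>n\<^sup>-\<^sup>3\<close> times its total mass.\<close>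

definition bad_config :: "real \<Rightarrow> nat \<Rightarrow> nat \<Rightarrow> (nat \<Rightarrow> complex) set" where
  "bad_config \<beta> n j = {\<zeta> \<in> space (dA_n n). \<zeta> j \<notin> nbhd \<or>
     ennreal (real n ^ 3) * ennreal (wpoly n ({1..n} - {j}) \<zeta> (\<zeta> j) powr \<beta>)
       < wpoly_mass \<beta> n ({1..n} - {j}) \<zeta>}"

lemma bad_config_sets:
  assumes j: "j \<in> {1..n}"
  shows "bad_config \<beta> n j \<in> sets (dA_n n)"
proof -
  let ?I = "{1..n} - {j}"
  have [measurable]: "(\<lambda>\<zeta>. \<zeta> j) \<in> borel_measurable (dA_n n)"
    unfolding dA_n_def by (rule component_measurable[OF j])
  have [measurable]: "nbhd \<in> sets borel" using open_nbhd by simp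
  have [measurable]: "(\<lambda>\<zeta>. wpoly n ?I \<zeta> (\<zeta> j)) \<in> borel_measurable (dA_n n)"
  proof -
    have [measurable]: "(\<lambda>\<zeta>. \<Prod>k\<in>?I. (cmod (\<zeta> j - \<zeta> k))\<^sup>2) \<in> borel_measurable (dA_n n)"
    proof (rule borel_measurable_prod)
      fix k assume "k \<in> ?I"
      then have [measurable]: "(\<lambda>\<zeta>. \<zeta> k) \<in> borel_measurable (dA_n n)"
        unfolding dA_n_def by (intro component_measurable) auto
      show "(\<lambda>\<zeta>. (cmod (\<zeta> j - \<zeta> k))\<^sup>2) \<in> borel_measurable (dA_n n)" by measurable
    qed
    show ?thesis unfolding wpoly_def by measurable
  qed
  have "(\<lambda>p. wpoly n ?I (fst p) (snd p)) \<in> borel_measurable (dA_n n \<Otimes>\<^sub>M dA)"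
    unfolding wpoly_def dA_n_def
    by (intro borel_measurable_times borel_measurable_prod borel_measurable_power borel_measurable_norm
        borel_measurable_diff measurable_compose[OF measurable_fst component_measurable]
        measurable_compose[OF measurable_snd v_measurable[unfolded measurable_cong_sets[OF sets_dA[symmetric] refl]]]) auto
  then have "(\<lambda>\<zeta>. wpoly_mass \<beta> n ?I \<zeta>) \<in> borel_measurable (dA_n n)"
    unfolding wpoly_mass_def by (intro dA.borel_measurable_nn_integral) (simp add: split_beta)
  then have [measurable]: "wpoly_mass \<beta> n ?I \<in> borel_measurable (dA_n n)" by simp
  show ?thesis unfolding bad_config_def by measurable
qed

text \<open>Escape from \<open>nbhd\<close> is controlled by \<open>wpoly_localization\<close>.
  Where the density is below n^(-3) times the mass, integration over \<open>nbhd\<close>, of finite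
  area V, contributes at most V n^(-3).\<close>

lemma gibbs_bad_config:
  "\<exists>K::real. K \<ge> 0 \<and> (\<forall>\<^sub>F n in sequentially. \<forall>\<beta> j. \<beta> \<ge> 1 \<longrightarrow> 0 < partition_function Q \<beta> n \<longrightarrow>
     partition_function Q \<beta> n < \<infinity> \<longrightarrow> j \<in> {1..n} \<longrightarrow>
     emeasure (gibbs_measure Q \<beta> n) (bad_config \<beta> n j) \<le> ennreal (K / real n ^ 3))"
proof -
  obtain K where K: "K \<ge> 0" and loc: "\<forall>\<^sub>F n in sequentially. \<forall>\<beta> I a. \<beta> \<ge> 1 \<longrightarrow> finite I \<longrightarrow> card I \<le> n \<longrightarrow>
     (\<integral>\<^sup>+y. indicator (- nbhd) y * ennreal (wpoly n I a y powr \<beta>) \<partial>dA)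
       \<le> ennreal (K / real n ^ 3) * wpoly_mass \<beta> n I a"
    using wpoly_localization by blast
  obtain V where V: "emeasure dA nbhd = ennreal V" "V \<ge> 0"
    using emeasure_nbhd_finite by (cases "emeasure dA nbhd") auto
  have [measurable]: "nbhd \<in> sets borel" using open_nbhd by simp
  have "\<forall>\<^sub>F n in sequentially. \<forall>\<beta> j. \<beta> \<ge> 1 \<longrightarrow> 0 < partition_function Q \<beta> n \<longrightarrow>
     partition_function Q \<beta> n < \<infinity> \<longrightarrow> j \<in> {1..n} \<longrightarrow>
     emeasure (gibbs_measure Q \<beta> n) (bad_config \<beta> n j) \<le> ennreal ((K + V) / real n ^ 3)"
    using loc eventually_ge_at_top[of 1]
  proof eventually_elim
    case (elim n)
    show ?case
    proof (intro allI impI)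
      fix \<beta> j assume \<beta>: "1 \<le> \<beta>" and Z: "0 < partition_function Q \<beta> n" "partition_function Q \<beta> n < \<infinity>"
        and j: "j \<in> {1..n}"
      let ?I = "{1..n} - {j}"
      show "emeasure (gibbs_measure Q \<beta> n) (bad_config \<beta> n j) \<le> ennreal ((K + V) / real n ^ 3)"
      proof (rule gibbs_conditional_bound[OF _ elim(2) j Z bad_config_sets[OF j]])
        fix x
        let ?m = "wpoly_mass \<beta> n ?I x"
        have pw: "indicator (bad_config \<beta> n j) (x(j := y)) * ennreal (wpoly n ?I x y powr \<beta>)
           \<le> indicator (- nbhd) y * ennreal (wpoly n ?I x y powr \<beta>) + indicator nbhd y * (ennreal (1 / real n ^ 3) * ?m)" for y
        proof (cases "x(j := y) \<in> bad_config \<beta> n j \<and> y \<in> nbhd")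
          case True
          have "wpoly n ?I (x(j := y)) = wpoly n ?I x" by (rule wpoly_cong) auto
          then have lt: "ennreal (real n ^ 3) * ennreal (wpoly n ?I x y powr \<beta>) < ?m"
            using True by (auto simp: bad_config_def wpoly_mass_def)
          have "ennreal (wpoly n ?I x y powr \<beta>) = ennreal (1 / real n ^ 3) * (ennreal (real n ^ 3) * ennreal (wpoly n ?I x y powr \<beta>))"
            using elim(2) by (simp add: ennreal_mult[symmetric])
          also have "\<dots> \<le> ennreal (1 / real n ^ 3) * ?m"
            by (intro mult_left_mono less_imp_le[OF lt]) auto
          finally show ?thesis using True by simp
        qed (auto simp: indicator_def)
        have "(\<integral>\<^sup>+y. indicator (bad_config \<beta> n j) (x(j := y)) * ennreal (wpoly n ?I x y powr \<beta>) \<partial>dA)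
          \<le> (\<integral>\<^sup>+y. indicator (- nbhd) y * ennreal (wpoly n ?I x y powr \<beta>) + indicator nbhd y * (ennreal (1 / real n ^ 3) * ?m) \<partial>dA)"
          by (intro nn_integral_mono pw)
        also have "\<dots> = (\<integral>\<^sup>+y. indicator (- nbhd) y * ennreal (wpoly n ?I x y powr \<beta>) \<partial>dA)
            + (\<integral>\<^sup>+y. indicator nbhd y * (ennreal (1 / real n ^ 3) * ?m) \<partial>dA)"
          by (rule nn_integral_add) measurable
        also have "(\<integral>\<^sup>+y. indicator nbhd y * (ennreal (1 / real n ^ 3) * ?m) \<partial>dA) = ennreal (V / real n ^ 3) * ?m"
          using V by (subst nn_integral_multc) (auto simp: ennreal_mult[symmetric] mult.assoc[symmetric])
        also have "(\<integral>\<^sup>+y. indicator (- nbhd) y * ennreal (wpoly n ?I x y powr \<beta>) \<partial>dA) \<le> ennreal (K / real n ^ 3) * ?m"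
          using elim(1) \<beta> j by (auto simp: card_Diff_singleton)
        then have "(\<integral>\<^sup>+y. indicator (- nbhd) y * ennreal (wpoly n ?I x y powr \<beta>) \<partial>dA) + ennreal (V / real n ^ 3) * ?m
           \<le> ennreal (K / real n ^ 3) * ?m + ennreal (V / real n ^ 3) * ?m" by (rule add_right_mono)
        also have "\<dots> = ennreal ((K + V) / real n ^ 3) * ?m"
          using K V by (simp add: distrib_right[symmetric] ennreal_plus[symmetric] add_divide_distrib del: ennreal_plus)
        finally show "(\<integral>\<^sup>+y. indicator (bad_config \<beta> n j) (x(j := y)) * ennreal (wpoly n ?I x y powr \<beta>) \<partial>dA)
          \<le> ennreal ((K + V) / real n ^ 3) * ?m" .
      qed (use \<beta> in simp)
    qed
  qed
  then show ?thesis using K V(2) by (intro exI[of _ "K + V"]) auto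
qed

text \<open>For n \<ge> 2 the minimum is attained by some pair, and \<open>points_separated\<close>
  applies to it because every index is good.\<close>

lemma good_config_spacing:
  assumes n: "n \<ge> 2" "1 / sqrt (real n) \<le> \<rho>" and \<beta>: "\<beta> \<ge> 1" and c0: "c0 > 0" "\<beta> \<ge> c0 * ln (real n)"
    and \<zeta>: "\<zeta> \<in> space (dA_n n)" "\<And>j. j \<in> {1..n} \<Longrightarrow> \<zeta> \<notin> bad_config \<beta> n j"
  shows "spacing n \<zeta> \<ge> 1 / (2 * (1 + exp (A + 2 / c0)))"
proof -
  let ?D = "{cmod (\<zeta> j - \<zeta> k) | j k. j \<in> {1..n} \<and> k \<in> {1..n} \<and> j \<noteq> k}"
  have "?D = (\<lambda>(j, k). cmod (\<zeta> j - \<zeta> k)) ` {(j, k) \<in> {1..n} \<times> {1..n}. j \<noteq> k}" by auto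
  moreover have "finite {(j, k) \<in> {1..n} \<times> {1..n}. j \<noteq> k}"
    by (rule finite_subset[of _ "{1..n} \<times> {1..n}"]) auto
  ultimately have "finite ?D" by simp
  moreover have "cmod (\<zeta> 1 - \<zeta> 2) \<in> ?D" using n(1) by force
  ultimately have "Min ?D \<in> ?D" by (intro Min_in) auto
  then obtain j k where jk: "j \<in> {1..n}" "k \<in> {1..n}" "j \<noteq> k" "Min ?D = cmod (\<zeta> j - \<zeta> k)" by auto
  have good: "\<zeta> j \<in> nbhd" "wpoly_mass \<beta> n ({1..n} - {j}) \<zeta>
      \<le> ennreal (real n ^ 3) * ennreal (wpoly n ({1..n} - {j}) \<zeta> (\<zeta> j) powr \<beta>)"
    using \<zeta>(2)[OF jk(1)] \<zeta>(1) by (auto simp: bad_config_def not_less)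
  show ?thesis
    unfolding spacing_def jk(4)
    by (rule points_separated[OF good(1) _ _ _ n(2) \<beta> c0 good(2)]) (use jk n in auto)
qed

text \<open>A union bound over the n points loses one power of n; the threshold n^(-3) was chosen to
  leave a summable n^(-2).\<close>

lemma gibbs_not_separated:
  "\<exists>K::real. K \<ge> 0 \<and> (\<forall>\<^sub>F n in sequentially. \<forall>\<beta>. \<beta> \<ge> 1 \<longrightarrow> 0 < partition_function Q \<beta> n \<longrightarrow>
     partition_function Q \<beta> n < \<infinity> \<longrightarrow>
     emeasure (gibbs_measure Q \<beta> n) (\<Union>j\<in>{1..n}. bad_config \<beta> n j) \<le> ennreal (K / real n ^ 2))"
proof -
  obtain K where K: "K \<ge> 0" and bad: "\<forall>\<^sub>F n in sequentially. \<forall>\<beta> j. \<beta> \<ge> 1 \<longrightarrow> 0 < partition_function Q \<beta> n \<longrightarrow>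
     partition_function Q \<beta> n < \<infinity> \<longrightarrow> j \<in> {1..n} \<longrightarrow>
     emeasure (gibbs_measure Q \<beta> n) (bad_config \<beta> n j) \<le> ennreal (K / real n ^ 3)"
    using gibbs_bad_config by blast
  have "\<forall>\<^sub>F n in sequentially. \<forall>\<beta>. \<beta> \<ge> 1 \<longrightarrow> 0 < partition_function Q \<beta> n \<longrightarrow>
     partition_function Q \<beta> n < \<infinity> \<longrightarrow>
     emeasure (gibbs_measure Q \<beta> n) (\<Union>j\<in>{1..n}. bad_config \<beta> n j) \<le> ennreal (K / real n ^ 2)"
    using bad eventually_ge_at_top[of 1]
  proof eventually_elim
    case (elim n)
    show ?case
    proof (intro allI impI)
      fix \<beta> :: real assume h: "1 \<le> \<beta>" "0 < partition_function Q \<beta> n" "partition_function Q \<beta> n < \<infinity>"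
      let ?P = "gibbs_measure Q \<beta> n"
      have "emeasure ?P (\<Union>j\<in>{1..n}. bad_config \<beta> n j) \<le> (\<Sum>j\<in>{1..n}. emeasure ?P (bad_config \<beta> n j))"
        using bad_config_sets by (intro emeasure_subadditive_finite) (auto simp: gibbs_measure_def)
      also have "\<dots> \<le> (\<Sum>j\<in>{1..n}. ennreal (K / real n ^ 3))"
        using elim(1) h by (intro sum_mono) blast
      also have "\<dots> = ennreal (real n * (K / real n ^ 3))"
        using K by (subst sum_ennreal) auto
      also have "real n * (K / real n ^ 3) = K / real n ^ 2"
        using elim(2) by (simp add: power2_eq_square power3_eq_cube)
      finally show "emeasure ?P (\<Union>j\<in>{1..n}. bad_config \<beta> n j) \<le> ennreal (K / real n ^ 2)" .
    qed
  qed
  then show ?thesis using K by blast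
qed

text \<open>Each factor of the product measure is the marginal of its configuration, so the bad
  events have summable probabilities and Borel-Cantelli applies.\<close>

lemma AE_family_separated:
  assumes adm: "admissible_temperatures Q \<beta>" and c0: "c0 > 0" "\<And>n. n \<ge> 1 \<Longrightarrow> \<beta> n \<ge> c0 * ln (real n)"
  shows "AE \<zeta> in family_measure Q \<beta>. liminf (\<lambda>n. ereal (spacing n (\<zeta> n))) \<ge> ereal (1 / (2 * (1 + exp (A + 2 / c0))))"
proof -
  let ?s = "1 / (2 * (1 + exp (A + 2 / c0)))"
  let ?M = "family_measure Q \<beta>"
  have Z: "\<beta> n > 0" "0 < partition_function Q (\<beta> n) n" "partition_function Q (\<beta> n) n < \<infinity>" if "n \<ge> 1" for n
    using adm that by (auto simp: admissible_temperatures_def)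
  have prob: "prob_space (gibbs_measure Q (\<beta> n) n)" if "n \<in> {1..}" for n
    using prob_space_gibbs Z that by auto
  interpret M: prob_space ?M
    unfolding family_measure_def by (rule prob_space_PiM) (rule prob)
  obtain K where K: "K \<ge> 0" and bound: "\<forall>\<^sub>F n in sequentially. \<forall>\<beta>. \<beta> \<ge> 1 \<longrightarrow> 0 < partition_function Q \<beta> n \<longrightarrow>
     partition_function Q \<beta> n < \<infinity> \<longrightarrow>
     emeasure (gibbs_measure Q \<beta> n) (\<Union>j\<in>{1..n}. bad_config \<beta> n j) \<le> ennreal (K / real n ^ 2)"
    using gibbs_not_separated by blast
  \<comment> \<open>From n \<ge> exp(1/c0) on, \<beta> n \<ge> c0 log n \<ge> 1, as the mean value
    estimates require; n \<ge> 1/\<rho>^2 fits the discs of radius n^(-1/2) into the Taylor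
    neighbourhood.\<close>
  have ev_n: "\<forall>\<^sub>F n in sequentially. real n \<ge> max (max 2 (exp (1 / c0))) (1 / \<rho>\<^sup>2)"
    using filterlim_real_sequentially unfolding filterlim_at_top by blast
  have "\<forall>\<^sub>F n in sequentially. n \<ge> 2 \<and> 1 / sqrt (real n) \<le> \<rho> \<and> \<beta> n \<ge> 1 \<and>
     emeasure (gibbs_measure Q (\<beta> n) n) (\<Union>j\<in>{1..n}. bad_config (\<beta> n) n j) \<le> ennreal (K / real n ^ 2)"
    using bound ev_n
  proof eventually_elim
    case (elim n)
    have n: "n \<ge> 2" using elim(2) by simp
    have "1 \<le> real n * \<rho>\<^sup>2" using elim(2) \<rho> by (simp add: field_simps)
    then have "sqrt 1 \<le> sqrt (real n * \<rho>\<^sup>2)" by (rule real_sqrt_le_mono)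
    then have 1: "1 / sqrt (real n) \<le> \<rho>" using n \<rho> by (simp add: real_sqrt_mult field_simps)
    have "1 / c0 \<le> ln (real n)" using elim(2) n by (subst ln_ge_iff) auto
    then have "1 \<le> c0 * ln (real n)" using c0(1) by (simp add: field_simps)
    then have 2: "\<beta> n \<ge> 1" using c0(2)[of n] n by simp
    show ?case using n 1 2 elim(1) Z[of n] by auto
  qed
  then obtain N where N: "\<And>n. n \<ge> N \<Longrightarrow> n \<ge> 2 \<and> 1 / sqrt (real n) \<le> \<rho> \<and> \<beta> n \<ge> 1 \<and>
     emeasure (gibbs_measure Q (\<beta> n) n) (\<Union>j\<in>{1..n}. bad_config (\<beta> n) n j) \<le> ennreal (K / real n ^ 2)"
    unfolding eventually_sequentially by blast
  \<comment> \<open>Empty for the finitely many small n, so that measurability and the bound hold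
    for every n.\<close>
  define B where "B n = (if n \<ge> N then {\<zeta> \<in> space ?M. \<zeta> n \<in> (\<Union>j\<in>{1..n}. bad_config (\<beta> n) n j)} else {})" for n
  have comp: "(\<lambda>\<zeta>. \<zeta> n) \<in> measurable ?M (gibbs_measure Q (\<beta> n) n)" if "n \<ge> 1" for n
    unfolding family_measure_def using that by (intro measurable_component_singleton) auto
  have bad_sets: "(\<Union>j\<in>{1..n}. bad_config (\<beta> n) n j) \<in> sets (gibbs_measure Q (\<beta> n) n)" for n
    using bad_config_sets by (auto simp: gibbs_measure_def intro!: sets.finite_UN)
  have B_eq: "B n = (\<lambda>\<zeta>. \<zeta> n) -` (\<Union>j\<in>{1..n}. bad_config (\<beta> n) n j) \<inter> space ?M" if "n \<ge> N" for n
    using that by (auto simp: B_def)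
  have B_sets: "B n \<in> sets ?M" for n
  proof (cases "n \<ge> N")
    case True
    then show ?thesis using measurable_sets[OF comp bad_sets, of n] N[of n] B_eq[of n] by simp
  qed (simp add: B_def)
  have B_le: "measure ?M (B n) \<le> K * (1 / real n ^ 2)" for n
  proof (cases "n \<ge> N")
    case True
    have n1: "n \<ge> 1" using N[OF True] by simp
    have "emeasure ?M (B n) = emeasure (distr ?M (gibbs_measure Q (\<beta> n) n) (\<lambda>\<zeta>. \<zeta> n)) (\<Union>j\<in>{1..n}. bad_config (\<beta> n) n j)"
      unfolding B_eq[OF True] by (rule emeasure_distr[OF comp[OF n1] bad_sets, symmetric])
    also have "distr ?M (gibbs_measure Q (\<beta> n) n) (\<lambda>\<zeta>. \<zeta> n) = gibbs_measure Q (\<beta> n) n"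
      unfolding family_measure_def using prob n1
      by (intro distr_PiM_component[where M="\<lambda>n. gibbs_measure Q (\<beta> n) n"]) auto
    also have "emeasure (gibbs_measure Q (\<beta> n) n) (\<Union>j\<in>{1..n}. bad_config (\<beta> n) n j) \<le> ennreal (K / real n ^ 2)"
      using N[OF True] by blast
    finally show ?thesis using K by (simp add: M.emeasure_eq_measure)
  qed (use K in \<open>simp add: B_def\<close>)
  have "summable (\<lambda>n. measure ?M (B n))"
  proof (rule summable_comparison_test'[where N=0])
    show "summable (\<lambda>n. K * (1 / real n ^ 2))"
      using inverse_power_summable[of 2, where 'a=real] by (intro summable_mult) (simp add: inverse_eq_divide power_one_over)
    show "norm (measure ?M (B n)) \<le> K * (1 / real n ^ 2)" for n using B_le[of n] by simp
  qed
  then have "AE \<zeta> in ?M. \<forall>\<^sub>F n in sequentially. \<zeta> \<in> space ?M - B n"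
    using B_sets by (intro borel_cantelli_AE1) (auto simp: M.emeasure_eq_measure)
  then show ?thesis
  proof eventually_elim
    case (elim \<zeta>)
    have "\<forall>\<^sub>F n in sequentially. ereal ?s \<le> ereal (spacing n (\<zeta> n))"
      using elim eventually_ge_at_top[of N]
    proof eventually_elim
      case (elim n)
      have n: "n \<ge> 2" "1 / sqrt (real n) \<le> \<rho>" "\<beta> n \<ge> 1" using N[OF elim(2)] by auto
      have "\<zeta> n \<in> space (gibbs_measure Q (\<beta> n) n)"
        using measurable_space[OF comp[of n]] elim(1) n by auto
      then have "\<zeta> n \<in> space (dA_n n)" by (simp add: gibbs_measure_def)
      moreover have "\<zeta> n \<notin> bad_config (\<beta> n) n j" if "j \<in> {1..n}" for j
        using elim that by (auto simp: B_def)
      ultimately have "?s \<le> spacing n (\<zeta> n)"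
        using n c0(2)[of n] by (intro good_config_spacing[OF n(1,2,3) c0(1)]) auto
      then show ?case by simp
    qed
    then show ?case by (rule Liminf_bounded)
  qed
qed

end

section \<open>The separation constant of a droplet with conditions (1)-(4)\<close>

theorem theorem1p1:
  fixes Q :: "complex \<Rightarrow> ereal" and \<sigma> :: "complex measure" and S :: "complex set" and c :: real
  assumes potential: "external_potential Q"
    and equilibrium: "equilibrium_measure Q \<sigma>"
    and droplet: "S = measure_support \<sigma>"
    and smooth: "C2_near Q S"
    and cond1: "laplacian_pos_near Q (frontier S)"
    and cond2: "finite (components (frontier S))"
    and cond3: "\<And>C. C \<in> components (frontier S) \<Longrightarrow> C1_jordan_curve C"
    and cond4: "\<And>\<zeta>. \<zeta> \<notin> S \<Longrightarrow> Q \<zeta> > (SUP f\<in>obstacle_class Q. f \<zeta>)"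
    and c: "c > 0"
  shows "\<exists>s0::real. s0 > 0 \<and>
    (\<forall>\<beta>::nat \<Rightarrow> real.
       admissible_temperatures Q \<beta> \<and> (\<forall>n\<ge>1. \<beta> n \<ge> c * ln (real n)) \<longrightarrow>
       (AE \<zeta> in family_measure Q \<beta>. liminf (\<lambda>n. ereal (spacing n (\<zeta> n))) \<ge> ereal s0))"
proof -
  have \<sigma>: "prob_space \<sigma>" "sets \<sigma> = sets borel" and S: "compact S"
    using equilibrium unfolding equilibrium_measure_def compact_prob_measure_def droplet by auto
  have S_ne: "S \<noteq> {}" unfolding droplet by (rule measure_support_nonempty[OF \<sigma>])
  have Q_ninf: "\<And>z. Q z \<noteq> - \<infinity>" using potential by (auto simp: external_potential_def)
  interpret weighted_droplet "weight Q" S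
    by (rule weighted_droplet_weight[OF potential smooth S_ne cond4])
  obtain U where U: "open U" "S \<subseteq> U" and U_fin: "\<And>z. z \<in> U \<Longrightarrow> Q z < \<infinity>"
    and C2: "C2_smooth_on (\<lambda>z. real_of_ereal (Q z)) U"
    using smooth unfolding C2_near_def by blast
  obtain \<rho> A d where \<rho>: "\<rho> > 0" and A: "A \<ge> 0"
    and taylor: "\<And>s z w. s \<in> S \<Longrightarrow> z \<in> ball s (2 * \<rho>) \<Longrightarrow> w \<in> ball z \<rho> \<Longrightarrow> w \<in> U \<and>
      \<bar>real_of_ereal (Q w) - real_of_ereal (Q z) - Re (d z * (w - z))\<bar> \<le> A * (cmod (w - z))\<^sup>2"
    using C2_taylor_uniform[OF C2 U(1) S U(2)] by blast
  interpret coulomb_gas Q S \<rho> A d "\<lambda>z. real_of_ereal (Q z)"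
  proof
    show "weight Q w = exp (- real_of_ereal (Q w))" if "s \<in> S" "z \<in> ball s (2 * \<rho>)" "w \<in> ball z \<rho>" for s z w
      using taylor[OF that] U_fin[of w] by (auto simp: weight_def)
  qed (use \<rho> A S S_ne taylor Q_ninf in \<open>auto intro: compact_imp_bounded\<close>)
  \<comment> \<open>\<open>A\<close> was obtained from Q before any temperatures are fixed, so the
    constant depends on Q and c alone.\<close>
  show ?thesis
    using AE_family_separated[OF _ c]
    by (intro exI[of _ "1 / (2 * (1 + exp (A + 2 / c)))"]) (auto simp: add_pos_pos)
qed

end
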